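(* Let $\lambda/\mu$ be a skew diagram satisfying the positivity condition $\lambda'_{i+1}-\mu'_i\le n$ ($i=1,\dots,l-1$, $l=\lambda_1$). Let $P_{\mathrm{odd}}(\lambda/\mu)$ be the set of $p\in P_1(\lambda/\mu)$ having at least one odd $\mathrm I$- or $\mathrm{II}$-region. For $p\in P_{\mathrm{odd}}(\lambda/\mu)$ put $\iota_2(p)=\varepsilon_V(p)$, where $V$ is the unique odd $\mathrm I$- or $\mathrm{II}$-region of $p$ for which $\max\{\mathrm{hp}(w)\mid w\in V,\ \mathrm{ht}(w)=0\}$ is greatest among all odd $\mathrm I$- and $\mathrm{II}$-regions of $p$. Then $\iota_2:P_{\mathrm{odd}}(\lambda/\mu)\to P_{\mathrm{odd}}(\lambda/\mu)$ is a weight-preserving, sign-reversing involution: $\iota_2\circ\iota_2=\mathrm{id}$, $z_a^{\iota_2(p)}=z_a^p$ and $(-1)^{\iota_2(p)}=-(-1)^p$ for all $p$.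
   Context: Ring. Fix a positive integer $n$ (rank of type $D_n$) and $a\in\mathbb C$. $I=\{1,2,\dots,n,\overline n,\dots,\overline 2,\overline 1\}$. $\mathcal Z$ is the commutative ring over $\mathbb Z$ generated by $z_{i,b}$ ($i\in I$, $b\in\mathbb C$) with relations $z_{i,b}z_{\overline i,b-2n+2i}=z_{i-1,b}z_{\overline{i-1},b-2n+2i}$ ($i=1,\dots,n$), where $z_{0,b}=z_{\overline 0,b}=1$. A skew diagram $\lambda/\mu$ is a pair of partitions with $\lambda_i\ge\mu_i$ for all $i$; $\lambda',\mu'$ are the conjugates. Paths. For $w=(x,y)\in\mathbb R^2$ put $\mathrm{ht}(w)=x+y$ (height), $\mathrm{hp}(w)=\frac12(x-y)$ (horizontal position). Steps on $\mathbb Z^2$: NE-step $(x,y)\to(x+1,y)$, NW-step $(x,y)\to(x,y+1)$, E-step $(x,y)\to(x+1,y-1)$. A path is a sequence of consecutive NE-, NW-, E-steps from a lattice point of height $-n$ to one of height $n$, where E-steps occur only at height $0$ and their number is even. The weight $z_a^p\in\mathcal Z$ of a path $p$ is the product over its NE- and E-steps $s$ of $z_{L^1(s),a-2x}$, where $s$ starts at $(x,y)$, $m=x+y$, and $L^1(s)$ is: $n+1+m$ if $m<0$; $n$ if $m=0$ and $s$ is the 2nd, 4th, 6th, ... E-step of $p$; $\overline{n-m}$ otherwise. Put $u_i=(\mu'_i+1-i,-n-\mu'_i-1+i)$, $v_i=(\lambda'_i+1-i,n-\lambda'_i-1+i)$ for $1\le i\le l$. For $\sigma\in\mathfrak S_l$,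 $\mathfrak P(\sigma;u_\mu,v_\lambda)$ is the set of $l$-tuples $p=(p_1,\dots,p_l)$ of paths with $p_i$ from $u_i$ to $v_{\sigma(i)}$, and $\mathfrak P(u_\mu,v_\lambda)=\bigsqcup_\sigma\mathfrak P(\sigma;u_\mu,v_\lambda)$; for $p\in\mathfrak P(\sigma;u_\mu,v_\lambda)$, $z_a^p=\prod_iz_a^{p_i}$ and $(-1)^p=\mathrm{sgn}\,\sigma$. Two paths intersect if they share a lattice point. An intersecting pair $(p_i,p_j)$ is specially intersecting if the intersection occurs only at height $0$ and $p_i(0)-p_j(0)$ is odd, where $p_i(0)$ is the horizontal position of the leftmost point of $p_i$ at height $0$; otherwise it is ordinarily intersecting. $P_1(\lambda/\mu)$ is the set of $p\in\mathfrak P(u_\mu,v_\lambda)$ with no ordinarily intersecting pair $(p_i,p_j)$. Regions. $S_+=\{0\le\mathrm{ht}\le n\}$, $S_-=\{-n\le\mathrm{ht}\le0\}$. A lower (resp. upper) path is a sequence of consecutive NE/NW-steps from height $-n$ to $0$ (resp. from $0$ to $n$); $\alpha(r)$ denotes the horizontal position at height $r$. Duals: $\alpha^*(r)=\alpha(-r)-1$, $\beta^*(-r)=\beta(r)+1$ ($0\le r\le n$) for a lower path $\alpha$ and an upper path $\beta$. Removing all E-steps from $p\in P_1(\lambda/\mu)$ gives $\pi(p)=(\alpha;\beta)=(\alpha_1,\dots,\alpha_l;\beta_1,\dots,\beta_l)$, where $\alpha_i$ is the lower path starting at $u_i$ and $\beta_i$ the upper path ending at $v_i$. A unit $U\subset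 S_\pm$ is a unit square of the lattice inside $S_\pm$, or the half in $S_\pm$ of a unit square whose horizontal diagonal lies on the boundary of $S_\pm$; its height is the height of its left vertex; its left and right vertices have horizontal positions $c$ and $c'=c+1$. Let $\pm r=\mathrm{ht}(U)$, and set $\beta_{l+1}=\beta_{l+1}^*=-\infty$, $\alpha_0=\alpha_0^*=+\infty$. $U$ is a $\mathrm I$-unit if for some $0\le i\le l$: $\alpha^*_i(r)\le c<c'\le\beta_{i+1}(r)$ (if $U\subset S_+$), resp. $\alpha_i(-r)\le c<c'\le\beta^*_{i+1}(-r)$ (if $U\subset S_-$). $U$ is a $\mathrm{II}$-unit if for some $0\le i\le l$: $\beta_{i+1}(r)\le c<c'\le\alpha_i^*(r)$ (if $U\subset S_+$), resp. $\beta^*_{i+1}(-r)\le c<c'\le\alpha_i(-r)$ (if $U\subset S_-$); it is a boundary $\mathrm{II}$-unit if this holds with $i=0$, or $i=l$, or $r=n$. Two units are adjacent if the left or right vertex of one is also a vertex of the other. A connected component of the $\mathrm I$-units (resp. $\mathrm{II}$-units) is the union (in $S_+\sqcup S_-$) of an equivalence class for the equivalence relation on the set of $\mathrm I$-units (resp. $\mathrm{II}$-units) generated by adjacency. A $\mathrm I$-region is a connected component of the $\mathrm I$-units containing at least one $\mathrm I$-unit of height $0$; a $\mathrm{II}$-region is a connected component of the $\mathrm{II}$-units containing at least one $\mathrm{II}$-unit of height $0$ and no boundary $\mathrm{II}$-unit. For $1\le i\le l-1$ let $h=\alpha_i(0)-\beta_{i+1}(0)$; the pair $(\alpha_i,\beta_{i+1})$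 is an overlap if $h\le0$, a hole if $h>0$, and is even/odd according to the parity of $h$. It intersects $V$ at height $0$ if the height-$0$ endpoint of $\alpha_i$ lies in a unit of $V$ in $S_-$ or that of $\beta_{i+1}$ lies in a unit of $V$ in $S_+$. For a $\mathrm I$-region (resp. $\mathrm{II}$-region) $V$, $n(V)$ is the number of $i$ such that $(\alpha_i,\beta_{i+1})$ is an even overlap (resp. an even hole) intersecting $V$ at height $0$; $V$ is odd if $n(V)$ is odd. Expansion/folding. For a $\mathrm I$- or $\mathrm{II}$-region $V$ of $(\alpha;\beta)=\pi(p)$, $\varepsilon_V(\alpha;\beta)=(\alpha';\beta')$, where $\alpha'_i$ is obtained from $\alpha_i$ by replacing the part $\alpha_i\cap V$ with $\beta^*_{i+1}\cap V$, and $\beta'_i$ from $\beta_i$ by replacing $\beta_i\cap V$ with $\alpha^*_{i-1}\cap V$ (at each height where the lower path $\alpha_i$ meets the $S_-$-part of $V$, its position is replaced by that of $\beta^*_{i+1}$; at each height where $\beta_i$ meets the $S_+$-part of $V$, its position is replaced by that of $\alpha^*_{i-1}$). Then $\varepsilon_V(p)$ denotes the element $p'\in P_1(\lambda/\mu)$ with $\pi(p')=\varepsilon_V(\pi(p))$ (the E-steps at height $0$ being removed or inserted accordingly).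
   Formalization: Adjacency between a unit of S_+ and a unit of S_- is restricted to units of height 0 where the right vertex of the S_+ unit is the left vertex of the S_- unit; with all planar vertex coincidences admitted, ι_2 leaves P_odd already for n=1, λ=(2), μ=∅. *)

theory Defs
  imports
    "HOL-Algebra.QuotRing"
    "HOL-Algebra.Generated_Rings"
    "HOL-Algebra.Algebraic_Closure_Type"
    "HOL-Combinatorics.Permutations"
    "HOL-Library.Extended_Real"
    "HOL-Library.FuncSet"
    "HOL-Library.Poly_Mapping"
begin

section \<open>The ring of the variables \<open>z\<close>\<close>

datatype letter = Unbarred nat | Barred nat

definition letters :: "nat \<Rightarrow> letter set" where
  "letters n = Unbarred ` {1..n} \<union> Barred ` {1..n}"

text \<open>Polynomials with integer coefficients in indeterminates indexed by all of
  \<open>letter \<times> complex\<close>; \<open>zpoly_ring n\<close> keeps only those with letters in \<open>letters n\<close>.\<close>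

type_synonym zpoly = "((letter \<times> complex) \<Rightarrow>\<^sub>0 nat) \<Rightarrow>\<^sub>0 int"

definition zvar :: "letter \<Rightarrow> complex \<Rightarrow> zpoly" where
  "zvar i b = Poly_Mapping.single (Poly_Mapping.single (i, b) 1) 1"

definition zpoly_ring :: "nat \<Rightarrow> zpoly ring" where
  "zpoly_ring n = (ring_of_type_algebra :: zpoly ring)
     \<lparr>carrier := generate_ring ring_of_type_algebra {zvar i b | i b. i \<in> letters n}\<rparr>"

definition zvar0 :: "letter \<Rightarrow> complex \<Rightarrow> zpoly" where
  "zvar0 i b = (if i = Unbarred 0 \<or> i = Barred 0 then 1 else zvar i b)"

definition zrelations :: "nat \<Rightarrow> zpoly set" where
  "zrelations n =
     {zvar0 (Unbarred i) b * zvar0 (Barred i) (b - 2 * of_nat n + 2 * of_nat i)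
      - zvar0 (Unbarred (i - 1)) b * zvar0 (Barred (i - 1)) (b - 2 * of_nat n + 2 * of_nat i)
      | i b. i \<in> {1..n}}"

definition zideal :: "nat \<Rightarrow> zpoly set" where
  "zideal n = genideal (zpoly_ring n) (zrelations n)"

definition Zring :: "nat \<Rightarrow> zpoly set ring" where
  "Zring n = FactRing (zpoly_ring n) (zideal n)"

definition zgen :: "nat \<Rightarrow> letter \<Rightarrow> complex \<Rightarrow> zpoly set" where
  "zgen n i b = a_r_coset (zpoly_ring n) (zideal n) (zvar i b)"

section \<open>Skew diagrams\<close>

text \<open>Partitions are indexed from 1; the value at 0 is never used.\<close>

definition is_partition :: "(nat \<Rightarrow> nat) \<Rightarrow> bool" where
  "is_partition lam \<longleftrightarrow>
     (\<forall>i\<ge>1. lam (i + 1) \<le> lam i) \<and> finite {i. 1 \<le> i \<and> lam i \<noteq> 0}"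

definition conj_part :: "(nat \<Rightarrow> nat) \<Rightarrow> nat \<Rightarrow> nat" where
  "conj_part lam i = card {j. 1 \<le> j \<and> i \<le> lam j}"

definition skew_diagram :: "(nat \<Rightarrow> nat) \<Rightarrow> (nat \<Rightarrow> nat) \<Rightarrow> bool" where
  "skew_diagram lam mu \<longleftrightarrow>
     is_partition lam \<and> is_partition mu \<and> (\<forall>i\<ge>1. mu i \<le> lam i)"

section \<open>Paths\<close>

type_synonym point = "int \<times> int"
type_synonym path = "point list"

definition lat :: "point \<Rightarrow> real \<times> real" where
  "lat w = (of_int (fst w), of_int (snd w))"

definition ht :: "'a :: linordered_idom \<times> 'a \<Rightarrow> 'a" where
  "ht w = fst w + snd w"

definition hp :: "real \<times> real \<Rightarrow> real" where
  "hp w = (fst w - snd w) / 2"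

definition even_real :: "real \<Rightarrow> bool" where
  "even_real t \<longleftrightarrow> (\<exists>k::int. even k \<and> t = of_int k)"

definition odd_real :: "real \<Rightarrow> bool" where
  "odd_real t \<longleftrightarrow> (\<exists>k::int. odd k \<and> t = of_int k)"

definition NE_step :: "point \<times> point \<Rightarrow> bool" where
  "NE_step s \<longleftrightarrow> snd s = (fst (fst s) + 1, snd (fst s))"

definition NW_step :: "point \<times> point \<Rightarrow> bool" where
  "NW_step s \<longleftrightarrow> snd s = (fst (fst s), snd (fst s) + 1)"

definition E_step :: "point \<times> point \<Rightarrow> bool" where
  "E_step s \<longleftrightarrow> snd s = (fst (fst s) + 1, snd (fst s) - 1)"

definition steps :: "path \<Rightarrow> (point \<times> point) list" where
  "steps q = zip q (tl q)"

definition is_path :: "nat \<Rightarrow> path \<Rightarrow> bool" where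
  "is_path n q \<longleftrightarrow> q \<noteq> [] \<and> ht (hd q) = - int n \<and> ht (last q) = int n \<and>
     (\<forall>s\<in>set (steps q). NE_step s \<or> NW_step s \<or> (E_step s \<and> ht (fst s) = 0)) \<and>
     even (length (filter E_step (steps q)))"

text \<open>\<open>L1 n q k\<close> is the letter of the \<open>k\<close>-th step (counted from 0) of \<open>q\<close>. An E-step is
  the 2nd, 4th, ... E-step iff the number of E-steps up to and including it is even.\<close>

definition L1 :: "nat \<Rightarrow> path \<Rightarrow> nat \<Rightarrow> letter" where
  "L1 n q k = (let m = ht (fst (steps q ! k)) in
     if m < 0 then Unbarred (nat (int n + 1 + m))
     else if m = 0 \<and> E_step (steps q ! k) \<and> even (length (filter E_step (take (Suc k) (steps q))))
       then Unbarred n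
     else Barred (nat (int n - m)))"

definition path_weight :: "nat \<Rightarrow> complex \<Rightarrow> path \<Rightarrow> zpoly set" where
  "path_weight n a q =
     finprod (Zring n) (\<lambda>k. zgen n (L1 n q k) (a - 2 * of_int (fst (fst (steps q ! k)))))
       {k. k < length (steps q) \<and> (NE_step (steps q ! k) \<or> E_step (steps q ! k))}"

definition u_pt :: "nat \<Rightarrow> (nat \<Rightarrow> nat) \<Rightarrow> nat \<Rightarrow> point" where
  "u_pt n mu i = (int (conj_part mu i) + 1 - int i,
                  - int n - int (conj_part mu i) - 1 + int i)"

definition v_pt :: "nat \<Rightarrow> (nat \<Rightarrow> nat) \<Rightarrow> nat \<Rightarrow> point" where
  "v_pt n lam i = (int (conj_part lam i) + 1 - int i,
                   int n - int (conj_part lam i) - 1 + int i)"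

text \<open>The permutation is a component of a tuple of paths, so that the union over all
  permutations is disjoint. Tuples are extensional functions on \<open>{1..l}\<close>, with \<open>l = lam 1\<close>.\<close>

type_synonym path_tuple = "(nat \<Rightarrow> nat) \<times> (nat \<Rightarrow> path)"

definition path_tuples :: "nat \<Rightarrow> (nat \<Rightarrow> nat) \<Rightarrow> (nat \<Rightarrow> nat) \<Rightarrow> path_tuple set" where
  "path_tuples n lam mu =
     {(\<sigma>, q). \<sigma> permutes {1..lam 1} \<and>
        q \<in> (\<Pi>\<^sub>E i\<in>{1..lam 1}.
               {r. is_path n r \<and> hd r = u_pt n mu i \<and> last r = v_pt n lam (\<sigma> i)})}"

definition tuple_weight :: "nat \<Rightarrow> complex \<Rightarrow> nat \<Rightarrow> path_tuple \<Rightarrow> zpoly set" where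
  "tuple_weight n a l p = finprod (Zring n) (\<lambda>i. path_weight n a (snd p i)) {1..l}"

definition tuple_sign :: "path_tuple \<Rightarrow> int" where
  "tuple_sign p = sign (fst p)"

definition intersecting :: "path \<Rightarrow> path \<Rightarrow> bool" where
  "intersecting q q' \<longleftrightarrow> set q \<inter> set q' \<noteq> {}"

definition leftmost0 :: "path \<Rightarrow> real" where
  "leftmost0 q = Min ((\<lambda>w. hp (lat w)) ` {w \<in> set q. ht w = 0})"

definition specially_intersecting :: "path \<Rightarrow> path \<Rightarrow> bool" where
  "specially_intersecting q q' \<longleftrightarrow> intersecting q q' \<and>
     (\<forall>w\<in>set q \<inter> set q'. ht w = 0) \<and> odd_real (leftmost0 q - leftmost0 q')"

definition ordinarily_intersecting :: "path \<Rightarrow> path \<Rightarrow> bool" where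
  "ordinarily_intersecting q q' \<longleftrightarrow> intersecting q q' \<and> \<not> specially_intersecting q q'"

definition P1 :: "nat \<Rightarrow> (nat \<Rightarrow> nat) \<Rightarrow> (nat \<Rightarrow> nat) \<Rightarrow> path_tuple set" where
  "P1 n lam mu = {p \<in> path_tuples n lam mu.
     \<forall>i\<in>{1..lam 1}. \<forall>j\<in>{1..lam 1}. i \<noteq> j \<longrightarrow>
       \<not> ordinarily_intersecting (snd p i) (snd p j)}"

section \<open>Lower and upper paths\<close>

definition lower_part :: "path \<Rightarrow> path" where
  "lower_part q = filter (\<lambda>w. ht w < 0) q @ [hd (filter (\<lambda>w. ht w = 0) q)]"

definition upper_part :: "path \<Rightarrow> path" where
  "upper_part q = last (filter (\<lambda>w. ht w = 0) q) # filter (\<lambda>w. ht w > 0) q"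

text \<open>The pair \<open>(\<alpha>; \<beta>)\<close>: lower paths are numbered by their starting points, upper paths by
  their end points.\<close>

type_synonym half_paths = "(nat \<Rightarrow> path) \<times> (nat \<Rightarrow> path)"

definition pi_map :: "nat \<Rightarrow> path_tuple \<Rightarrow> half_paths" where
  "pi_map l p =
     ((\<lambda>i\<in>{1..l}. lower_part (snd p i)),
      (\<lambda>j\<in>{1..l}. upper_part (snd p (inv_into {1..l} (fst p) j))))"

definition hpos :: "path \<Rightarrow> int \<Rightarrow> real" where
  "hpos q r = hp (lat (THE w. w \<in> set q \<and> ht w = r))"

text \<open>Positions with the conventions \<open>\<alpha>\<^sub>0 = \<infinity>\<close> and \<open>\<beta>\<^bsub>l+1\<^esub> = - \<infinity>\<close>, and their duals.
  The dual of a lower path lives at heights \<open>0..n\<close>, that of an upper path at heights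
  \<open>-n..0\<close>; the last argument is always the actual height.\<close>

definition low :: "half_paths \<Rightarrow> nat \<Rightarrow> int \<Rightarrow> ereal" where
  "low c i r = (if i = 0 then \<infinity> else ereal (hpos (fst c i) r))"

definition upp :: "nat \<Rightarrow> half_paths \<Rightarrow> nat \<Rightarrow> int \<Rightarrow> ereal" where
  "upp l c i r = (if i = l + 1 then - \<infinity> else ereal (hpos (snd c i) r))"

definition low_dual :: "half_paths \<Rightarrow> nat \<Rightarrow> int \<Rightarrow> ereal" where
  "low_dual c i r = low c i (- r) - 1"

definition upp_dual :: "nat \<Rightarrow> half_paths \<Rightarrow> nat \<Rightarrow> int \<Rightarrow> ereal" where
  "upp_dual l c i r = upp l c i (- r) + 1"

section \<open>Units\<close>

datatype side = Upper | Lower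

fun strip :: "nat \<Rightarrow> side \<Rightarrow> ('a :: linordered_idom \<times> 'a) set" where
  "strip n Upper = {w. 0 \<le> ht w \<and> ht w \<le> of_nat n}"
| "strip n Lower = {w. - of_nat n \<le> ht w \<and> ht w \<le> 0}"

text \<open>A unit is given by its side and its left vertex \<open>(x, y)\<close>; it is the part inside the
  strip of the unit square \<open>[x, x+1] \<times> [y-1, y]\<close>. The left vertex may have any height
  occurring in the strip: at the two extreme heights the horizontal diagonal lies on the
  boundary and only a half of the square remains; otherwise the whole square is in the strip.\<close>

type_synonym lunit = "side \<times> point"

definition lunits :: "nat \<Rightarrow> lunit set" where
  "lunits n = {(s, w). w \<in> strip n s}"

definition left_vertex :: "lunit \<Rightarrow> point" where
  "left_vertex U = snd U"

definition right_vertex :: "lunit \<Rightarrow> point" where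
  "right_vertex U = (fst (snd U) + 1, snd (snd U) - 1)"

definition lunit_vertices :: "nat \<Rightarrow> lunit \<Rightarrow> point set" where
  "lunit_vertices n U =
     {fst (snd U), fst (snd U) + 1} \<times> {snd (snd U) - 1, snd (snd U)} \<inter> strip n (fst U)"

definition lunit_height :: "lunit \<Rightarrow> int" where
  "lunit_height U = ht (left_vertex U)"

text \<open>Points of the disjoint union of the two strips carry their side as a tag.\<close>

type_synonym spoint = "side \<times> real \<times> real"

definition lunit_points :: "nat \<Rightarrow> lunit \<Rightarrow> spoint set" where
  "lunit_points n U =
     (\<lambda>w. (fst U, w)) `
       ({of_int (fst (snd U)) .. of_int (fst (snd U)) + 1} \<times>
        {of_int (snd (snd U)) - 1 .. of_int (snd (snd U))} \<inter> strip n (fst U))"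

definition I_at :: "nat \<Rightarrow> half_paths \<Rightarrow> nat \<Rightarrow> lunit \<Rightarrow> bool" where
  "I_at l c i U =
     (let x = ereal (hp (lat (left_vertex U))); x' = ereal (hp (lat (right_vertex U)));
          h = lunit_height U in
      case fst U of
        Upper \<Rightarrow> low_dual c i h \<le> x \<and> x' \<le> upp l c (i + 1) h
      | Lower \<Rightarrow> low c i h \<le> x \<and> x' \<le> upp_dual l c (i + 1) h)"

definition II_at :: "nat \<Rightarrow> half_paths \<Rightarrow> nat \<Rightarrow> lunit \<Rightarrow> bool" where
  "II_at l c i U =
     (let x = ereal (hp (lat (left_vertex U))); x' = ereal (hp (lat (right_vertex U)));
          h = lunit_height U in
      case fst U of
        Upper \<Rightarrow> upp l c (i + 1) h \<le> x \<and> x' \<le> low_dual c i h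
      | Lower \<Rightarrow> upp_dual l c (i + 1) h \<le> x \<and> x' \<le> low c i h)"

definition I_units :: "nat \<Rightarrow> nat \<Rightarrow> half_paths \<Rightarrow> lunit set" where
  "I_units n l c = {U \<in> lunits n. \<exists>i\<in>{0..l}. I_at l c i U}"

definition II_units :: "nat \<Rightarrow> nat \<Rightarrow> half_paths \<Rightarrow> lunit set" where
  "II_units n l c = {U \<in> lunits n. \<exists>i\<in>{0..l}. II_at l c i U}"

definition boundary_II_units :: "nat \<Rightarrow> nat \<Rightarrow> half_paths \<Rightarrow> lunit set" where
  "boundary_II_units n l c =
     {U \<in> II_units n l c. II_at l c 0 U \<or> II_at l c l U \<or> \<bar>lunit_height U\<bar> = int n}"

section \<open>Regions\<close>

text \<open>Vertices are points of the disjoint union of the two strips. Its two lines of height 0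
  are not identified pointwise: the duality \<open>\<alpha> \<mapsto> \<alpha>\<^sup>*\<close> shifts positions by one, and
  exchanges the upper unit of height \<open>r\<close> and left position \<open>c\<close> with the lower unit of height
  \<open>-r\<close> and left position \<open>c + 1\<close>. Accordingly units on different sides are adjacent only
  if they have height 0 and the right vertex of the upper one is the left vertex of the lower
  one, i.e. if they are dual to each other. If all coincidences of planar vertices across the
  line of height 0 were admitted, regions would not be stable under duality; for
  \<open>n = 1\<close>, \<open>\<lambda> = (2)\<close>, \<open>\<mu> = \<emptyset>\<close> expansion would already lead out of \<open>P_odd\<close>.\<close>

definition adjacent_same_side :: "nat \<Rightarrow> lunit \<Rightarrow> lunit \<Rightarrow> bool" where
  "adjacent_same_side n U W \<longleftrightarrow> fst U = fst W \<and>
     (left_vertex U \<in> lunit_vertices n W \<or> right_vertex U \<in> lunit_vertices n W \<or>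
      left_vertex W \<in> lunit_vertices n U \<or> right_vertex W \<in> lunit_vertices n U)"

definition adjacent_across :: "lunit \<Rightarrow> lunit \<Rightarrow> bool" where
  "adjacent_across U W \<longleftrightarrow> fst U = Upper \<and> fst W = Lower \<and>
     lunit_height U = 0 \<and> lunit_height W = 0 \<and> right_vertex U = left_vertex W"

definition adjacent :: "nat \<Rightarrow> lunit \<Rightarrow> lunit \<Rightarrow> bool" where
  "adjacent n U W \<longleftrightarrow>
     adjacent_same_side n U W \<or> adjacent_across U W \<or> adjacent_across W U"

definition unit_classes :: "nat \<Rightarrow> lunit set \<Rightarrow> lunit set set" where
  "unit_classes n S = S // {(U, W). U \<in> S \<and> W \<in> S \<and> adjacent n U W}\<^sup>*"

definition I_regions :: "nat \<Rightarrow> nat \<Rightarrow> half_paths \<Rightarrow> spoint set set" where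
  "I_regions n l c =
     {\<Union> (lunit_points n ` C) | C. C \<in> unit_classes n (I_units n l c) \<and>
        (\<exists>U\<in>C. lunit_height U = 0)}"

definition II_regions :: "nat \<Rightarrow> nat \<Rightarrow> half_paths \<Rightarrow> spoint set set" where
  "II_regions n l c =
     {\<Union> (lunit_points n ` C) | C. C \<in> unit_classes n (II_units n l c) \<and>
        (\<exists>U\<in>C. lunit_height U = 0) \<and> C \<inter> boundary_II_units n l c = {}}"

definition gap :: "half_paths \<Rightarrow> nat \<Rightarrow> real" where
  "gap c i = hpos (fst c i) 0 - hpos (snd c (i + 1)) 0"

text \<open>For a lower path the height-0 endpoint is its last point, for an upper path its first.\<close>

definition meets0 :: "half_paths \<Rightarrow> nat \<Rightarrow> spoint set \<Rightarrow> bool" where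
  "meets0 c i V \<longleftrightarrow>
     (Lower, lat (last (fst c i))) \<in> V \<or> (Upper, lat (hd (snd c (i + 1)))) \<in> V"

definition n_I :: "nat \<Rightarrow> half_paths \<Rightarrow> spoint set \<Rightarrow> nat" where
  "n_I l c V = card {i \<in> {1..<l}. gap c i \<le> 0 \<and> even_real (gap c i) \<and> meets0 c i V}"

definition n_II :: "nat \<Rightarrow> half_paths \<Rightarrow> spoint set \<Rightarrow> nat" where
  "n_II l c V = card {i \<in> {1..<l}. gap c i > 0 \<and> even_real (gap c i) \<and> meets0 c i V}"

definition odd_regions :: "nat \<Rightarrow> nat \<Rightarrow> half_paths \<Rightarrow> spoint set set" where
  "odd_regions n l c =
     {V \<in> I_regions n l c. odd (n_I l c V)} \<union> {V \<in> II_regions n l c. odd (n_II l c V)}"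

definition rightmost0 :: "spoint set \<Rightarrow> real" where
  "rightmost0 V = (GREATEST t. \<exists>s w. (s, w) \<in> V \<and> ht w = 0 \<and> t = hp w)"

section \<open>Expansion and folding\<close>

definition point_at :: "int \<Rightarrow> ereal \<Rightarrow> point" where
  "point_at r t = (THE w. ht w = r \<and> ereal (hp (lat w)) = t)"

text \<open>A region never meets \<open>\<alpha>\<^sub>l\<close> on the lower side or \<open>\<beta>\<^sub>1\<close> on the upper side, so the infinite
  positions are not used here.\<close>

definition eps :: "nat \<Rightarrow> spoint set \<Rightarrow> half_paths \<Rightarrow> half_paths" where
  "eps l V c =
     ((\<lambda>i\<in>{1..l}. map (\<lambda>w. if (Lower, lat w) \<in> V
                           then point_at (ht w) (upp_dual l c (i + 1) (ht w)) else w) (fst c i)),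
      (\<lambda>i\<in>{1..l}. map (\<lambda>w. if (Upper, lat w) \<in> V
                           then point_at (ht w) (low_dual c (i - 1) (ht w)) else w) (snd c i)))"

definition is_eps_tuple ::
  "nat \<Rightarrow> (nat \<Rightarrow> nat) \<Rightarrow> (nat \<Rightarrow> nat) \<Rightarrow> spoint set \<Rightarrow> path_tuple \<Rightarrow> path_tuple \<Rightarrow> bool" where
  "is_eps_tuple n lam mu V p p' \<longleftrightarrow>
     p' \<in> P1 n lam mu \<and> pi_map (lam 1) p' = eps (lam 1) V (pi_map (lam 1) p)"

definition eps_tuple ::
  "nat \<Rightarrow> (nat \<Rightarrow> nat) \<Rightarrow> (nat \<Rightarrow> nat) \<Rightarrow> spoint set \<Rightarrow> path_tuple \<Rightarrow> path_tuple" where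
  "eps_tuple n lam mu V p = (THE p'. is_eps_tuple n lam mu V p p')"

definition P_odd :: "nat \<Rightarrow> (nat \<Rightarrow> nat) \<Rightarrow> (nat \<Rightarrow> nat) \<Rightarrow> path_tuple set" where
  "P_odd n lam mu = {p \<in> P1 n lam mu. odd_regions n (lam 1) (pi_map (lam 1) p) \<noteq> {}}"

definition is_top_odd_region :: "nat \<Rightarrow> nat \<Rightarrow> path_tuple \<Rightarrow> spoint set \<Rightarrow> bool" where
  "is_top_odd_region n l p V \<longleftrightarrow> V \<in> odd_regions n l (pi_map l p) \<and>
     (\<forall>W\<in>odd_regions n l (pi_map l p). rightmost0 W \<le> rightmost0 V)"

definition top_odd_region :: "nat \<Rightarrow> nat \<Rightarrow> path_tuple \<Rightarrow> spoint set" where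
  "top_odd_region n l p = (THE V. is_top_odd_region n l p V)"

definition iota2 :: "nat \<Rightarrow> (nat \<Rightarrow> nat) \<Rightarrow> (nat \<Rightarrow> nat) \<Rightarrow> path_tuple \<Rightarrow> path_tuple" where
  "iota2 n lam mu p = eps_tuple n lam mu (top_odd_region n (lam 1) p) p"

end

theory Submission
  imports Defs
begin

text \<open>
  Record \<open>\<alpha>\<^sub>i\<close> and the dual \<open>\<beta>\<^sub>j\<^sup>*\<close> by their integer abscissae at each height in \<open>[-n, 0]\<close>. Everything about
  units depends only on the predicates \<open>P i s x = (\<alpha>\<^sub>i(s) \<le> x)\<close> and \<open>Q i s x = (\<beta>\<^sup>*\<^sub>i\<^sub>+\<^sub>1(s) \<le> x)\<close>, for \<open>0 \<le> i \<le> l\<close>: a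
  I-unit is a cell where \<open>P\<close> holds and \<open>Q\<close> fails for some \<open>i\<close>, a II-unit one where \<open>Q\<close> holds and \<open>P\<close> fails.
  The two kinds of units are exchanged by exchanging \<open>P\<close> and \<open>Q\<close>, they are never adjacent, and expansion
  or folding along a region simply exchanges \<open>P\<close> and \<open>Q\<close> on the cells of the region. Hence the set of
  regions does not change, only the type of one region does, and expanding twice gives back the pair.

  At height 0, an element of \<open>P\<^sub>1\<close> matches the \<open>\<alpha>\<close>s with the \<open>\<beta>\<close>s inside each of the two parity classes so
  that the intervals of E-steps of one class are disjoint. An exchange adds or removes one interval in both
  classes simultaneously, which keeps the matching possible and unique. The permutation is increasing on
  each class, so its sign is read off the indices in one class, and every even pair of an exchanged region
  changes it.

  The relations of the ring say that the weight does not change when a pair of half paths is pushed across a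
  unit square. Pushing whole rows of units down to height 0 leaves one product per unit of height 0, which
  is compensated by the E-steps.
\<close>

section \<open>Exchanging thresholds on a union of components\<close>

text \<open>Predicates are used instead of positions because the conventional paths of index 0 and
  \<open>l + 1\<close> are infinite: they become constant predicates, \<open>P 0\<close> false and
  \<open>Q l\<close> true. Two obstacles shape the proof. \<open>eps\<close> tests whether path
  points lie in the region, while the symmetric description exchanges cells; both agree because a
  path point that is a vertex of the region either bounds a row of its cells or lies where the two
  curves coincide. And nothing in the exchange itself says that the new half paths can be joined by
  E-steps. This is recovered by counting: inside an overlap the coverages of the two parity classes
  add up to 2, inside a hole to 0, so changing both by one keeps each in {0, 1}. Positivity keeps
  I-cells away from the extreme heights, where endpoints are prescribed; for II-regions the
  exclusion of boundary units does this. The weight is compared only for exchanges along I-cells;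
  the other case is read backwards.\<close>

definition threshold_family :: "nat \<Rightarrow> nat \<Rightarrow> (nat \<Rightarrow> int \<Rightarrow> int \<Rightarrow> bool) \<Rightarrow> bool" where
  "threshold_family n l P \<longleftrightarrow>
     (\<forall>i\<le>l. \<forall>s x. - int n \<le> s \<longrightarrow> s \<le> 0 \<longrightarrow> P i s x \<longrightarrow> P i s (x + 1)) \<and>
     (\<forall>i<l. \<forall>s x. - int n \<le> s \<longrightarrow> s \<le> 0 \<longrightarrow> P i s x \<longrightarrow> P (Suc i) s (x - 1)) \<and>
     (\<forall>i\<le>l. \<forall>s x. - int n \<le> s \<longrightarrow> s < 0 \<longrightarrow> P i s x \<longrightarrow> P i (s + 1) (x + 1)) \<and>
     (\<forall>i\<le>l. \<forall>s x. - int n \<le> s \<longrightarrow> s < 0 \<longrightarrow> P i (s + 1) x \<longrightarrow> P i s x)"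

text \<open>A cell \<open>(x, s)\<close> stands for the lower unit whose left vertex has abscissa
  \<open>x\<close> and height \<open>s\<close>, and at the same time for the dual upper
  unit.\<close>

definition cells ::
  "nat \<Rightarrow> nat \<Rightarrow> (nat \<Rightarrow> int \<Rightarrow> int \<Rightarrow> bool) \<Rightarrow> (nat \<Rightarrow> int \<Rightarrow> int \<Rightarrow> bool) \<Rightarrow> (int \<times> int) set" where
  "cells n l P Q = {(x, s). - int n \<le> s \<and> s \<le> 0 \<and> (\<exists>i\<le>l. P i s x \<and> \<not> Q i s x)}"

text \<open>Neighbours one height up or down share an edge, neighbours of the same height share the
  left or right vertex. Units two heights apart that touch in a top and a bottom vertex are not
  adjacent.\<close>

definition cell_adj :: "int \<times> int \<Rightarrow> int \<times> int \<Rightarrow> bool" where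
  "cell_adj U W \<longleftrightarrow>
     snd W = snd U \<and> \<bar>fst W - fst U\<bar> \<le> 1 \<or>
     snd W = snd U + 1 \<and> fst W - fst U \<in> {0, 1} \<or>
     snd W = snd U - 1 \<and> fst U - fst W \<in> {0, 1}"

definition swap_on ::
  "(int \<times> int) set \<Rightarrow> (nat \<Rightarrow> int \<Rightarrow> int \<Rightarrow> bool) \<Rightarrow> (nat \<Rightarrow> int \<Rightarrow> int \<Rightarrow> bool) \<Rightarrow> nat \<Rightarrow> int \<Rightarrow> int \<Rightarrow> bool" where
  "swap_on C P Q i s x = (if (x, s) \<in> C then Q i s x else P i s x)"

text \<open>\<open>C\<close> need not lie in \<open>S\<close>, so that one set can be tested against
  both kinds of cells.\<close>

definition closed_in :: "(int \<times> int) set \<Rightarrow> (int \<times> int) set \<Rightarrow> bool" where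
  "closed_in S C \<longleftrightarrow> (\<forall>U W. U \<in> C \<longrightarrow> U \<in> S \<longrightarrow> W \<in> S \<longrightarrow> cell_adj U W \<longrightarrow> W \<in> C)"

lemma threshold_familyD:
  assumes "threshold_family n l P"
  shows "i \<le> l \<Longrightarrow> - int n \<le> s \<Longrightarrow> s \<le> 0 \<Longrightarrow> P i s x \<Longrightarrow> P i s (x + 1)"
    and "i < l \<Longrightarrow> - int n \<le> s \<Longrightarrow> s \<le> 0 \<Longrightarrow> P i s x \<Longrightarrow> P (Suc i) s (x - 1)"
    and "i \<le> l \<Longrightarrow> - int n \<le> s \<Longrightarrow> s < 0 \<Longrightarrow> P i s x \<Longrightarrow> P i (s + 1) (x + 1)"
    and "i \<le> l \<Longrightarrow> - int n \<le> s \<Longrightarrow> s < 0 \<Longrightarrow> P i (s + 1) x \<Longrightarrow> P i s x"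
proof -
  note D = assms[unfolded threshold_family_def]
  show "i \<le> l \<Longrightarrow> - int n \<le> s \<Longrightarrow> s \<le> 0 \<Longrightarrow> P i s x \<Longrightarrow> P i s (x + 1)"
    by (rule D[THEN conjunct1, rule_format])
  show "i < l \<Longrightarrow> - int n \<le> s \<Longrightarrow> s \<le> 0 \<Longrightarrow> P i s x \<Longrightarrow> P (Suc i) s (x - 1)"
    by (rule D[THEN conjunct2, THEN conjunct1, rule_format])
  show "i \<le> l \<Longrightarrow> - int n \<le> s \<Longrightarrow> s < 0 \<Longrightarrow> P i s x \<Longrightarrow> P i (s + 1) (x + 1)"
    by (rule D[THEN conjunct2, THEN conjunct2, THEN conjunct1, rule_format])
  show "i \<le> l \<Longrightarrow> - int n \<le> s \<Longrightarrow> s < 0 \<Longrightarrow> P i (s + 1) x \<Longrightarrow> P i s x"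
    by (rule D[THEN conjunct2, THEN conjunct2, THEN conjunct2, rule_format])
qed

lemma threshold_mono:
  assumes "threshold_family n l P" "i \<le> l" "- int n \<le> s" "s \<le> 0" "P i s x" "x \<le> y"
  shows "P i s y"
  using assms(6)
proof (induction y rule: int_ge_induct)
  case base
  then show ?case using assms by simp
next
  case (step y)
  then show ?case using threshold_familyD(1)[OF assms(1-4)] by blast
qed



lemma threshold_index_mono:
  assumes P: "threshold_family n l P" and "i < j" "j \<le> l" and s: "- int n \<le> s" "s \<le> 0" and "P i s x"
  shows "P j s (x - 1)"
  using \<open>i < j\<close> \<open>j \<le> l\<close>
proof (induction j)
  case (Suc j)
  show ?case
  proof (cases "i = j")
    case True
    then show ?thesis using threshold_familyD(2)[OF P] Suc.prems s \<open>P i s x\<close> by auto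
  next
    case False
    with Suc have "P j s (x - 1)" by auto
    then have "P (Suc j) s (x - 1 - 1)"
      using threshold_familyD(2)[OF P, of j s "x - 1"] Suc.prems s by auto
    then show ?thesis
      using threshold_mono[OF P, of "Suc j" s "x - 1 - 1" "x - 1"] Suc.prems s by auto
  qed
qed simp

lemma cellsI: "P i s x \<Longrightarrow> \<not> Q i s x \<Longrightarrow> i \<le> l \<Longrightarrow> - int n \<le> s \<Longrightarrow> s \<le> 0 \<Longrightarrow> (x, s) \<in> cells n l P Q"
  unfolding cells_def by blast

lemma cell_adj_sym: "cell_adj U W \<Longrightarrow> cell_adj W U"
  unfolding cell_adj_def by auto

text \<open>Here \<open>u\<close> and \<open>w\<close> say whether the source and the target cell
  are exchanged. The implication could fail only if exactly one of them is, and then both cells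
  separate the two predicates in the same direction; the last two hypotheses exclude this.\<close>

lemma swap_step:
  assumes "if u then q else p" "p \<longrightarrow> p'" "q \<longrightarrow> q'"
    and "p \<and> \<not> q \<and> p' \<and> \<not> q' \<longrightarrow> (u \<longleftrightarrow> w)" "q \<and> \<not> p \<and> q' \<and> \<not> p' \<longrightarrow> (u \<longleftrightarrow> w)"
  shows "if w then q' else p'"
  using assms by argo

text \<open>Each of the four rules leads from a cell to an adjacent one. If both cells are of the
  same type, closedness puts both or neither of them into \<open>C\<close>, and
  \<open>swap_step\<close> applies.\<close>

lemma threshold_family_swap_on:
  assumes P: "threshold_family n l P" and Q: "threshold_family n l Q"
    and cl: "closed_in (cells n l P Q) C" "closed_in (cells n l Q P) C"
  shows "threshold_family n l (swap_on C P Q)"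
proof -
  have main: "W \<in> C \<longleftrightarrow> U \<in> C"
    if "cell_adj U W" "U \<in> cells n l P Q \<and> W \<in> cells n l P Q \<or> U \<in> cells n l Q P \<and> W \<in> cells n l Q P" for U W
    using that cl cell_adj_sym unfolding closed_in_def by blast
  have move: "swap_on C P Q j t y"
    if "i \<le> l" "- int n \<le> s" "s \<le> 0" "j \<le> l" "- int n \<le> t" "t \<le> 0" "cell_adj (x, s) (y, t)"
      and PQ: "P i s x \<Longrightarrow> P j t y" "Q i s x \<Longrightarrow> Q j t y" and "swap_on C P Q i s x" for i s x j t y
    using that(10) unfolding swap_on_def
  proof (rule swap_step)
    have U: "P i s x \<and> \<not> Q i s x \<longrightarrow> (x, s) \<in> cells n l P Q" "Q i s x \<and> \<not> P i s x \<longrightarrow> (x, s) \<in> cells n l Q P"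
      using cellsI that(1-3) by metis+
    have W: "P j t y \<and> \<not> Q j t y \<longrightarrow> (y, t) \<in> cells n l P Q" "Q j t y \<and> \<not> P j t y \<longrightarrow> (y, t) \<in> cells n l Q P"
      using cellsI that(4-6) by metis+
    show "P i s x \<and> \<not> Q i s x \<and> P j t y \<and> \<not> Q j t y \<longrightarrow> ((x, s) \<in> C \<longleftrightarrow> (y, t) \<in> C)"
      using main[OF that(7)] U(1) W(1) by blast
    show "Q i s x \<and> \<not> P i s x \<and> Q j t y \<and> \<not> P j t y \<longrightarrow> ((x, s) \<in> C \<longleftrightarrow> (y, t) \<in> C)"
      using main[OF that(7)] U(2) W(2) by blast
  qed (use PQ in blast)+
  note tP = threshold_familyD[OF P] and tQ = threshold_familyD[OF Q]
  have 1: "swap_on C P Q i s (x + 1)" if "i \<le> l" "- int n \<le> s" "s \<le> 0" "swap_on C P Q i s x" for i s x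
    by (rule move[OF that(1-3) that(1-3) _ tP(1)[OF that(1-3)] tQ(1)[OF that(1-3)] that(4)]) (simp_all add: cell_adj_def)
  have 2: "swap_on C P Q (Suc i) s (x - 1)" if "i < l" "- int n \<le> s" "s \<le> 0" "swap_on C P Q i s x" for i s x
    by (rule move[OF _ that(2,3) _ that(2,3) _ tP(2)[OF that(1-3)] tQ(2)[OF that(1-3)] that(4)]) (use that in \<open>simp_all add: cell_adj_def\<close>)
  have 3: "swap_on C P Q i (s + 1) (x + 1)" if "i \<le> l" "- int n \<le> s" "s < 0" "swap_on C P Q i s x" for i s x
    by (rule move[OF that(1,2) _ that(1) _ _ _ tP(3)[OF that(1-3)] tQ(3)[OF that(1-3)] that(4)]) (use that in \<open>simp_all add: cell_adj_def\<close>)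
  have 4: "swap_on C P Q i s x" if "i \<le> l" "- int n \<le> s" "s < 0" "swap_on C P Q i (s + 1) x" for i s x
    by (rule move[OF that(1) _ _ that(1,2) _ _ tP(4)[OF that(1-3)] tQ(4)[OF that(1-3)] that(4)]) (use that in \<open>simp_all add: cell_adj_def\<close>)
  show ?thesis unfolding threshold_family_def
    by (intro conjI allI impI) (rule 1 2 3 4; assumption)+
qed

text \<open>Let the cells have indices \<open>i\<close> and \<open>j\<close>. If
  \<open>i < j\<close>, the strict decrease in the index carries \<open>P\<close> with index
  \<open>j\<close> from \<open>U\<close> to \<open>W\<close>; if \<open>j < i\<close>, it carries
  \<open>Q\<close> with index \<open>i\<close> from \<open>W\<close> to \<open>U\<close>. For equal
  indices a single monotonicity rule gives the contradiction.\<close>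

lemma cells_not_adjacent:
  assumes P: "threshold_family n l P" and Q: "threshold_family n l Q"
    and U: "U \<in> cells n l P Q" and W: "W \<in> cells n l Q P"
  shows "\<not> cell_adj U W"
proof
  assume adj: "cell_adj U W"
  obtain x s i where U': "U = (x, s)" "- int n \<le> s" "s \<le> 0" "i \<le> l" "P i s x" "\<not> Q i s x"
    using U unfolding cells_def by blast
  obtain y t j where W': "W = (y, t)" "- int n \<le> t" "t \<le> 0" "j \<le> l" "Q j t y" "\<not> P j t y"
    using W unfolding cells_def by blast
  have dP: "P j s (x - 1)" if "i < j" using threshold_index_mono[OF P that] U' W' by blast
  have dQ: "Q i t (y - 1)" if "j < i" using threshold_index_mono[OF Q that] U' W' by blast
  have mP: "P k r b" if "P k r a" "a \<le> b" "k \<le> l" "- int n \<le> r" "r \<le> 0" for k r a b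
    using threshold_mono[OF P] that by blast
  have mQ: "Q k r b" if "Q k r a" "a \<le> b" "k \<le> l" "- int n \<le> r" "r \<le> 0" for k r a b
    using threshold_mono[OF Q] that by blast
  consider "t = s" "\<bar>y - x\<bar> \<le> 1" | "t = s + 1" "y = x \<or> y = x + 1" | "s = t + 1" "x = y \<or> x = y + 1"
    using adj U' W' unfolding cell_adj_def by auto
  then show False
  proof cases
    case 1
    then have xy: "x - 1 \<le> y" "y - 1 \<le> x" by linarith+
    consider "i < j" | "j < i" | "i = j" "x \<le> y" | "i = j" "y \<le> x" by linarith
    then show False
    proof cases
      case a: 1
      then show False using dP mP[of j s "x-1" y] xy 1 W' U' by auto
    next
      case a: 2
      then show False using dQ mQ[of i s "y-1" x] xy 1 W' U' by auto
    next
      case a: 3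
      then show False using mP[of i s x y] 1 W' U' by auto
    next
      case a: 4
      then show False using mQ[of i s y x] 1 W' U' by auto
    qed
  next
    case 2
    have "P i t (x + 1)" using threshold_familyD(3)[OF P, of i s x] 2 U' W' by auto
    have ij: "P j t x" if "i < j" using dP[OF that] threshold_familyD(3)[OF P, of j s "x - 1"] 2 U' W' by auto
    have "Q j s y" using threshold_familyD(4)[OF Q, of j s y] 2 U' W' by auto
    have ji: "Q i s (y - 1)" if "j < i" using dQ[OF that] threshold_familyD(4)[OF Q, of i s "y-1"] 2 U' W' by auto
    consider "i < j" | "j < i" | "i = j" "y = x" | "i = j" "y = x + 1" using 2 by linarith
    then show False
    proof cases
      case a: 1
      then show False using ij mP[of j t x y] 2 W' U' by auto
    next
      case a: 2
      then show False using ji mQ[of i s "y-1" x] 2 W' U' by auto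
    next
      case a: 3
      then show False using \<open>Q j s y\<close> U' by auto
    next
      case a: 4
      then show False using \<open>P i t (x + 1)\<close> W' by auto
    qed
  next
    case 3
    have "P i t x" using threshold_familyD(4)[OF P, of i t x] 3 U' W' by auto
    have ij: "P j t (x - 1)" if "i < j" using dP[OF that] threshold_familyD(4)[OF P, of j t "x - 1"] 3 U' W' by auto
    have "Q j s (y + 1)" using threshold_familyD(3)[OF Q, of j t y] 3 U' W' by auto
    have ji: "Q i s y" if "j < i" using dQ[OF that] threshold_familyD(3)[OF Q, of i t "y-1"] 3 U' W' by auto
    consider "i < j" | "j < i" | "i = j" "x = y" | "i = j" "x = y + 1" using 3 by linarith
    then show False
    proof cases
      case a: 1
      then show False using ij mP[of j t "x-1" y] 3 W' U' by auto
    next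
      case a: 2
      then show False using ji mQ[of i s y x] 3 W' U' by auto
    next
      case a: 3
      then show False using \<open>P i t x\<close> W' by auto
    next
      case a: 4
      then show False using \<open>Q j s (y + 1)\<close> U' by auto
    qed
  qed
qed

lemma cells_swap_on:
  "cells n l (swap_on C P Q) (swap_on C Q P) = (cells n l P Q - C) \<union> (cells n l Q P \<inter> C)"
  unfolding cells_def swap_on_def by auto

text \<open>Whether the lattice point with abscissa \<open>v\<close> at height \<open>s\<close> is a vertex of a unit in \<open>C\<close>.\<close>

definition vertex_in :: "(int \<times> int) set \<Rightarrow> int \<Rightarrow> int \<Rightarrow> bool" where
  "vertex_in C v s \<longleftrightarrow> (v, s) \<in> C \<or> (v - 1, s) \<in> C \<or> (v - 1, s - 1) \<in> C \<or> (v, s + 1) \<in> C"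

text \<open>Any of the four cells around a point of the left curve of index \<open>i\<close> has an
  index at least \<open>i\<close>, since the thresholds decrease strictly. Hence the cell to the
  right of the point is of the same type and adjacent, so it lies in \<open>C\<close>, unless both
  curves of index \<open>i\<close> pass through the point.\<close>

lemma vertex_in_swap_left:
  assumes P: "threshold_family n l P" and Q: "threshold_family n l Q"
    and C: "C \<subseteq> cells n l P Q" and cl: "closed_in (cells n l P Q) C"
    and i: "i \<le> l" and s: "- int n \<le> s" "s \<le> 0"
    and v: "P i s v" "\<not> P i s (v - 1)" and vin: "vertex_in C v s"
  shows "(v, s) \<in> C \<and> \<not> Q i s v \<or> (\<forall>x. P i s x \<longleftrightarrow> Q i s x)"
proof -
  have mP: "P k r b" if "P k r a" "a \<le> b" "k \<le> l" "- int n \<le> r" "r \<le> 0" for k r a b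
    using threshold_mono[OF P] that by blast
  have mQ: "Q k r b" if "Q k r a" "a \<le> b" "k \<le> l" "- int n \<le> r" "r \<le> 0" for k r a b
    using threshold_mono[OF Q] that by blast
  \<comment> \<open>A smaller index would move the left curve of index \<open>i\<close> strictly to
    the left of \<open>v\<close>.\<close>
  have ge: "i \<le> j" if "P j s w" "w \<le> v" "j \<le> l" for j w
  proof (rule ccontr)
    assume "\<not> i \<le> j"
    then have "P i s (w - 1)" using threshold_index_mono[OF P _ i s that(1)] by auto
    then show False using mP[of i s "w - 1" "v - 1"] v i s that by auto
  qed
  have dQ: "Q j s (v - 1)" if "Q i s v" "i < j" "j \<le> l" for j
    using threshold_index_mono[OF Q that(2,3) s that(1)] .
  have flag: "(v, s) \<in> C \<and> \<not> Q i s v" if "U \<in> C" "cell_adj U (v, s)" "\<not> Q i s v" for U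
    using that cl C cellsI[of P i s v Q l n] v i s unfolding closed_in_def by blast
  have eq: "\<forall>x. P i s x \<longleftrightarrow> Q i s x" if "Q i s v" "\<not> Q i s (v - 1)"
  proof
    fix x
    show "P i s x \<longleftrightarrow> Q i s x"
      using mP[of i s v x] mP[of i s x "v - 1"] mQ[of i s v x] mQ[of i s x "v - 1"] v that i s
      by (cases "v \<le> x") auto
  qed
  consider "(v, s) \<in> C" | "(v - 1, s) \<in> C" | "(v - 1, s - 1) \<in> C" | "(v, s + 1) \<in> C"
    using vin unfolding vertex_in_def by blast
  then show ?thesis
  proof cases
    case 1
    then obtain j where j: "j \<le> l" "P j s v" "\<not> Q j s v" using C unfolding cells_def by blast
    have "\<not> Q i s v" using ge[OF j(2) _ j(1)] dQ[of j] mQ[of j s "v-1" v] j s by (cases "i = j") auto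
    then show ?thesis using 1 by blast
  next
    case 2
    then obtain j where j: "j \<le> l" "P j s (v - 1)" "\<not> Q j s (v - 1)" using C unfolding cells_def by blast
    have "i \<noteq> j" using j v by auto
    then have "\<not> Q i s v" using ge[OF j(2) _ j(1)] dQ[of j] j by auto
    then show ?thesis using flag[OF 2] by (auto simp: cell_adj_def)
  next
    case 3
    then obtain j where j: "j \<le> l" "P j (s - 1) (v - 1)" "\<not> Q j (s - 1) (v - 1)" and sn: "- int n \<le> s - 1"
      using C unfolding cells_def by blast
    have "P j s v" using threshold_familyD(3)[OF P, of j "s - 1" "v - 1"] j s sn by auto
    then have "i \<le> j" using ge j by blast
    have nq: "\<not> Q j s (v - 1)" using threshold_familyD(4)[OF Q, of j "s - 1" "v - 1"] j s sn by auto
    show ?thesis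
    proof (cases "i = j \<and> Q i s v")
      case True
      then show ?thesis using eq nq by blast
    next
      case False
      then have "\<not> Q i s v" using dQ[of j] nq j \<open>i \<le> j\<close> by (cases "i = j") auto
      then show ?thesis using flag[OF 3] by (auto simp: cell_adj_def)
    qed
  next
    case 4
    then obtain j where j: "j \<le> l" "P j (s + 1) v" "\<not> Q j (s + 1) v" and sn: "s < 0"
      using C unfolding cells_def by auto
    have "P j s v" using threshold_familyD(4)[OF P, of j s v] j s sn by auto
    then have "i \<le> j" using ge j by blast
    have nq: "\<not> Q j s (v - 1)" using threshold_familyD(3)[OF Q, of j s "v - 1"] j s sn by auto
    show ?thesis
    proof (cases "i = j \<and> Q i s v")
      case True
      then show ?thesis using eq nq by blast
    next
      case False
      then have "\<not> Q i s v" using dQ[of j] nq j \<open>i \<le> j\<close> by (cases "i = j") auto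
      then show ?thesis using flag[OF 4] by (auto simp: cell_adj_def)
    qed
  qed
qed

text \<open>The mirror image: around a point of the right curve the indices are at most
  \<open>i\<close>, and the cell to the left of the point is the one that lies in
  \<open>C\<close>.\<close>

lemma vertex_in_swap_right:
  assumes P: "threshold_family n l P" and Q: "threshold_family n l Q"
    and C: "C \<subseteq> cells n l P Q" and cl: "closed_in (cells n l P Q) C"
    and i: "i \<le> l" and s: "- int n \<le> s" "s \<le> 0"
    and v: "Q i s v" "\<not> Q i s (v - 1)" and vin: "vertex_in C v s"
  shows "(v - 1, s) \<in> C \<and> P i s (v - 1) \<or> (\<forall>x. P i s x \<longleftrightarrow> Q i s x)"
proof -
  have mP: "P k r b" if "P k r a" "a \<le> b" "k \<le> l" "- int n \<le> r" "r \<le> 0" for k r a b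
    using threshold_mono[OF P] that by blast
  have mQ: "Q k r b" if "Q k r a" "a \<le> b" "k \<le> l" "- int n \<le> r" "r \<le> 0" for k r a b
    using threshold_mono[OF Q] that by blast
  have le: "j \<le> i" if "\<not> Q j s w" "v - 1 \<le> w" "j \<le> l" for j w
  proof (rule ccontr)
    assume "\<not> j \<le> i"
    then have "Q j s (v - 1)" using threshold_index_mono[OF Q _ that(3) s v(1)] by auto
    then show False using mQ[of j s "v - 1" w] s that by auto
  qed
  have dP: "P i s (v - 1)" if "P j s v" "j < i" for j
    using threshold_index_mono[OF P that(2) i s that(1)] .
  have flag: "(v - 1, s) \<in> C \<and> P i s (v - 1)" if "U \<in> C" "cell_adj U (v - 1, s)" "P i s (v - 1)" for U
    using that cl C cellsI[of P i s "v - 1" Q l n] v i s unfolding closed_in_def by blast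
  have eq: "\<forall>x. P i s x \<longleftrightarrow> Q i s x" if "P i s v" "\<not> P i s (v - 1)"
  proof
    fix x
    show "P i s x \<longleftrightarrow> Q i s x"
      using mP[of i s v x] mP[of i s x "v - 1"] mQ[of i s v x] mQ[of i s x "v - 1"] v that i s
      by (cases "v \<le> x") auto
  qed
  consider "(v, s) \<in> C" | "(v - 1, s) \<in> C" | "(v - 1, s - 1) \<in> C" | "(v, s + 1) \<in> C"
    using vin unfolding vertex_in_def by blast
  then show ?thesis
  proof cases
    case 1
    then obtain j where j: "j \<le> l" "P j s v" "\<not> Q j s v" using C unfolding cells_def by blast
    have "i \<noteq> j" using j v by auto
    then have "P i s (v - 1)" using le[OF j(3) _ j(1)] dP[of j] j by auto
    then show ?thesis using flag[OF 1] by (auto simp: cell_adj_def)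
  next
    case 2
    then obtain j where j: "j \<le> l" "P j s (v - 1)" "\<not> Q j s (v - 1)" using C unfolding cells_def by blast
    have "P i s (v - 1)" using le[OF j(3) _ j(1)] dP[of j] mP[of j s "v - 1" v] j s by (cases "i = j") auto
    then show ?thesis using 2 by blast
  next
    case 3
    then obtain j where j: "j \<le> l" "P j (s - 1) (v - 1)" "\<not> Q j (s - 1) (v - 1)" and sn: "- int n \<le> s - 1"
      using C unfolding cells_def by blast
    have pj: "P j s v" using threshold_familyD(3)[OF P, of j "s - 1" "v - 1"] j s sn by auto
    have nq: "\<not> Q j s (v - 1)" using threshold_familyD(4)[OF Q, of j "s - 1" "v - 1"] j s sn by auto
    then have "j \<le> i" using le j by blast
    show ?thesis
    proof (cases "i = j \<and> \<not> P i s (v - 1)")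
      case True
      then show ?thesis using eq pj by blast
    next
      case False
      then have "P i s (v - 1)" using dP[of j] pj j \<open>j \<le> i\<close> by (cases "i = j") auto
      then show ?thesis using flag[OF 3] by (auto simp: cell_adj_def)
    qed
  next
    case 4
    then obtain j where j: "j \<le> l" "P j (s + 1) v" "\<not> Q j (s + 1) v" and sn: "s < 0"
      using C unfolding cells_def by auto
    have pj: "P j s v" using threshold_familyD(4)[OF P, of j s v] j s sn by auto
    have nq: "\<not> Q j s (v - 1)" using threshold_familyD(3)[OF Q, of j s "v - 1"] j s sn by auto
    then have "j \<le> i" using le j by blast
    show ?thesis
    proof (cases "i = j \<and> \<not> P i s (v - 1)")
      case True
      then show ?thesis using eq pj by blast
    next
      case False
      then have "P i s (v - 1)" using dP[of j] pj j \<open>j \<le> i\<close> by (cases "i = j") auto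
      then show ?thesis using flag[OF 4] by (auto simp: cell_adj_def)
    qed
  qed
qed

section \<open>The sign of a permutation that is increasing on two complementary sets\<close>

lemma strict_mono_permutes_id:
  fixes \<sigma> :: "nat \<Rightarrow> nat"
  assumes \<sigma>: "\<sigma> permutes {1..l}"
    and mono: "\<And>x y. x \<in> {1..l} \<Longrightarrow> y \<in> {1..l} \<Longrightarrow> x < y \<Longrightarrow> \<sigma> x < \<sigma> y"
  shows "\<sigma> = id"
proof -
  have *: "i \<in> {1..l} \<longrightarrow> i \<le> \<tau> i"
    if \<tau>: "\<tau> permutes {1..l}" and mono: "\<And>x y. x \<in> {1..l} \<Longrightarrow> y \<in> {1..l} \<Longrightarrow> x < y \<Longrightarrow> \<tau> x < \<tau> y"
    for \<tau> :: "nat \<Rightarrow> nat" and i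
  proof (induction i)
    case (Suc i)
    show ?case
    proof (cases "i = 0")
      case True
      then show ?thesis using permutes_in_image[OF \<tau>, of 1] by auto
    next
      case False
      then show ?thesis using Suc mono[of i "Suc i"] by auto
    qed
  qed simp
  have inv: "inv_into UNIV \<sigma> permutes {1..l}" using \<sigma> by (rule permutes_inv)
  have invmono: "inv_into UNIV \<sigma> x < inv_into UNIV \<sigma> y" if "x \<in> {1..l}" "y \<in> {1..l}" "x < y" for x y
  proof (rule ccontr)
    assume "\<not> inv_into UNIV \<sigma> x < inv_into UNIV \<sigma> y"
    moreover have "inv_into UNIV \<sigma> x \<in> {1..l}" "inv_into UNIV \<sigma> y \<in> {1..l}" using that permutes_in_image[OF inv] by auto
    ultimately have "\<sigma> (inv_into UNIV \<sigma> y) \<le> \<sigma> (inv_into UNIV \<sigma> x)" using mono[of "inv_into UNIV \<sigma> y" "inv_into UNIV \<sigma> x"] by force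
    then show False using that permutes_inverses(1)[OF \<sigma>] by simp
  qed
  have "\<sigma> i = i" if "i \<in> {1..l}" for i
  proof (rule antisym)
    show "i \<le> \<sigma> i" using *[OF \<sigma> mono] that by blast
    have "\<sigma> i \<in> {1..l}" using that permutes_in_image[OF \<sigma>] by auto
    then have "\<sigma> i \<le> inv_into UNIV \<sigma> (\<sigma> i)" using *[OF inv invmono] by blast
    then show "\<sigma> i \<le> i" using permutes_inverses(2)[OF \<sigma>] by simp
  qed
  then show ?thesis using \<sigma> unfolding permutes_def by (metis eq_id_iff)
qed

lemma transpose_Suc_mono:
  fixes x y :: nat
  assumes "x < y" "\<not> (x = j \<and> y = Suc j)"
  shows "transpose j (Suc j) x < transpose j (Suc j) y"
  using assms unfolding transpose_def by auto

lemma sum_transpose_image: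
  assumes "finite E" "j \<notin> E" "Suc j \<in> E"
  shows "\<Sum>E = Suc (\<Sum>(transpose j (Suc j) ` E))"
proof -
  have im: "transpose j (Suc j) ` E = insert j (E - {Suc j})"
    using assms unfolding transpose_def by (auto simp: image_iff)
  have "\<Sum>E = Suc j + \<Sum>(E - {Suc j})" using assms by (simp add: sum.remove)
  then show ?thesis unfolding im using assms by simp
qed

lemma down_closed_eq_atLeastAtMost:
  assumes E: "E \<subseteq> {1..l}" and step: "\<And>j. 1 \<le> j \<Longrightarrow> Suc j \<in> E \<Longrightarrow> j \<in> E"
  shows "E = {1..card E}"
proof (cases "E = {}")
  case False
  have fin: "finite E" using E finite_subset by blast
  define m where "m = Max E"
  have mE: "m \<in> E" unfolding m_def using Max_in[OF fin False] .
  have down: "x \<in> E" if "1 \<le> x" "x \<le> m" for x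
    using that(2,1)
  proof (induction x rule: inc_induct)
    case base
    then show ?case using mE by simp
  next
    case (step k)
    then show ?case using assms(2)[of k] by auto
  qed
  have "E = {1..m}"
  proof (rule antisym)
    show "E \<subseteq> {1..m}" using E Max_ge[OF fin] unfolding m_def by auto
    show "{1..m} \<subseteq> E"
    proof
      fix x
      assume "x \<in> {1..m}"
      then show "x \<in> E" using down[of x] by simp
    qed
  qed
  then show ?thesis by (metis card_atLeastAtMost diff_Suc_1)
qed simp

text \<open>An adjacent transposition on the source or the target side lowers one of the two sums by
  one, reverses the sign and preserves both increasing pieces. When neither side admits one,
  \<open>E\<close> and its image are the same initial segment and the permutation is the
  identity.\<close>

lemma sign_two_shuffles:
  fixes \<sigma> :: "nat \<Rightarrow> nat"
  assumes "\<sigma> permutes {1..l}" "E \<subseteq> {1..l}"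
    and "\<And>x y. x \<in> {1..l} \<Longrightarrow> y \<in> {1..l} \<Longrightarrow> x < y \<Longrightarrow> (x \<in> E \<longleftrightarrow> y \<in> E) \<Longrightarrow> \<sigma> x < \<sigma> y"
  shows "sign \<sigma> = (- 1) ^ (\<Sum>E + \<Sum>(\<sigma> ` E))"
  using assms
proof (induction "\<Sum>E + \<Sum>(\<sigma> ` E)" arbitrary: \<sigma> E rule: less_induct)
  case less
  note \<sigma> = less.prems(1) and E = less.prems(2) and mono = less.prems(3)
  have finE: "finite E" using E finite_subset by blast
  have perm: "permutation \<sigma>" using \<sigma> by (auto simp: permutation_permutes)
  have F: "\<sigma> ` E \<subseteq> {1..l}" using E permutes_image[OF \<sigma>] by blast
  consider (E) j where "1 \<le> j" "Suc j \<in> E" "j \<notin> E" | (F) j where "1 \<le> j" "Suc j \<in> \<sigma> ` E" "j \<notin> \<sigma> ` E"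
    | (id) "\<And>j. 1 \<le> j \<Longrightarrow> Suc j \<in> E \<Longrightarrow> j \<in> E" "\<And>j. 1 \<le> j \<Longrightarrow> Suc j \<in> \<sigma> ` E \<Longrightarrow> j \<in> \<sigma> ` E"
    by blast
  then show ?case
  proof cases
    case E: E
    let ?t = "transpose j (Suc j)"
    have tp: "?t permutes {1..l}" using E \<open>E \<subseteq> {1..l}\<close> by (intro permutes_swap_id) auto
    have im: "(\<sigma> \<circ> ?t) ` (?t ` E) = \<sigma> ` E" by (simp add: image_comp comp_assoc)
    have s: "\<Sum>E = Suc (\<Sum>(?t ` E))" using sum_transpose_image finE E by blast
    have sub: "?t ` E \<subseteq> {1..l}" using permutes_image[OF tp] \<open>E \<subseteq> {1..l}\<close> by blast
    have mem: "x \<in> ?t ` E \<longleftrightarrow> ?t x \<in> E" for x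
      by (metis imageE image_eqI transpose_involutory)
    have jm: "\<not> (x = j \<and> y = Suc j)" if "x \<in> ?t ` E \<longleftrightarrow> y \<in> ?t ` E" for x y
      using that E unfolding mem by auto
    have "sign (\<sigma> \<circ> ?t) = (- 1) ^ (\<Sum>(?t ` E) + \<Sum>((\<sigma> \<circ> ?t) ` (?t ` E)))"
    proof (rule less.hyps)
      show "\<Sum>(?t ` E) + \<Sum>((\<sigma> \<circ> ?t) ` (?t ` E)) < \<Sum>E + \<Sum>(\<sigma> ` E)" unfolding im using s by simp
      show "\<sigma> \<circ> ?t permutes {1..l}" using \<sigma> tp by (rule permutes_compose[rotated])
      show "?t ` E \<subseteq> {1..l}" by (rule sub)
      show "(\<sigma> \<circ> ?t) x < (\<sigma> \<circ> ?t) y"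
        if "x \<in> {1..l}" "y \<in> {1..l}" "x < y" "x \<in> ?t ` E \<longleftrightarrow> y \<in> ?t ` E" for x y
        using mono[of "?t x" "?t y"] that(1,2) permutes_in_image[OF tp] that(4)[unfolded mem]
          transpose_Suc_mono[OF that(3) jm[OF that(4)]] by auto
    qed
    moreover have "sign (\<sigma> \<circ> ?t) = - sign \<sigma>"
      using sign_compose[OF perm, of ?t] by (simp add: sign_swap_id permutation_swap_id)
    ultimately show ?thesis unfolding im using s by simp
  next
    case F': F
    let ?t = "transpose j (Suc j)"
    have tp: "?t permutes {1..l}" using F' F by (intro permutes_swap_id) auto
    have im: "(?t \<circ> \<sigma>) ` E = ?t ` (\<sigma> ` E)" by (simp add: image_comp)
    have s: "\<Sum>(\<sigma> ` E) = Suc (\<Sum>(?t ` (\<sigma> ` E)))" using sum_transpose_image finE F' by blast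
    have inj: "inj \<sigma>" using \<sigma> by (rule permutes_inj)
    have jm: "\<not> (\<sigma> x = j \<and> \<sigma> y = Suc j)" if "x \<in> E \<longleftrightarrow> y \<in> E" for x y
      using that F' inj_image_mem_iff[OF inj] by metis
    have "sign (?t \<circ> \<sigma>) = (- 1) ^ (\<Sum>E + \<Sum>((?t \<circ> \<sigma>) ` E))"
    proof (rule less.hyps)
      show "\<Sum>E + \<Sum>((?t \<circ> \<sigma>) ` E) < \<Sum>E + \<Sum>(\<sigma> ` E)" unfolding im using s by simp
      show "?t \<circ> \<sigma> permutes {1..l}" using \<sigma> tp by (rule permutes_compose)
      show "E \<subseteq> {1..l}" by fact
      show "(?t \<circ> \<sigma>) x < (?t \<circ> \<sigma>) y"
        if "x \<in> {1..l}" "y \<in> {1..l}" "x < y" "x \<in> E \<longleftrightarrow> y \<in> E" for x y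
        using transpose_Suc_mono[OF mono[OF that] jm[OF that(4)]] by simp
    qed
    moreover have "sign (?t \<circ> \<sigma>) = - sign \<sigma>"
      using sign_compose[of ?t, OF _ perm] by (simp add: sign_swap_id permutation_swap_id)
    ultimately show ?thesis unfolding im using s by simp
  next
    case id
    have "E = {1..card E}" using down_closed_eq_atLeastAtMost[OF E] id(1) by blast
    moreover have "\<sigma> ` E = {1..card (\<sigma> ` E)}" using down_closed_eq_atLeastAtMost[OF F] id(2) by blast
    moreover have "card (\<sigma> ` E) = card E" using card_image permutes_inj_on[OF \<sigma>] by blast
    ultimately have Ec: "E = {1..card E}" "\<sigma> ` E = E" by simp_all
    have inv: "\<sigma> x \<in> E \<longleftrightarrow> x \<in> E" for x
      using Ec(2) permutes_inj[OF \<sigma>] inj_image_mem_iff by metis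
    have "\<sigma> x < \<sigma> y" if "x \<in> {1..l}" "y \<in> {1..l}" "x < y" for x y
    proof (cases "x \<in> E \<longleftrightarrow> y \<in> E")
      case True
      then show ?thesis using mono that by blast
    next
      case False
      have "x \<in> E" "y \<notin> E" using False that Ec(1) by (metis atLeastAtMost_iff le_trans less_imp_le)+
      then have "\<sigma> x \<in> {1..card E}" "\<sigma> y \<notin> {1..card E}" using inv Ec(1) by blast+
      moreover have "\<sigma> y \<in> {1..l}" using that permutes_in_image[OF \<sigma>] by blast
      ultimately show ?thesis by auto
    qed
    then have "\<sigma> = id" using strict_mono_permutes_id[OF \<sigma>] by blast
    \<comment> \<open>Both sums agree, so the exponent is even.\<close>
    then show ?thesis by (simp flip: mult_2)
  qed
qed

section \<open>Matching the half paths at height 0\<close>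

text \<open>For a matching this is the number of E-step intervals of class \<open>e\<close>
  containing \<open>t\<close>, both ends included, but written without the permutation.\<close>

definition coverage :: "nat \<Rightarrow> (nat \<Rightarrow> int) \<Rightarrow> (nat \<Rightarrow> int) \<Rightarrow> bool \<Rightarrow> int \<Rightarrow> int" where
  "coverage l a b e t =
     (\<Sum>j\<in>{1..l}. of_bool (t \<le> b j \<and> even (b j) = e)) - (\<Sum>i\<in>{1..l}. of_bool (t < a i \<and> even (a i) = e))"

text \<open>A permutation-free criterion for a matching: \<open>matching_balanced\<close> and
  \<open>matching_exists\<close> give the two directions, the latter for decreasing
  sequences.\<close>

definition balanced :: "nat \<Rightarrow> (nat \<Rightarrow> int) \<Rightarrow> (nat \<Rightarrow> int) \<Rightarrow> bool" where
  "balanced l a b \<longleftrightarrow> (\<forall>e t. coverage l a b e t \<in> {0, 1})"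

definition decreasing_on :: "nat \<Rightarrow> (nat \<Rightarrow> int) \<Rightarrow> bool" where
  "decreasing_on l a \<longleftrightarrow> (\<forall>i\<in>{1..l}. \<forall>j\<in>{1..l}. i < j \<longrightarrow> a j < a i)"

text \<open>The intervals from \<open>a i\<close> to \<open>b (\<sigma> i)\<close> are traversed by
  E-steps, and equal parity of the ends encodes their even number. Intervals of different classes
  may meet, because such paths intersect specially.\<close>

definition matching :: "nat \<Rightarrow> (nat \<Rightarrow> int) \<Rightarrow> (nat \<Rightarrow> int) \<Rightarrow> (nat \<Rightarrow> nat) \<Rightarrow> bool" where
  "matching l a b \<sigma> \<longleftrightarrow> \<sigma> permutes {1..l} \<and>
     (\<forall>i\<in>{1..l}. a i \<le> b (\<sigma> i) \<and> (even (b (\<sigma> i)) \<longleftrightarrow> even (a i))) \<and>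
     (\<forall>i\<in>{1..l}. \<forall>j\<in>{1..l}. i \<noteq> j \<longrightarrow> (even (a i) \<longleftrightarrow> even (a j)) \<longrightarrow> b (\<sigma> i) < a j \<or> b (\<sigma> j) < a i)"

lemma matchingD:
  assumes "matching l a b \<sigma>"
  shows "\<sigma> permutes {1..l}"
    and "i \<in> {1..l} \<Longrightarrow> a i \<le> b (\<sigma> i)" and "i \<in> {1..l} \<Longrightarrow> even (b (\<sigma> i)) \<longleftrightarrow> even (a i)"
    and "i \<in> {1..l} \<Longrightarrow> j \<in> {1..l} \<Longrightarrow> i \<noteq> j \<Longrightarrow> (even (a i) \<longleftrightarrow> even (a j)) \<Longrightarrow> b (\<sigma> i) < a j \<or> b (\<sigma> j) < a i"
  using assms unfolding matching_def by blast+

lemma decreasing_onD: "decreasing_on l a \<Longrightarrow> i \<in> {1..l} \<Longrightarrow> j \<in> {1..l} \<Longrightarrow> i < j \<Longrightarrow> a j < a i"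
  unfolding decreasing_on_def by blast

lemma decreasing_on_le_iff:
  assumes "decreasing_on l a" "i \<in> {1..l}" "j \<in> {1..l}"
  shows "a i \<le> a j \<longleftrightarrow> j \<le> i"
proof
  assume "a i \<le> a j"
  then show "j \<le> i" using decreasing_onD[OF assms] by fastforce
next
  assume "j \<le> i"
  then consider "j < i" | "j = i" by linarith
  then show "a i \<le> a j" using decreasing_onD[OF assms(1,3,2)] by cases auto
qed

lemma coverage_card:
  "coverage l a b e t = int (card {j \<in> {1..l}. t \<le> b j \<and> even (b j) = e}) - int (card {i \<in> {1..l}. t < a i \<and> even (a i) = e})"
  unfolding coverage_def by (simp add: sum_of_bool_eq Int_def)

lemma matching_coverage:
  assumes m: "matching l a b \<sigma>"
  shows "coverage l a b e t = (\<Sum>i\<in>{1..l}. of_bool (even (a i) = e \<and> a i \<le> t \<and> t \<le> b (\<sigma> i)))"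
proof -
  have "(\<Sum>j\<in>{1..l}. of_bool (t \<le> b j \<and> even (b j) = e) :: int)
      = (\<Sum>i\<in>{1..l}. of_bool (t \<le> b (\<sigma> i) \<and> even (b (\<sigma> i)) = e))"
    using sum.permute[OF matchingD(1)[OF m], of "\<lambda>j. of_bool (t \<le> b j \<and> even (b j) = e) :: int"] by (simp add: comp_def)
  then have "coverage l a b e t = (\<Sum>i\<in>{1..l}. of_bool (t \<le> b (\<sigma> i) \<and> even (b (\<sigma> i)) = e) - of_bool (t < a i \<and> even (a i) = e))"
    unfolding coverage_def by (simp add: sum_subtractf)
  also have "\<dots> = (\<Sum>i\<in>{1..l}. of_bool (even (a i) = e \<and> a i \<le> t \<and> t \<le> b (\<sigma> i)))"
  proof (rule sum.cong[OF refl])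
    fix i assume "i \<in> {1..l}"
    then show "of_bool (t \<le> b (\<sigma> i) \<and> even (b (\<sigma> i)) = e) - of_bool (t < a i \<and> even (a i) = e)
        = (of_bool (even (a i) = e \<and> a i \<le> t \<and> t \<le> b (\<sigma> i)) :: int)"
      using matchingD(2,3)[OF m, of i] by (auto simp: of_bool_def)
  qed
  finally show ?thesis .
qed

lemma matching_balanced:
  assumes m: "matching l a b \<sigma>"
  shows "balanced l a b"
proof -
  have "coverage l a b e t \<in> {0, 1}" for e t
  proof -
    let ?S = "{i \<in> {1..l}. even (a i) = e \<and> a i \<le> t \<and> t \<le> b (\<sigma> i)}"
    have "coverage l a b e t = int (card ?S)"
      unfolding matching_coverage[OF m] by (simp add: sum_of_bool_eq Int_def)
    moreover have "x = y" if "x \<in> ?S" "y \<in> ?S" for x y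
      using matchingD(4)[OF m, of x y] that by force
    then have "card ?S \<le> 1" by (subst One_nat_def, subst card_le_Suc0_iff_eq) auto
    then have "card ?S = 0 \<or> card ?S = 1" by linarith
    moreover have "int k \<in> {0, 1}" if "k = 0 \<or> k = 1" for k using that by auto
    ultimately show ?thesis by (simp only:)
  qed
  then show ?thesis unfolding balanced_def by blast
qed

definition targets :: "nat \<Rightarrow> (nat \<Rightarrow> int) \<Rightarrow> (nat \<Rightarrow> int) \<Rightarrow> nat \<Rightarrow> nat set" where
  "targets l a b i = {j \<in> {1..l}. a i \<le> b j \<and> (even (b j) \<longleftrightarrow> even (a i))}"

lemma finite_targets: "finite (targets l a b i)"
  unfolding targets_def by simp

text \<open>A larger admissible index would be an upper end inside the interval of \<open>i\<close>,
  and the interval ending there would meet that of \<open>i\<close>.\<close>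

lemma matching_eq_Max:
  assumes m: "matching l a b \<sigma>" and b: "decreasing_on l b" and i: "i \<in> {1..l}"
  shows "\<sigma> i = Max (targets l a b i)"
proof (rule Max_eqI[symmetric, OF finite_targets])
  note \<sigma> = matchingD(1)[OF m]
  have si: "\<sigma> i \<in> {1..l}" using permutes_in_image[OF \<sigma>] i by blast
  show "\<sigma> i \<in> targets l a b i" unfolding targets_def using matchingD(2,3)[OF m i] si by auto
  fix j assume j: "j \<in> targets l a b i"
  show "j \<le> \<sigma> i"
  proof (rule ccontr)
    assume "\<not> j \<le> \<sigma> i"
    have jl: "j \<in> {1..l}" using j unfolding targets_def by blast
    then obtain k where k: "k \<in> {1..l}" "j = \<sigma> k" using permutes_image[OF \<sigma>] by blast
    have "k \<noteq> i" using k \<open>\<not> j \<le> \<sigma> i\<close> by auto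
    have "b j < b (\<sigma> i)" using decreasing_onD[OF b si jl] \<open>\<not> j \<le> \<sigma> i\<close> by auto
    then show False
      using matchingD(4)[OF m i k(1)] \<open>k \<noteq> i\<close> matchingD(2,3)[OF m k(1)] j k(2) unfolding targets_def by auto
  qed
qed

lemma matching_unique:
  assumes "matching l a b \<sigma>" "matching l a b \<tau>" "decreasing_on l b"
  shows "\<sigma> = \<tau>"
proof
  fix i
  show "\<sigma> i = \<tau> i"
    using matching_eq_Max[OF assms(1,3), of i] matching_eq_Max[OF assms(2,3), of i]
      matchingD(1)[OF assms(1)] matchingD(1)[OF assms(2)] unfolding permutes_def by (cases "i \<in> {1..l}") auto
qed

text \<open>Every start is sent to the nearest end of its class to the right. Nonnegative coverage
  provides such an end. Coverage at most one makes the choice injective: two starts with the same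
  nearest end would have the same targets, too few for both.\<close>

lemma matching_exists:
  assumes bal: "balanced l a b" and a: "decreasing_on l a" and b: "decreasing_on l b"
  shows "\<exists>\<sigma>. matching l a b \<sigma>"
proof -
  let ?S = "targets l a b"
  define \<sigma> where "\<sigma> i = (if i \<in> {1..l} then Max (?S i) else i)" for i
  let ?R = "\<lambda>i t. {k \<in> {1..l}. t < a k \<and> (even (a k) \<longleftrightarrow> even (a i))}"
  \<comment> \<open>One below \<open>a i\<close>, the start \<open>a i\<close> itself is counted,
    while no end of the same parity lies at \<open>a i - 1\<close>, so the set of ends is still that
    of the targets.\<close>
  have lower: "card (?R i (a i - 1)) \<le> card (?S i)" for i
  proof -
    have "0 \<le> coverage l a b (even (a i)) (a i - 1)"
      using bal unfolding balanced_def by (metis empty_iff insert_iff order.refl zero_le_one)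
    moreover have "{j \<in> {1..l}. a i - 1 \<le> b j \<and> even (b j) = even (a i)} = ?S i"
      unfolding targets_def using order.order_iff_strict by (auto simp: le_less) presburger+
    ultimately show ?thesis unfolding coverage_card by simp
  qed
  have upper: "card (?S i) \<le> 1 + card (?R i (a i))" for i
  proof -
    have "coverage l a b (even (a i)) (a i) \<le> 1"
      using bal unfolding balanced_def by (metis empty_iff insert_iff order.refl zero_le_one)
    moreover have "{j \<in> {1..l}. a i \<le> b j \<and> even (b j) = even (a i)} = ?S i"
      unfolding targets_def by auto
    ultimately show ?thesis unfolding coverage_card by simp
  qed
  have ne: "?S i \<noteq> {}" if "i \<in> {1..l}" for i
  proof
    assume "?S i = {}"
    then have "card (?R i (a i - 1)) = 0" using lower[of i] by simp
    then have "?R i (a i - 1) = {}" by (subst (asm) card_0_eq) auto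
    moreover have "i \<in> ?R i (a i - 1)" using that by simp
    ultimately show False by blast
  qed
  have inS: "\<sigma> i \<in> ?S i" if "i \<in> {1..l}" for i
    using Max_in[OF finite_targets ne[OF that]] that unfolding \<sigma>_def by simp
  have maxS: "j \<le> \<sigma> i" if "j \<in> ?S i" "i \<in> {1..l}" for i j
    using Max_ge[OF finite_targets that(1)] that(2) unfolding \<sigma>_def by simp
  have neq: "\<sigma> i \<noteq> \<sigma> j" if i: "i \<in> {1..l}" and j: "j \<in> {1..l}" and "i < j" for i j
  proof
    assume eq: "\<sigma> i = \<sigma> j"
    have lt: "a j < a i" using decreasing_onD[OF a i j \<open>i < j\<close>] .
    have par: "even (a i) \<longleftrightarrow> even (a j)" using inS[OF i] inS[OF j] eq unfolding targets_def by auto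
    have "?S i = ?S j"
    proof (rule antisym)
      show "?S i \<subseteq> ?S j" using lt par unfolding targets_def by auto
      show "?S j \<subseteq> ?S i"
      proof
        fix k assume k: "k \<in> ?S j"
        then have "k \<le> \<sigma> i" using maxS[OF k j] eq by simp
        then have "b (\<sigma> i) \<le> b k"
          using decreasing_on_le_iff[OF b, of "\<sigma> i" k] k inS[OF i] unfolding targets_def by auto
        then show "k \<in> ?S i" using k inS[OF i] par unfolding targets_def by auto
      qed
    qed
    then have "card (?R j (a j - 1)) \<le> 1 + card (?R i (a i))" using lower[of j] upper[of i] by simp
    \<comment> \<open>Both \<open>i\<close> and \<open>j\<close> are counted at
      \<open>a j - 1\<close>, neither of them at \<open>a i\<close>.\<close>
    moreover have "card (insert i (insert j (?R i (a i)))) \<le> card (?R j (a j - 1))"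
      using i j lt par by (intro card_mono) auto
    moreover have "card (insert i (insert j (?R i (a i)))) = 2 + card (?R i (a i))"
      using \<open>i < j\<close> lt by (subst card_insert_disjoint; simp)+
    ultimately show False by simp
  qed
  have inj: "inj_on \<sigma> {1..l}"
    using neq by (intro inj_onI) (metis linorder_neqE_nat)
  have "\<sigma> ` {1..l} \<subseteq> {1..l}" using inS unfolding targets_def by blast
  then have "\<sigma> ` {1..l} = {1..l}" using endo_inj_surj[OF finite_atLeastAtMost _ inj] by blast
  then have perm: "\<sigma> permutes {1..l}"
    using inj by (intro bij_imp_permutes) (auto simp: bij_betw_def \<sigma>_def)
  have disj: "b (\<sigma> j) < a i"
    if i: "i \<in> {1..l}" and j: "j \<in> {1..l}" and "i < j" "even (a i) \<longleftrightarrow> even (a j)" for i j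
  proof (rule ccontr)
    assume "\<not> b (\<sigma> j) < a i"
    then have "\<sigma> j \<in> ?S i" using inS[OF j] that unfolding targets_def by auto
    then have "\<sigma> j \<le> \<sigma> i" using maxS i by blast
    moreover have "a j < a i" using decreasing_onD[OF a i j \<open>i < j\<close>] .
    then have "\<sigma> i \<in> ?S j" using inS[OF i] that unfolding targets_def by auto
    then have "\<sigma> i \<le> \<sigma> j" using maxS j by blast
    ultimately show False using neq[OF i j \<open>i < j\<close>] by simp
  qed
  have "matching l a b \<sigma>"
    unfolding matching_def
  proof (intro conjI ballI impI)
    fix i assume i: "i \<in> {1..l}"
    show "a i \<le> b (\<sigma> i)" "even (b (\<sigma> i)) \<longleftrightarrow> even (a i)" using inS[OF i] unfolding targets_def by auto
    fix j assume "j \<in> {1..l}" "i \<noteq> j" "even (a i) \<longleftrightarrow> even (a j)"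
    then show "b (\<sigma> i) < a j \<or> b (\<sigma> j) < a i" using disj[of i j] disj[of j i] i by (cases "i < j") auto
  qed (rule perm)
  then show ?thesis by blast
qed

text \<open>Disjoint intervals of one class have their ends in the order of their starts, so the
  permutation increases on each class. The sign is stated as a product of local factors so that
  \<open>prod_swap\<close> can follow it through an exchange.\<close>

lemma matching_sign:
  assumes m: "matching l a b \<sigma>" and b: "decreasing_on l b" and a: "decreasing_on l a"
  shows "sign \<sigma> = (\<Prod>i\<in>{1..l}. if even (a i) then (- 1) ^ i else 1) * (\<Prod>j\<in>{1..l}. if even (b j) then (- 1) ^ j else 1)"
proof -
  note \<sigma> = matchingD(1)[OF m]
  let ?E = "{i \<in> {1..l}. even (a i)}"
  have im: "\<sigma> ` ?E = {j \<in> {1..l}. even (b j)}"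
  proof (intro equalityI subsetI)
    fix j assume "j \<in> \<sigma> ` ?E"
    then show "j \<in> {j \<in> {1..l}. even (b j)}"
      using matchingD(3)[OF m] permutes_in_image[OF \<sigma>] by fastforce
  next
    fix j assume "j \<in> {j \<in> {1..l}. even (b j)}"
    then have j: "j \<in> {1..l}" "even (b j)" by auto
    then obtain i where i: "i \<in> {1..l}" "j = \<sigma> i" using permutes_image[OF \<sigma>] by blast
    then have "i \<in> ?E" using matchingD(3)[OF m i(1)] j by simp
    then show "j \<in> \<sigma> ` ?E" using i by blast
  qed
  have power: "(- 1) ^ (\<Sum>{i \<in> {1..l}. Q i}) = (\<Prod>i\<in>{1..l}. if Q i then (- 1) ^ i else 1 :: int)" for Q
    unfolding power_sum by (rule prod.inter_filter) simp
  have "sign \<sigma> = (- 1) ^ (\<Sum>?E + \<Sum>(\<sigma> ` ?E))"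
  proof (rule sign_two_shuffles[OF \<sigma>])
    show "?E \<subseteq> {1..l}" by blast
    fix x y :: nat assume x: "x \<in> {1..l}" and y: "y \<in> {1..l}" and "x < y" and "x \<in> ?E \<longleftrightarrow> y \<in> ?E"
    then have "b (\<sigma> x) < a y \<or> b (\<sigma> y) < a x" using matchingD(4)[OF m x y] by auto
    moreover have "a y < a x" using decreasing_onD[OF a x y \<open>x < y\<close>] .
    ultimately have "b (\<sigma> y) < b (\<sigma> x)" using matchingD(2)[OF m x] matchingD(2)[OF m y] by linarith
    then show "\<sigma> x < \<sigma> y"
      using decreasing_on_le_iff[OF b, of "\<sigma> x" "\<sigma> y"] permutes_in_image[OF \<sigma>] x y by force
  qed
  then show ?thesis unfolding im power_add power .
qed

text \<open>The effect at height 0 of exchanging \<open>\<alpha>\<^sub>i\<close> with \<open>\<beta>\<^sub>i\<^sub>+\<^sub>1\<close> up to duality, for all \<open>i\<close> in \<open>J\<close>.\<close>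

definition swap_low :: "nat set \<Rightarrow> (nat \<Rightarrow> int) \<Rightarrow> (nat \<Rightarrow> int) \<Rightarrow> nat \<Rightarrow> int" where
  "swap_low J a b i = (if i \<in> J then b (Suc i) + 1 else a i)"

definition swap_upp :: "nat set \<Rightarrow> (nat \<Rightarrow> int) \<Rightarrow> (nat \<Rightarrow> int) \<Rightarrow> nat \<Rightarrow> int" where
  "swap_upp J a b j = (if j \<in> Suc ` J then a (j - 1) - 1 else b j)"

lemma prod_swap:
  fixes F :: "nat \<Rightarrow> int \<Rightarrow> 'm::comm_monoid_mult"
  assumes J: "J \<subseteq> {1..<l}"
    and *: "\<And>i. i \<in> J \<Longrightarrow> F i (b (Suc i) + 1) * H (Suc i) (a i - 1) = D i * (F i (a i) * H (Suc i) (b (Suc i)))"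
  shows "(\<Prod>i\<in>{1..l}. F i (swap_low J a b i)) * (\<Prod>j\<in>{1..l}. H j (swap_upp J a b j))
    = (\<Prod>i\<in>J. D i) * ((\<Prod>i\<in>{1..l}. F i (a i)) * (\<Prod>j\<in>{1..l}. H j (b j)))"
proof -
  have fJ: "finite J" using J finite_subset by blast
  have J1: "J \<subseteq> {1..l}" and J2: "Suc ` J \<subseteq> {1..l}" using J by auto
  have split: "(\<Prod>i\<in>{1..l}. f i) = (\<Prod>i\<in>J. f i) * (\<Prod>i\<in>{1..l} - J. f i)"
    "(\<Prod>i\<in>{1..l}. f i) = (\<Prod>i\<in>J. f (Suc i)) * (\<Prod>i\<in>{1..l} - Suc ` J. f i)" for f :: "nat \<Rightarrow> 'm"
    using prod.subset_diff[OF J1, of f] prod.subset_diff[OF J2, of f]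
    by (simp_all add: prod.reindex mult.commute)
  have 1: "(\<Prod>i\<in>{1..l}. F i (swap_low J a b i)) = (\<Prod>i\<in>J. F i (b (Suc i) + 1)) * (\<Prod>i\<in>{1..l} - J. F i (a i))"
    unfolding split(1) by (intro arg_cong2[where f = "(*)"] prod.cong) (auto simp: swap_low_def)
  have 2: "(\<Prod>j\<in>{1..l}. H j (swap_upp J a b j)) = (\<Prod>i\<in>J. H (Suc i) (a i - 1)) * (\<Prod>j\<in>{1..l} - Suc ` J. H j (b j))"
    unfolding split(2) by (intro arg_cong2[where f = "(*)"] prod.cong) (auto simp: swap_upp_def)
  have "(\<Prod>i\<in>J. F i (b (Suc i) + 1)) * (\<Prod>i\<in>J. H (Suc i) (a i - 1))
      = (\<Prod>i\<in>J. D i) * ((\<Prod>i\<in>J. F i (a i)) * (\<Prod>i\<in>J. H (Suc i) (b (Suc i))))"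
    unfolding prod.distrib[symmetric] by (rule prod.cong) (use * in auto)
  moreover have "x * p * (y * r) = d * (z * p * (w * r))" if "x * y = d * (z * w)" for x y z w p r d :: 'm
  proof -
    have "x * p * (y * r) = x * y * (p * r)" by (simp only: ac_simps)
    also have "\<dots> = d * (z * p * (w * r))" unfolding that by (simp only: ac_simps)
    finally show ?thesis .
  qed
  ultimately show ?thesis
    unfolding 1 2 split(1)[of "\<lambda>i. F i (a i)"] split(2)[of "\<lambda>j. H j (b j)"] by blast
qed

text \<open>The additive analogue of \<open>prod_swap\<close>, for the counting functions
  \<open>coverage\<close> and \<open>mid_cover\<close>.\<close>

lemma sum_swap:
  fixes F :: "int \<Rightarrow> int"
  assumes J: "J \<subseteq> {1..<l}"
  shows "(\<Sum>j\<in>{1..l}. H (swap_upp J a b j)) - (\<Sum>i\<in>{1..l}. F (swap_low J a b i))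
    = (\<Sum>j\<in>{1..l}. H (b j)) - (\<Sum>i\<in>{1..l}. F (a i))
      + (\<Sum>i\<in>J. H (a i - 1) - H (b (Suc i)) - F (b (Suc i) + 1) + F (a i))"
proof -
  have fJ: "finite J" using J finite_subset by blast
  have J1: "J \<subseteq> {1..l}" and J2: "Suc ` J \<subseteq> {1..l}" using J by auto
  have split: "(\<Sum>i\<in>{1..l}. f i) = (\<Sum>i\<in>J. f i) + (\<Sum>i\<in>{1..l} - J. f i)"
    "(\<Sum>i\<in>{1..l}. f i) = (\<Sum>i\<in>J. f (Suc i)) + (\<Sum>i\<in>{1..l} - Suc ` J. f i)" for f :: "nat \<Rightarrow> int"
    using sum.subset_diff[OF J1, of f] sum.subset_diff[OF J2, of f]
    by (simp_all add: sum.reindex)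
  have 1: "(\<Sum>i\<in>{1..l}. F (swap_low J a b i)) = (\<Sum>i\<in>J. F (b (Suc i) + 1)) + (\<Sum>i\<in>{1..l} - J. F (a i))"
    unfolding split(1) by (intro arg_cong2[where f = "(+)"] sum.cong) (auto simp: swap_low_def)
  have 2: "(\<Sum>j\<in>{1..l}. H (swap_upp J a b j)) = (\<Sum>i\<in>J. H (a i - 1)) + (\<Sum>j\<in>{1..l} - Suc ` J. H (b j))"
    unfolding split(2) by (intro arg_cong2[where f = "(+)"] sum.cong) (auto simp: swap_upp_def)
  show ?thesis
    unfolding 1 2 split(1)[of "\<lambda>i. F (a i)"] split(2)[of "\<lambda>j. H (b j)"]
    by (simp add: sum_subtractf sum.distrib)
qed

lemma prod_neg_one_if: "finite J \<Longrightarrow> (\<Prod>i\<in>J. if Q i then - 1 else 1 :: int) = (- 1) ^ card {i \<in> J. Q i}"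
  by (subst prod.inter_filter[symmetric]) simp_all

text \<open>For an even difference both positions of the pair lie in one class. They contribute the
  signs of the consecutive indices \<open>i\<close> and \<open>i + 1\<close> either before or after
  the exchange, but not both, which gives -1. For an odd difference one position is even, at the
  same index before and after.\<close>

lemma matching_swap_sign:
  assumes m: "matching l a b \<sigma>" "decreasing_on l b" "decreasing_on l a"
    and m': "matching l a' b' \<sigma>'" "decreasing_on l b'" "decreasing_on l a'"
    and J: "J \<subseteq> {1..<l}"
    and a': "\<And>i. i \<in> {1..l} \<Longrightarrow> a' i = swap_low J a b i" and b': "\<And>j. j \<in> {1..l} \<Longrightarrow> b' j = swap_upp J a b j"
  shows "sign \<sigma>' = (- 1) ^ card {i \<in> J. even (a i - b (Suc i))} * sign \<sigma>"
proof -
  have fJ: "finite J" using J finite_subset by blast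
  let ?F = "\<lambda>i x. if even (x::int) then (- 1) ^ i else 1 :: int"
  have "sign \<sigma>' = (\<Prod>i\<in>{1..l}. ?F i (swap_low J a b i)) * (\<Prod>j\<in>{1..l}. ?F j (swap_upp J a b j))"
    unfolding matching_sign[OF m'] using a' b' by (intro arg_cong2[where f = "(*)"] prod.cong) auto
  also have "\<dots> = (\<Prod>i\<in>J. if even (a i - b (Suc i)) then - 1 else 1) * sign \<sigma>"
    unfolding matching_sign[OF m] by (rule prod_swap[OF J]) auto
  finally show ?thesis unfolding prod_neg_one_if[OF fJ] .
qed

text \<open>The change does not depend on \<open>e\<close>: exactly one of two consecutive integers
  has the given parity, so the exchanged positions together count once in each class.\<close>

lemma coverage_swap:
  assumes J: "J \<subseteq> {1..<l}"
  shows "coverage l (swap_low J a b) (swap_upp J a b) e t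
    = coverage l a b e t + (\<Sum>i\<in>J. of_bool (t < a i) - of_bool (t \<le> b (Suc i)))"
proof -
  have *: "of_bool (t \<le> x - 1 \<and> even (x - 1) = e) - of_bool (t \<le> y \<and> even y = e)
      - of_bool (t < y + 1 \<and> even (y + 1) = e) + of_bool (t < x \<and> even x = e)
      = (of_bool (t < x) - of_bool (t \<le> y) :: int)" for x y :: int
    by (auto simp: of_bool_def)
  show ?thesis
    unfolding coverage_def
    by (simp only: sum_swap[OF J, of "\<lambda>x. of_bool (t \<le> x \<and> even x = e)" a b "\<lambda>x. of_bool (t < x \<and> even x = e)"] *)
qed

text \<open>Without the parity condition the counts follow from the order:
  \<open>t \<le> b k\<close> means at least \<open>k\<close> ends, \<open>a k \<le> t\<close> at
  most \<open>k - 1\<close> starts. As \<open>a i\<close> is compared with the end of index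
  \<open>i + 1\<close>, an overlap yields 2 and a hole 0; a second index moves the bound by at least
  one more.\<close>

lemma coverage_total_bounds:
  assumes a: "decreasing_on l a" and b: "decreasing_on l b" and i: "i \<in> {1..<l}"
  shows "t \<le> b (Suc i) \<Longrightarrow> a i \<le> t \<Longrightarrow> 2 \<le> coverage l a b True t + coverage l a b False t"
    and "b (Suc i) < t \<Longrightarrow> t < a i \<Longrightarrow> coverage l a b True t + coverage l a b False t \<le> 0"
    and "j \<in> {1..<l} \<Longrightarrow> i < j \<Longrightarrow> t \<le> b (Suc j) \<Longrightarrow> a i \<le> t \<Longrightarrow> 3 \<le> coverage l a b True t + coverage l a b False t"
    and "j \<in> {1..<l} \<Longrightarrow> i < j \<Longrightarrow> b (Suc i) < t \<Longrightarrow> t < a j \<Longrightarrow> coverage l a b True t + coverage l a b False t \<le> - 1"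
proof -
  have tot: "coverage l a b True t + coverage l a b False t = int (card {j \<in> {1..l}. t \<le> b j}) - int (card {i \<in> {1..l}. t < a i})"
  proof -
    have *: "(of_bool (t \<le> x \<and> even x = True) + of_bool (t \<le> x \<and> even x = False) :: int) = of_bool (t \<le> x)"
      "(of_bool (t < x \<and> even x = True) + of_bool (t < x \<and> even x = False) :: int) = of_bool (t < x)" for x :: int by auto
    have "(\<Sum>j\<in>{1..l}. of_bool (t \<le> b j \<and> even (b j) = True)) + (\<Sum>j\<in>{1..l}. of_bool (t \<le> b j \<and> even (b j) = False))
        = (\<Sum>j\<in>{1..l}. of_bool (t \<le> b j) :: int)"
      "(\<Sum>i\<in>{1..l}. of_bool (t < a i \<and> even (a i) = True)) + (\<Sum>i\<in>{1..l}. of_bool (t < a i \<and> even (a i) = False))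
        = (\<Sum>i\<in>{1..l}. of_bool (t < a i) :: int)"
      unfolding sum.distrib[symmetric] * by (rule refl)+
    then have "coverage l a b True t + coverage l a b False t
        = (\<Sum>j\<in>{1..l}. of_bool (t \<le> b j)) - (\<Sum>i\<in>{1..l}. of_bool (t < a i))"
      unfolding coverage_def by linarith
    then show ?thesis by (simp add: sum_of_bool_eq Int_def)
  qed
  have dle: "f y \<le> f x" if "decreasing_on l f" "x \<in> {1..l}" "y \<in> {1..l}" "x \<le> y" for f x y
    using decreasing_on_le_iff[OF that(1) that(3,2)] that(4) by blast
  have card1: "k \<le> card {j \<in> {1..l}. t \<le> b j}" if "k \<in> {1..l}" "t \<le> b k" for k
  proof -
    have "{1..k} \<subseteq> {j \<in> {1..l}. t \<le> b j}" using dle[OF b _ that(1)] that by force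
    then show ?thesis using card_mono[of "{j \<in> {1..l}. t \<le> b j}" "{1..k}"] by simp
  qed
  have card2: "card {j \<in> {1..l}. t \<le> b j} < k" if "k \<in> {1..l}" "b k < t" for k
  proof -
    have "{j \<in> {1..l}. t \<le> b j} \<subseteq> {1..<k}"
    proof
      fix j assume j: "j \<in> {j \<in> {1..l}. t \<le> b j}"
      then have "\<not> k \<le> j" using dle[OF b that(1), of j] that by auto
      then show "j \<in> {1..<k}" using j by auto
    qed
    then have "card {j \<in> {1..l}. t \<le> b j} \<le> k - 1" using card_mono[of "{1..<k}"] by fastforce
    then show ?thesis using that by auto
  qed
  have card3: "k \<le> card {i \<in> {1..l}. t < a i}" if "k \<in> {1..l}" "t < a k" for k
  proof -
    have "{1..k} \<subseteq> {i \<in> {1..l}. t < a i}" using dle[OF a _ that(1)] that by force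
    then show ?thesis using card_mono[of "{i \<in> {1..l}. t < a i}" "{1..k}"] by simp
  qed
  have card4: "card {i \<in> {1..l}. t < a i} < k" if "k \<in> {1..l}" "a k \<le> t" for k
  proof -
    have "{i \<in> {1..l}. t < a i} \<subseteq> {1..<k}"
    proof
      fix j assume j: "j \<in> {i \<in> {1..l}. t < a i}"
      then have "\<not> k \<le> j" using dle[OF a that(1), of j] that by auto
      then show "j \<in> {1..<k}" using j by auto
    qed
    then have "card {i \<in> {1..l}. t < a i} \<le> k - 1" using card_mono[of "{1..<k}"] by fastforce
    then show ?thesis using that by auto
  qed
  have i': "i \<in> {1..l}" "Suc i \<in> {1..l}" using i by auto
  show "2 \<le> coverage l a b True t + coverage l a b False t" if "t \<le> b (Suc i)" "a i \<le> t"
    unfolding tot using card1[OF i'(2) that(1)] card4[OF i'(1) that(2)] by linarith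
  show "coverage l a b True t + coverage l a b False t \<le> 0" if "b (Suc i) < t" "t < a i"
    unfolding tot using card2[OF i'(2) that(1)] card3[OF i'(1) that(2)] by linarith
  assume j: "j \<in> {1..<l}" "i < j"
  then have j': "j \<in> {1..l}" "Suc j \<in> {1..l}" by auto
  show "3 \<le> coverage l a b True t + coverage l a b False t" if "t \<le> b (Suc j)" "a i \<le> t"
    unfolding tot using card1[OF j'(2) that(1)] card4[OF i'(1) that(2)] j by linarith
  show "coverage l a b True t + coverage l a b False t \<le> - 1" if "b (Suc i) < t" "t < a j"
    unfolding tot using card2[OF i'(2) that(1)] card3[OF j'(1) that(2)] j by linarith
qed

text \<open>At each \<open>t\<close> at most one index of \<open>J\<close> is effective, since two
  would force the total coverage to be at least 3 or negative. If there is one, both classes have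
  coverage 1 for an overlap and drop to 0, or both have coverage 0 for a hole and rise to 1.\<close>

lemma balanced_swap:
  assumes bal: "balanced l a b" and a: "decreasing_on l a" and b: "decreasing_on l b"
    and J: "J \<subseteq> {1..<l}"
    and type: "(\<forall>i\<in>J. a i \<le> b (Suc i)) \<or> (\<forall>i\<in>J. b (Suc i) < a i)"
  shows "balanced l (swap_low J a b) (swap_upp J a b)"
  unfolding balanced_def coverage_swap[OF J]
proof (intro allI)
  fix e t
  have cov: "coverage l a b True t \<in> {0, 1}" "coverage l a b False t \<in> {0, 1}"
    using bal unfolding balanced_def by auto
  note bounds = coverage_total_bounds[OF a b, where t = t]
  have fJ: "finite J" using J finite_subset by blast
  let ?d = "\<lambda>i. of_bool (t < a i) - of_bool (t \<le> b (Suc i)) :: int"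
  have overlap: "a i \<le> t \<and> t \<le> b (Suc i)" if "\<forall>i\<in>J. a i \<le> b (Suc i)" "i \<in> J" "?d i \<noteq> 0" for i
    using bspec[OF that(1,2)] that(3) by (cases "t < a i"; cases "t \<le> b (Suc i)") auto
  have hole: "b (Suc i) < t \<and> t < a i" if "\<not> (\<forall>i\<in>J. a i \<le> b (Suc i))" "i \<in> J" "?d i \<noteq> 0" for i
  proof -
    have "b (Suc i) < a i" using type that by blast
    then show ?thesis using that(3) by (cases "t < a i"; cases "t \<le> b (Suc i)") auto
  qed
  consider "\<forall>i\<in>J. ?d i = 0" | k where "k \<in> J" "?d k \<noteq> 0" by blast
  then show "coverage l a b e t + (\<Sum>i\<in>J. ?d i) \<in> {0, 1}"
  proof cases
    case 1
    then show ?thesis using cov by (cases e) (auto simp: sum.neutral)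
  next
    case 2
    have kl: "k \<in> {1..<l}" using 2 J by blast
    have others: "?d i = 0" if "i \<in> J" "i \<noteq> k" for i
    proof (rule ccontr)
      assume di: "?d i \<noteq> 0"
      have il: "i \<in> {1..<l}" using that J by blast
      show False
      proof (cases "\<forall>i\<in>J. a i \<le> b (Suc i)")
        case True
        then have "a k \<le> t" "t \<le> b (Suc k)" "a i \<le> t" "t \<le> b (Suc i)"
          using overlap[OF True 2] overlap[OF True that(1) di] by auto
        then show False using bounds(3)[OF kl il] bounds(3)[OF il kl] that(2) cov by (cases "i < k") auto
      next
        case False
        then have "b (Suc k) < t" "t < a k" "b (Suc i) < t" "t < a i"
          using hole[OF False 2] hole[OF False that(1) di] by auto
        then show False using bounds(4)[OF kl il] bounds(4)[OF il kl] that(2) cov by (cases "i < k") auto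
      qed
    qed
    have "(\<Sum>i\<in>J. ?d i) = ?d k + (\<Sum>i\<in>J - {k}. ?d i)" using fJ 2 by (simp add: sum.remove)
    also have "\<dots> = ?d k" using others by (simp add: sum.neutral)
    finally have s: "(\<Sum>i\<in>J. ?d i) = ?d k" .
    show ?thesis
    proof (cases "\<forall>i\<in>J. a i \<le> b (Suc i)")
      case True
      then have "a k \<le> t" "t \<le> b (Suc k)" using overlap[OF True 2] by auto
      then show ?thesis using bounds(1)[OF kl] cov s by (cases e) auto
    next
      case False
      then have "b (Suc k) < t" "t < a k" using hole[OF False 2] by auto
      then show ?thesis using bounds(2)[OF kl] cov s by (cases e) auto
    qed
  qed
qed

section \<open>Paths as graphs of functions of the height\<close>

definition unit_steps :: "int \<Rightarrow> int \<Rightarrow> (int \<Rightarrow> int) \<Rightarrow> bool" where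
  "unit_steps a b f \<longleftrightarrow> (\<forall>s. a \<le> s \<longrightarrow> s < b \<longrightarrow> f (s + 1) = f s \<or> f (s + 1) = f s + 1)"

definition graph_point :: "(int \<Rightarrow> int) \<Rightarrow> int \<Rightarrow> point" where
  "graph_point f s = (f s, s - f s)"

definition lower_path :: "nat \<Rightarrow> (int \<Rightarrow> int) \<Rightarrow> path" where
  "lower_path n f = map (graph_point f) [- int n..0]"

definition upper_path :: "nat \<Rightarrow> (int \<Rightarrow> int) \<Rightarrow> path" where
  "upper_path n g = map (graph_point g) [0..int n]"

text \<open>The lower function counts up to height 0 and the upper one from height 0 on. Their
  values at 0 may differ and are the ends of the E-step interval.\<close>

definition path_of :: "nat \<Rightarrow> (int \<Rightarrow> int) \<Rightarrow> (int \<Rightarrow> int) \<Rightarrow> path" where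
  "path_of n f g = map (graph_point f) [- int n..-1] @ map (\<lambda>x. (x, - x)) [f 0..g 0] @ map (graph_point g) [1..int n]"

lemma unit_stepsD: "unit_steps a b f \<Longrightarrow> a \<le> s \<Longrightarrow> s < b \<Longrightarrow> f (s + 1) = f s \<or> f (s + 1) = f s + 1"
  unfolding unit_steps_def by blast

lemma ht_graph_point [simp]: "ht (graph_point f s) = s"
  by (simp add: graph_point_def ht_def)

lemma ht_antidiagonal [simp]: "ht (x :: int, - x) = 0"
  by (simp add: ht_def)

lemma graph_point_eq_iff: "graph_point f s = graph_point g t \<longleftrightarrow> s = t \<and> f s = g t"
  unfolding graph_point_def by auto

lemma steps_Nil [simp]: "steps [] = []" and steps_single [simp]: "steps [x] = []"
  and steps_Cons_Cons [simp]: "steps (x # y # zs) = (x, y) # steps (y # zs)"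
  unfolding steps_def by simp_all

lemma steps_append:
  "xs \<noteq> [] \<Longrightarrow> ys \<noteq> [] \<Longrightarrow> steps (xs @ ys) = steps xs @ (last xs, hd ys) # steps ys"
proof (induction xs)
  case (Cons x xs)
  show ?case
  proof (cases xs)
    case Nil
    then show ?thesis using Cons.prems by (cases ys) auto
  next
    case (Cons y zs)
    then show ?thesis using Cons.IH Cons.prems by simp
  qed
qed simp

lemma steps_map_upto: "steps (map h [a..b]) = map (\<lambda>k. (h k, h (k + 1))) [a..b - 1]"
proof (induction a b rule: upto.induct)
  case (1 a b)
  show ?case
  proof (cases "a < b")
    case True
    have "[a..b] = a # (a + 1) # [a + 1 + 1..b]" "[a + 1..b] = (a + 1) # [a + 1 + 1..b]" "[a..b - 1] = a # [a + 1..b - 1]"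
      using True by (simp_all add: upto_rec1)
    then show ?thesis using 1 True by (simp only: list.map steps_Cons_Cons)
  next
    case False
    then show ?thesis by (cases "a = b") (simp_all add: upto.simps)
  qed
qed

lemma hd_upto: "a \<le> b \<Longrightarrow> hd [a..b] = a" and last_upto: "a \<le> b \<Longrightarrow> last [a..b] = b"
  by (simp add: upto_rec1) (simp add: upto_rec2)

lemma path_of_neq_Nil: "f 0 \<le> g 0 \<Longrightarrow> path_of n f g \<noteq> []"
  unfolding path_of_def by simp

lemma hd_path_of: "f 0 \<le> g 0 \<Longrightarrow> hd (path_of n f g) = graph_point f (- int n)"
  by (cases "n = 0") (auto simp: path_of_def hd_append hd_map hd_upto graph_point_def)

lemma last_path_of: "f 0 \<le> g 0 \<Longrightarrow> last (path_of n f g) = graph_point g (int n)"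
  by (cases "n = 0") (auto simp: path_of_def last_append last_map last_upto graph_point_def)

lemma steps_path_of:
  assumes n: "1 \<le> n" and fg: "f 0 \<le> g 0"
  shows "steps (path_of n f g) =
    map (\<lambda>s. (graph_point f s, graph_point f (s + 1))) [- int n..-1] @
    map (\<lambda>x. ((x, - x), (x + 1, - x - 1))) [f 0..g 0 - 1] @
    map (\<lambda>r. (graph_point g r, graph_point g (r + 1))) [0..int n - 1]"
proof -
  have ne: "map (graph_point f) [- int n..-1] \<noteq> []" "map (\<lambda>x. (x, - x)) [f 0..g 0] \<noteq> []" "map (graph_point g) [1..int n] \<noteq> []"
    using n fg by simp_all
  have 1: "map (\<lambda>s. (graph_point f s, graph_point f (s + 1))) [- int n..-1]
      = map (\<lambda>s. (graph_point f s, graph_point f (s + 1))) [- int n..-2] @ [(graph_point f (-1), graph_point f 0)]"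
    using n by (simp add: upto_rec2)
  have 3: "map (\<lambda>r. (graph_point g r, graph_point g (r + 1))) [0..int n - 1]
      = (graph_point g 0, graph_point g 1) # map (\<lambda>r. (graph_point g r, graph_point g (r + 1))) [1..int n - 1]"
    using n by (simp add: upto_rec1)
  have l: "last (map (graph_point f) [- int n..-1]) = graph_point f (-1)"
    "last (map (\<lambda>x. (x, - x)) [f 0..g 0]) = graph_point g 0"
    "hd (map (\<lambda>x. (x, - x)) [f 0..g 0]) = graph_point f 0" "hd (map (graph_point g) [1..int n]) = graph_point g 1"
    using n fg by (simp_all add: last_map hd_map last_upto hd_upto graph_point_def)
  show ?thesis
    unfolding path_of_def 1 3 using ne l by (simp add: steps_append steps_map_upto)
qed

lemma path_step_kinds:
  assumes "unit_steps a b f" "a \<le> s" "s < b"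
  shows "NE_step (graph_point f s, graph_point f (s + 1)) \<or> NW_step (graph_point f s, graph_point f (s + 1))"
    and "NE_step (graph_point f s, graph_point f (s + 1)) \<longleftrightarrow> f (s + 1) = f s + 1"
    and "\<not> E_step (graph_point f s, graph_point f (s + 1))"
  using unit_stepsD[OF assms] by (auto simp: NE_step_def NW_step_def E_step_def graph_point_def)

lemma E_step_antidiagonal: "E_step ((x, - x), (x + 1, - x - 1))"
  by (simp add: E_step_def)

lemma filter_E_step_path_of:
  assumes "1 \<le> n" "f 0 \<le> g 0" "unit_steps (- int n) 0 f" "unit_steps 0 (int n) g"
  shows "filter E_step (steps (path_of n f g)) = map (\<lambda>x. ((x, - x), (x + 1, - x - 1))) [f 0..g 0 - 1]"
proof -
  have "filter E_step (map (\<lambda>s. (graph_point f s, graph_point f (s + 1))) [- int n..-1]) = []"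
    using path_step_kinds(3)[OF assms(3)] by (auto simp: filter_empty_conv)
  moreover have "filter E_step (map (\<lambda>r. (graph_point g r, graph_point g (r + 1))) [0..int n - 1]) = []"
    using path_step_kinds(3)[OF assms(4)] by (auto simp: filter_empty_conv)
  moreover have "filter E_step (map (\<lambda>x. ((x, - x), (x + 1, - x - 1))) [f 0..g 0 - 1])
      = map (\<lambda>x. ((x, - x), (x + 1, - x - 1))) [f 0..g 0 - 1]"
    by (auto simp: filter_id_conv E_step_antidiagonal)
  ultimately show ?thesis unfolding steps_path_of[of n f g, OF assms(1,2)] by simp
qed

lemma is_path_path_of:
  assumes "1 \<le> n" "f 0 \<le> g 0" "unit_steps (- int n) 0 f" "unit_steps 0 (int n) g" "even (g 0 - f 0)"
  shows "is_path n (path_of n f g)"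
proof -
  have "NE_step s \<or> NW_step s \<or> E_step s \<and> ht (fst s) = 0" if "s \<in> set (steps (path_of n f g))" for s
  proof -
    consider x where "- int n \<le> x" "x < 0" "s = (graph_point f x, graph_point f (x + 1))"
      | "E_step s \<and> ht (fst s) = 0"
      | x where "0 \<le> x" "x < int n" "s = (graph_point g x, graph_point g (x + 1))"
      using \<open>s \<in> set (steps (path_of n f g))\<close>
      unfolding steps_path_of[of n f g, OF assms(1,2)] by (auto simp: E_step_antidiagonal)
    then show ?thesis
      by cases (use path_step_kinds(1)[OF assms(3)] path_step_kinds(1)[OF assms(4)] in blast)+
  qed
  moreover have "even (length (filter E_step (steps (path_of n f g))))"
    unfolding filter_E_step_path_of[of n f g, OF assms(1-4)] using assms(2,5) by (simp add: even_nat_iff)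
  ultimately show ?thesis
    unfolding is_path_def using assms(2) by (simp add: path_of_neq_Nil hd_path_of last_path_of)
qed

lemma upper_steps_obtain:
  assumes "q \<noteq> []" "\<forall>s\<in>set (steps q). NE_step s \<or> NW_step s \<or> E_step s \<and> ht (fst s) = 0"
    and "ht (hd q) = r" "1 \<le> r" "ht (last q) = n"
  shows "r \<le> n \<and> (\<exists>g. unit_steps r n g \<and> q = map (graph_point g) [r..n])"
  using assms
proof (induction q arbitrary: r)
  case (Cons w q)
  show ?case
  proof (cases q)
    case Nil
    then have "r = n" "w = graph_point (\<lambda>_. fst w) r" using Cons.prems by (auto simp: graph_point_def ht_def prod_eq_iff)
    then show ?thesis using Nil by (intro conjI exI[of _ "\<lambda>_. fst w"]) (auto simp: unit_steps_def)
  next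
    case (Cons w' q')
    have s: "NE_step (w, w') \<or> NW_step (w, w')" using Cons.prems Cons by (auto simp: ht_def)
    then have h: "ht w' = r + 1" "fst w' = fst w \<or> fst w' = fst w + 1"
      using Cons.prems by (auto simp: NE_step_def NW_step_def ht_def)
    have "r + 1 \<le> n \<and> (\<exists>g. unit_steps (r + 1) n g \<and> q = map (graph_point g) [r + 1..n])"
      using Cons.prems h Cons by (intro Cons.IH) auto
    then obtain g where g: "r + 1 \<le> n" "unit_steps (r + 1) n g" "q = map (graph_point g) [r + 1..n]" by blast
    have "w' = graph_point g (r + 1)" using g Cons by (simp add: upto_rec1)
    then have w': "fst w' = g (r + 1)" by (simp add: graph_point_def)
    let ?g = "g(r := fst w)"
    have "unit_steps r n ?g"
      unfolding unit_steps_def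
    proof (intro allI impI)
      fix s assume "r \<le> s" "s < n"
      then show "?g (s + 1) = ?g s \<or> ?g (s + 1) = ?g s + 1"
        using unit_stepsD[OF g(2), of s] h(2) w' by (cases "s = r") auto
    qed
    moreover have "map (graph_point ?g) [r + 1..n] = map (graph_point g) [r + 1..n]"
      by (auto simp: graph_point_def)
    then have "w # q = map (graph_point ?g) [r..n]"
      using g Cons.prems by (simp add: upto_rec1) (auto simp: graph_point_def ht_def prod_eq_iff)
    ultimately show ?thesis using g(1) by auto
  qed
qed simp

text \<open>The induction removes the first point, so the starting height is arbitrary. At height 0
  the function \<open>f\<close> matters only through \<open>f 0\<close>, and an initial E-step
  merely lowers that value by one.\<close>

lemma steps_obtain:
  assumes "q \<noteq> []" "\<forall>s\<in>set (steps q). NE_step s \<or> NW_step s \<or> E_step s \<and> ht (fst s) = 0"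
    and "ht (hd q) = r" "r \<le> 0" "ht (last q) = n" "1 \<le> n"
  shows "\<exists>f g. unit_steps r 0 f \<and> unit_steps 0 n g \<and> f 0 \<le> g 0 \<and> fst (hd q) = f r \<and>
    q = map (graph_point f) [r..-1] @ map (\<lambda>x. (x, - x)) [f 0..g 0] @ map (graph_point g) [1..n]"
  using assms
proof (induction q arbitrary: r)
  case (Cons w q)
  obtain w' q' where q: "q = w' # q'" using Cons.prems by (cases q) auto
  have st: "NE_step (w, w') \<or> NW_step (w, w') \<or> E_step (w, w') \<and> r = 0" using Cons.prems q by auto
  consider "r = 0" "E_step (w, w')" | "r = 0" "NE_step (w, w') \<or> NW_step (w, w')" | "r < 0" "NE_step (w, w') \<or> NW_step (w, w')"
    using st Cons.prems by fastforce
  then show ?case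
  proof cases
    case 1
    have h: "ht w' = 0" "fst w' = fst w + 1" "w = (fst w, - fst w)" using 1 Cons.prems by (auto simp: E_step_def ht_def prod_eq_iff)
    have "\<exists>f g. unit_steps 0 0 f \<and> unit_steps 0 n g \<and> f 0 \<le> g 0 \<and> fst (hd q) = f 0 \<and>
        q = map (graph_point f) [0..-1] @ map (\<lambda>x. (x, - x)) [f 0..g 0] @ map (graph_point g) [1..n]"
      using Cons.prems q h by (intro Cons.IH) auto
    then obtain f g where g: "unit_steps 0 n g" "f 0 \<le> g 0" "fst w' = f 0"
        "q = map (\<lambda>x. (x, - x)) [f 0..g 0] @ map (graph_point g) [1..n]"
      using q by auto
    have "w # q = map (\<lambda>x. (x, - x)) [fst w..g 0] @ map (graph_point g) [1..n]"
      using g h by (simp add: upto_rec1)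
    then show ?thesis
      using g h 1 by - (rule exI[of _ "\<lambda>_. fst w"], rule exI[of _ g], auto simp: unit_steps_def)
  next
    case 2
    have h: "ht w' = 1" "fst w' = fst w \<or> fst w' = fst w + 1" "w = (fst w, - fst w)"
      using 2 Cons.prems by (auto simp: NE_step_def NW_step_def ht_def prod_eq_iff)
    obtain g where g: "unit_steps 1 n g" "q = map (graph_point g) [1..n]"
      using upper_steps_obtain[of q 1 n] Cons.prems q h by auto
    have "w' = graph_point g 1" using g q \<open>1 \<le> n\<close> by (simp add: upto_rec1)
    then have w': "fst w' = g 1" by (simp add: graph_point_def)
    let ?g = "g(0 := fst w)"
    have "unit_steps 0 n ?g"
      unfolding unit_steps_def
    proof (intro allI impI)
      fix s assume "0 \<le> s" "s < n"
      then show "?g (s + 1) = ?g s \<or> ?g (s + 1) = ?g s + 1"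
        using unit_stepsD[OF g(1), of s] h(2) w' by (cases "s = 0") auto
    qed
    moreover have "map (graph_point ?g) [1..n] = map (graph_point g) [1..n]" by (auto simp: graph_point_def)
    ultimately show ?thesis
      using g h 2 by - (rule exI[of _ "\<lambda>_. fst w"], rule exI[of _ ?g], auto simp: unit_steps_def graph_point_def)
  next
    case 3
    have h: "ht w' = r + 1" "fst w' = fst w \<or> fst w' = fst w + 1"
      using 3 Cons.prems by (auto simp: NE_step_def NW_step_def ht_def)
    have "\<exists>f g. unit_steps (r + 1) 0 f \<and> unit_steps 0 n g \<and> f 0 \<le> g 0 \<and> fst (hd q) = f (r + 1) \<and>
        q = map (graph_point f) [r + 1..-1] @ map (\<lambda>x. (x, - x)) [f 0..g 0] @ map (graph_point g) [1..n]"
      using Cons.prems q h 3 by (intro Cons.IH) auto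
    then obtain f g where g: "unit_steps (r + 1) 0 f" "unit_steps 0 n g" "f 0 \<le> g 0" "fst w' = f (r + 1)"
        "q = map (graph_point f) [r + 1..-1] @ map (\<lambda>x. (x, - x)) [f 0..g 0] @ map (graph_point g) [1..n]"
      using q by auto
    define F where "F = f(r := fst w)"
    have F: "F 0 = f 0" "F r = fst w" using 3 by (simp_all add: F_def)
    have "unit_steps r 0 F"
      unfolding unit_steps_def
    proof (intro allI impI)
      fix s assume "r \<le> s" "s < 0"
      then show "F (s + 1) = F s \<or> F (s + 1) = F s + 1"
        using unit_stepsD[OF g(1), of s] h(2) g(4) by (cases "s = r") (auto simp: F_def)
    qed
    moreover have "map (graph_point F) [r + 1..-1] = map (graph_point f) [r + 1..-1]" by (auto simp: graph_point_def F_def)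
    moreover have "w = graph_point F r" using Cons.prems F by (auto simp: graph_point_def ht_def prod_eq_iff)
    ultimately show ?thesis
      using g 3 F by - (rule exI[of _ F], rule exI[of _ g], simp add: upto_rec1)
  qed
qed simp

lemma is_path_obtain:
  assumes "is_path n q" "1 \<le> n"
  obtains f g where "unit_steps (- int n) 0 f" "unit_steps 0 (int n) g" "f 0 \<le> g 0" "even (g 0 - f 0)" "q = path_of n f g"
proof -
  have q: "q \<noteq> []" "\<forall>s\<in>set (steps q). NE_step s \<or> NW_step s \<or> E_step s \<and> ht (fst s) = 0"
    "ht (hd q) = - int n" "ht (last q) = int n" "even (length (filter E_step (steps q)))"
    using assms(1) unfolding is_path_def by auto
  obtain f g where fg: "unit_steps (- int n) 0 f" "unit_steps 0 (int n) g" "f 0 \<le> g 0" "q = path_of n f g"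
    using steps_obtain[OF q(1-3) _ q(4)] assms(2) unfolding path_of_def by auto
  have "even (nat (g 0 - f 0))"
    using q(5) unfolding fg(4) filter_E_step_path_of[of n f g, OF assms(2) fg(3,1,2)] by simp
  then have "even (g 0 - f 0)" using fg(3) by (simp add: even_nat_iff)
  then show ?thesis using that fg by blast
qed

lemma set_path_of:
  "w \<in> set (path_of n f g) \<longleftrightarrow>
     (- int n \<le> ht w \<and> ht w < 0 \<and> fst w = f (ht w)) \<or>
     (ht w = 0 \<and> f 0 \<le> fst w \<and> fst w \<le> g 0) \<or>
     (0 < ht w \<and> ht w \<le> int n \<and> fst w = g (ht w))"
proof -
  have "w = (x, - x) \<longleftrightarrow> ht w = 0 \<and> fst w = x" for x by (cases w) (auto simp: ht_def)
  moreover have "w = graph_point h s \<longleftrightarrow> ht w = s \<and> fst w = h s" for h s by (cases w) (auto simp: ht_def graph_point_def)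
  ultimately show ?thesis unfolding path_of_def by (auto simp: image_iff Bex_def)
qed

lemma lower_part_path_of: "f 0 \<le> g 0 \<Longrightarrow> lower_part (path_of n f g) = lower_path n f"
proof -
  assume fg: "f 0 \<le> g 0"
  have e: "filter (\<lambda>w. ht w < 0) (map (graph_point f) [- int n..-1]) = map (graph_point f) [- int n..-1]"
    "filter (\<lambda>w. ht w < 0) (map (\<lambda>x::int. (x, - x)) [f 0..g 0]) = []"
    "filter (\<lambda>w. ht w < 0) (map (graph_point g) [1..int n]) = []"
    "filter (\<lambda>w. ht w = 0) (map (graph_point f) [- int n..-1]) = []"
    "filter (\<lambda>w. ht w = 0) (map (\<lambda>x::int. (x, - x)) [f 0..g 0]) = map (\<lambda>x. (x, - x)) [f 0..g 0]"
    "filter (\<lambda>w. ht w = 0) (map (graph_point g) [1..int n]) = []"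
    by (auto simp: filter_id_conv filter_empty_conv)
  have "lower_path n f = map (graph_point f) [- int n..-1] @ [graph_point f 0]"
    unfolding lower_path_def by (simp add: upto_rec2)
  then show ?thesis
    unfolding lower_part_def path_of_def filter_append e using fg
    by (simp add: hd_map hd_upto graph_point_def)
qed

lemma upper_part_path_of: "f 0 \<le> g 0 \<Longrightarrow> upper_part (path_of n f g) = upper_path n g"
proof -
  assume fg: "f 0 \<le> g 0"
  have e: "filter (\<lambda>w. ht w > 0) (map (graph_point f) [- int n..-1]) = []"
    "filter (\<lambda>w. ht w > 0) (map (\<lambda>x::int. (x, - x)) [f 0..g 0]) = []"
    "filter (\<lambda>w. ht w > 0) (map (graph_point g) [1..int n]) = map (graph_point g) [1..int n]"
    "filter (\<lambda>w. ht w = 0) (map (graph_point f) [- int n..-1]) = []"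
    "filter (\<lambda>w. ht w = 0) (map (\<lambda>x::int. (x, - x)) [f 0..g 0]) = map (\<lambda>x. (x, - x)) [f 0..g 0]"
    "filter (\<lambda>w. ht w = 0) (map (graph_point g) [1..int n]) = []"
    by (auto simp: filter_id_conv filter_empty_conv)
  have "upper_path n g = graph_point g 0 # map (graph_point g) [1..int n]"
    unfolding upper_path_def by (simp add: upto_rec1)
  then show ?thesis
    unfolding upper_part_def path_of_def filter_append e using fg
    by (simp add: last_map last_upto graph_point_def)
qed

lemma hp_lat: "hp (lat w) = of_int (fst w) - of_int (ht w) / 2"
  by (simp add: hp_def lat_def ht_def field_simps)

lemma leftmost0_path_of:
  assumes "f 0 \<le> g 0"
  shows "leftmost0 (path_of n f g) = of_int (f 0)"
  unfolding leftmost0_def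
proof (rule Min_eqI)
  show "finite ((\<lambda>w. hp (lat w)) ` {w \<in> set (path_of n f g). ht w = 0})" by simp
  show "of_int (f 0) \<le> y" if "y \<in> (\<lambda>w. hp (lat w)) ` {w \<in> set (path_of n f g). ht w = 0}" for y
    using that by (auto simp: set_path_of hp_lat)
  show "of_int (f 0) \<in> (\<lambda>w. hp (lat w)) ` {w \<in> set (path_of n f g). ht w = 0}"
    using assms by (intro image_eqI[of _ _ "(f 0, - f 0)"]) (auto simp: set_path_of hp_lat)
qed

lemma lower_path_cong: "(\<And>s. - int n \<le> s \<Longrightarrow> s \<le> 0 \<Longrightarrow> f s = g s) \<Longrightarrow> lower_path n f = lower_path n g"
  unfolding lower_path_def graph_point_def by auto

lemma upper_path_cong: "(\<And>s. 0 \<le> s \<Longrightarrow> s \<le> int n \<Longrightarrow> f s = g s) \<Longrightarrow> upper_path n f = upper_path n g"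
  unfolding upper_path_def graph_point_def by auto

lemma lower_path_eqD: "lower_path n f = lower_path n g \<Longrightarrow> - int n \<le> s \<Longrightarrow> s \<le> 0 \<Longrightarrow> f s = g s"
  unfolding lower_path_def by (auto simp: graph_point_eq_iff)

lemma upper_path_eqD: "upper_path n f = upper_path n g \<Longrightarrow> 0 \<le> s \<Longrightarrow> s \<le> int n \<Longrightarrow> f s = g s"
  unfolding upper_path_def by (auto simp: graph_point_eq_iff)

lemma path_of_cong:
  assumes "\<And>s. - int n \<le> s \<Longrightarrow> s \<le> 0 \<Longrightarrow> f s = f' s" "\<And>s. 0 \<le> s \<Longrightarrow> s \<le> int n \<Longrightarrow> g s = g' s"
  shows "path_of n f g = path_of n f' g'"
proof -
  have "map (graph_point f) [- int n..-1] = map (graph_point f') [- int n..-1]"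
    "map (graph_point g) [1..int n] = map (graph_point g') [1..int n]"
    using assms by (auto simp: graph_point_def)
  moreover have "f 0 = f' 0" "g 0 = g' 0" using assms by simp_all
  ultimately show ?thesis unfolding path_of_def by simp
qed

lemma odd_real_of_int [simp]: "odd_real (of_int k) \<longleftrightarrow> odd k" and even_real_of_int [simp]: "even_real (of_int k) \<longleftrightarrow> even k"
  unfolding odd_real_def even_real_def by auto

section \<open>Tuples without ordinary intersections\<close>

text \<open>The last conjunct stands for the permutation, which it determines by
  \<open>matching_exists\<close> and \<open>matching_unique\<close>.\<close>

definition config :: "nat \<Rightarrow> (nat \<Rightarrow> nat) \<Rightarrow> (nat \<Rightarrow> nat) \<Rightarrow> (nat \<Rightarrow> int \<Rightarrow> int) \<Rightarrow> (nat \<Rightarrow> int \<Rightarrow> int) \<Rightarrow> bool" where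
  "config n lam mu A G \<longleftrightarrow>
     (\<forall>i\<in>{1..lam 1}. unit_steps (- int n) 0 (A i) \<and> A i (- int n) = int (conj_part mu i) + 1 - int i) \<and>
     (\<forall>j\<in>{1..lam 1}. unit_steps 0 (int n) (G j) \<and> G j (int n) = int (conj_part lam j) + 1 - int j) \<and>
     (\<forall>s. - int n \<le> s \<longrightarrow> s \<le> 0 \<longrightarrow> decreasing_on (lam 1) (\<lambda>i. A i s)) \<and>
     (\<forall>r. 0 \<le> r \<longrightarrow> r \<le> int n \<longrightarrow> decreasing_on (lam 1) (\<lambda>j. G j r)) \<and>
     balanced (lam 1) (\<lambda>i. A i 0) (\<lambda>j. G j 0)"

definition half_paths_of :: "nat \<Rightarrow> nat \<Rightarrow> (nat \<Rightarrow> int \<Rightarrow> int) \<Rightarrow> (nat \<Rightarrow> int \<Rightarrow> int) \<Rightarrow> half_paths" where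
  "half_paths_of n l A G = ((\<lambda>i\<in>{1..l}. lower_path n (A i)), (\<lambda>j\<in>{1..l}. upper_path n (G j)))"

definition tuple_of :: "nat \<Rightarrow> nat \<Rightarrow> (nat \<Rightarrow> nat) \<Rightarrow> (nat \<Rightarrow> int \<Rightarrow> int) \<Rightarrow> (nat \<Rightarrow> int \<Rightarrow> int) \<Rightarrow> path_tuple" where
  "tuple_of n l \<sigma> A G = (\<sigma>, \<lambda>i\<in>{1..l}. path_of n (A i) (G (\<sigma> i)))"

lemma configD:
  assumes "config n lam mu A G"
  shows "i \<in> {1..lam 1} \<Longrightarrow> unit_steps (- int n) 0 (A i)"
    and "i \<in> {1..lam 1} \<Longrightarrow> A i (- int n) = int (conj_part mu i) + 1 - int i"
    and "j \<in> {1..lam 1} \<Longrightarrow> unit_steps 0 (int n) (G j)"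
    and "j \<in> {1..lam 1} \<Longrightarrow> G j (int n) = int (conj_part lam j) + 1 - int j"
    and "- int n \<le> s \<Longrightarrow> s \<le> 0 \<Longrightarrow> decreasing_on (lam 1) (\<lambda>i. A i s)"
    and "0 \<le> r \<Longrightarrow> r \<le> int n \<Longrightarrow> decreasing_on (lam 1) (\<lambda>j. G j r)"
    and "balanced (lam 1) (\<lambda>i. A i 0) (\<lambda>j. G j 0)"
  using assms unfolding config_def by blast+

lemma conj_part_antimono:
  assumes "is_partition lam" "1 \<le> i" "i \<le> j"
  shows "conj_part lam j \<le> conj_part lam i"
  unfolding conj_part_def
proof (rule card_mono)
  show "finite {k. 1 \<le> k \<and> i \<le> lam k}"
    by (rule finite_subset[of _ "{k. 1 \<le> k \<and> lam k \<noteq> 0}"]) (use assms in \<open>auto simp: is_partition_def\<close>)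
qed (use assms in auto)

text \<open>A discrete intermediate value argument: the difference changes by at most one per step
  and cannot change sign without vanishing.\<close>

lemma unit_steps_less_up:
  assumes "unit_steps a b f" "unit_steps a b h" "h a < f a" "\<And>s. a \<le> s \<Longrightarrow> s \<le> b \<Longrightarrow> f s \<noteq> h s" "a \<le> s" "s \<le> b"
  shows "h s < f s"
  using assms(5,6)
proof (induction s rule: int_ge_induct)
  case (step s)
  then show ?case
    using unit_stepsD[OF assms(1), of s] unit_stepsD[OF assms(2), of s] assms(4)[of "s + 1"] by auto
qed (rule assms(3))

lemma unit_steps_less_down:
  assumes "unit_steps a b f" "unit_steps a b h" "h b < f b" "\<And>s. a \<le> s \<Longrightarrow> s \<le> b \<Longrightarrow> f s \<noteq> h s" "s \<le> b" "a \<le> s"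
  shows "h s < f s"
  using assms(5,6)
proof (induction s rule: int_le_induct)
  case (step s)
  then show ?case
    using unit_stepsD[OF assms(1), of "s - 1"] unit_stepsD[OF assms(2), of "s - 1"] assms(4)[of "s - 1"] by auto
qed (rule assms(3))

lemma matching_cong:
  assumes "\<And>i. i \<in> {1..l} \<Longrightarrow> a i = a' i" "\<And>i. i \<in> {1..l} \<Longrightarrow> b i = b' i" "matching l a b \<sigma>"
  shows "matching l a' b' \<sigma>"
proof -
  have "\<sigma> i \<in> {1..l}" if "i \<in> {1..l}" for i
    using permutes_in_image[OF matchingD(1)[OF assms(3)]] that by blast
  then have "b (\<sigma> i) = b' (\<sigma> i)" if "i \<in> {1..l}" for i using assms(2) that by blast
  then show ?thesis using assms(1,3) unfolding matching_def by simp
qed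

lemma pi_map_tuple_of:
  assumes m: "matching l (\<lambda>i. A i 0) (\<lambda>j. G j 0) \<sigma>"
  shows "pi_map l (tuple_of n l \<sigma> A G) = half_paths_of n l A G"
proof -
  note \<sigma> = matchingD(1)[OF m]
  have le: "A i 0 \<le> G (\<sigma> i) 0" if "i \<in> {1..l}" for i using matchingD(2)[OF m that] .
  have inv: "inv_into {1..l} \<sigma> j \<in> {1..l} \<and> \<sigma> (inv_into {1..l} \<sigma> j) = j" if "j \<in> {1..l}" for j
    using that permutes_image[OF \<sigma>] inv_into_into[of j \<sigma> "{1..l}"] f_inv_into_f[of j \<sigma> "{1..l}"] by auto
  show ?thesis
    unfolding pi_map_def tuple_of_def half_paths_of_def
  proof (intro arg_cong2[where f = Pair] restrict_ext)
    fix i assume i: "i \<in> {1..l}"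
    show "lower_part (snd (\<sigma>, \<lambda>i\<in>{1..l}. path_of n (A i) (G (\<sigma> i))) i) = lower_path n (A i)"
      using i lower_part_path_of[of "A i" "G (\<sigma> i)", OF le[OF i]] by simp
    show "upper_part (snd (\<sigma>, \<lambda>i\<in>{1..l}. path_of n (A i) (G (\<sigma> i)))
        (inv_into {1..l} (fst (\<sigma>, \<lambda>i\<in>{1..l}. path_of n (A i) (G (\<sigma> i)))) i)) = upper_path n (G i)"
      using inv[OF i] upper_part_path_of[of "A (inv_into {1..l} \<sigma> i)" "G i"] le[of "inv_into {1..l} \<sigma> i"] by simp
  qed
qed

text \<open>A common point off height 0 contradicts the strict order of the half paths. A common
  point at height 0 lies in two E-step intervals, which must then belong to different parity
  classes, so the intersection is special.\<close>

lemma tuple_of_in_P1: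
  assumes n: "1 \<le> n" and c: "config n lam mu A G" and m: "matching (lam 1) (\<lambda>i. A i 0) (\<lambda>j. G j 0) \<sigma>"
  shows "tuple_of n (lam 1) \<sigma> A G \<in> P1 n lam mu"
proof -
  let ?l = "lam 1" and ?q = "\<lambda>i. path_of n (A i) (G (\<sigma> i))"
  note \<sigma> = matchingD(1)[OF m] and le = matchingD(2)[OF m] and par = matchingD(3)[OF m]
  have si: "\<sigma> i \<in> {1..?l}" if "i \<in> {1..?l}" for i using that permutes_in_image[OF \<sigma>] by blast
  have "is_path n (?q i)" if "i \<in> {1..?l}" for i
    using le[OF that] par[OF that] configD(1)[OF c that] configD(3)[OF c si[OF that]]
    by (intro is_path_path_of n) auto
  moreover have "hd (?q i) = u_pt n mu i" if "i \<in> {1..?l}" for i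
    using hd_path_of[of "A i" "G (\<sigma> i)", OF le[OF that]] configD(2)[OF c that]
    by (simp add: graph_point_def u_pt_def)
  moreover have "last (?q i) = v_pt n lam (\<sigma> i)" if "i \<in> {1..?l}" for i
    using last_path_of[of "A i" "G (\<sigma> i)", OF le[OF that]] configD(4)[OF c si[OF that]]
    by (simp add: graph_point_def v_pt_def)
  ultimately have tup: "tuple_of n ?l \<sigma> A G \<in> path_tuples n lam mu"
    unfolding tuple_of_def path_tuples_def using \<sigma> by auto
  have "\<not> ordinarily_intersecting (?q i) (?q j)" if i: "i \<in> {1..?l}" and j: "j \<in> {1..?l}" and ij: "i \<noteq> j" for i j
  proof
    assume oi: "ordinarily_intersecting (?q i) (?q j)"
    have sij: "\<sigma> i \<noteq> \<sigma> j" using permutes_inj[OF \<sigma>] ij by (auto dest: injD)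
    have zero: "ht w = 0" if w: "w \<in> set (?q i) \<inter> set (?q j)" for w
    proof (rule ccontr)
      assume "ht w \<noteq> 0"
      then consider "- int n \<le> ht w" "ht w < 0" "A i (ht w) = A j (ht w)"
        | "0 < ht w" "ht w \<le> int n" "G (\<sigma> i) (ht w) = G (\<sigma> j) (ht w)"
        using w unfolding set_path_of Int_iff by linarith
      then show False
      proof cases
        case 1
        then show False
          using decreasing_onD[OF configD(5)[OF c, of "ht w"] i j] decreasing_onD[OF configD(5)[OF c, of "ht w"] j i] ij
          by (cases "i < j") auto
      next
        case 2
        then show False
          using decreasing_onD[OF configD(6)[OF c, of "ht w"] si[OF i] si[OF j]]
            decreasing_onD[OF configD(6)[OF c, of "ht w"] si[OF j] si[OF i]] sij
          by (cases "\<sigma> i < \<sigma> j") auto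
      qed
    qed
    obtain w where w: "w \<in> set (?q i) \<inter> set (?q j)" using oi unfolding ordinarily_intersecting_def intersecting_def by blast
    then have "A i 0 \<le> fst w" "fst w \<le> G (\<sigma> i) 0" "A j 0 \<le> fst w" "fst w \<le> G (\<sigma> j) 0"
      using zero[OF w] w unfolding Int_iff set_path_of by auto
    then have "\<not> (even (A i 0) \<longleftrightarrow> even (A j 0))" using matchingD(4)[OF m i j ij] by linarith
    then have "odd (A i 0 - A j 0)" by simp
    then have "odd_real (of_int (A i 0 - A j 0))" by (simp del: of_int_diff)
    then have "odd_real (leftmost0 (?q i) - leftmost0 (?q j))"
      using leftmost0_path_of[of "A i" "G (\<sigma> i)", OF le[OF i]] leftmost0_path_of[of "A j" "G (\<sigma> j)", OF le[OF j]] by simp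
    then show False
      using oi zero unfolding ordinarily_intersecting_def specially_intersecting_def by blast
  qed
  then show ?thesis using tup unfolding P1_def tuple_of_def by auto
qed

text \<open>Common points occur only at height 0 and between paths of different parity. So two lower
  or two upper paths never coincide at any height, as equal positions at 0 would have equal parity,
  and they keep the order that the partitions impose on their prescribed endpoints.\<close>

lemma P1_obtain:
  assumes n: "1 \<le> n" and lam: "is_partition lam" and mu: "is_partition mu" and p: "p \<in> P1 n lam mu"
  obtains \<sigma> A G where "config n lam mu A G" "matching (lam 1) (\<lambda>i. A i 0) (\<lambda>j. G j 0) \<sigma>" "p = tuple_of n (lam 1) \<sigma> A G"
proof -
  let ?l = "lam 1"
  obtain \<sigma> q where p': "p = (\<sigma>, q)" by (cases p)
  have \<sigma>: "\<sigma> permutes {1..?l}"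
    and q: "q \<in> extensional {1..?l}"
    and qi: "\<And>i. i \<in> {1..?l} \<Longrightarrow> is_path n (q i) \<and> hd (q i) = u_pt n mu i \<and> last (q i) = v_pt n lam (\<sigma> i)"
    and nint: "\<And>i j. i \<in> {1..?l} \<Longrightarrow> j \<in> {1..?l} \<Longrightarrow> i \<noteq> j \<Longrightarrow> \<not> ordinarily_intersecting (q i) (q j)"
    using p unfolding p' P1_def path_tuples_def PiE_def by auto
  have "\<exists>fg. unit_steps (- int n) 0 (fst fg) \<and> unit_steps 0 (int n) (snd fg) \<and> fst fg 0 \<le> snd fg 0 \<and>
      even (snd fg 0 - fst fg 0) \<and> q i = path_of n (fst fg) (snd fg)" if i: "i \<in> {1..?l}" for i
  proof -
    obtain f g where "unit_steps (- int n) 0 f" "unit_steps 0 (int n) g" "f 0 \<le> g 0" "even (g 0 - f 0)" "q i = path_of n f g"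
      using is_path_obtain[of n "q i"] qi[OF i] n by blast
    then show ?thesis by (intro exI[of _ "(f, g)"]) auto
  qed
  then obtain fg where fg: "\<And>i. i \<in> {1..?l} \<Longrightarrow> unit_steps (- int n) 0 (fst (fg i)) \<and> unit_steps 0 (int n) (snd (fg i)) \<and>
      fst (fg i) 0 \<le> snd (fg i) 0 \<and> even (snd (fg i) 0 - fst (fg i) 0) \<and> q i = path_of n (fst (fg i)) (snd (fg i))"
    by metis
  define A where "A i = fst (fg i)" for i
  \<comment> \<open>Upper paths are numbered by their end points, so the permutation has to be
    undone.\<close>
  define G where "G j = snd (fg (inv_into UNIV \<sigma> j))" for j
  have Gs: "G (\<sigma> i) = snd (fg i)" for i unfolding G_def using permutes_inverses(2)[OF \<sigma>] by simp
  have A: "unit_steps (- int n) 0 (A i)" "unit_steps 0 (int n) (G (\<sigma> i))" "A i 0 \<le> G (\<sigma> i) 0"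
    "even (G (\<sigma> i) 0) \<longleftrightarrow> even (A i 0)" "q i = path_of n (A i) (G (\<sigma> i))" if "i \<in> {1..?l}" for i
    using fg[OF that] unfolding A_def Gs by auto
  have onto: "\<exists>i\<in>{1..?l}. j = \<sigma> i" if "j \<in> {1..?l}" for j
    using that permutes_image[OF \<sigma>] by blast
  have A0: "A i (- int n) = int (conj_part mu i) + 1 - int i" if "i \<in> {1..?l}" for i
    using qi[OF that] hd_path_of[of "A i" "G (\<sigma> i)", OF A(3)[OF that]] A(5)[OF that] by (simp add: graph_point_def u_pt_def)
  have Gn': "G (\<sigma> i) (int n) = int (conj_part lam (\<sigma> i)) + 1 - int (\<sigma> i)" if "i \<in> {1..?l}" for i
    using qi[OF that] last_path_of[of "A i" "G (\<sigma> i)", OF A(3)[OF that]] A(5)[OF that] by (simp add: graph_point_def v_pt_def)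
  have meet: "ht w = 0 \<and> (even (A i 0) \<noteq> even (A j 0))"
    if i: "i \<in> {1..?l}" and j: "j \<in> {1..?l}" and ij: "i \<noteq> j" and w: "w \<in> set (q i)" "w \<in> set (q j)" for i j w
  proof -
    have "specially_intersecting (q i) (q j)"
      using nint[OF i j ij] w unfolding ordinarily_intersecting_def intersecting_def by blast
    then have "ht w = 0" "odd_real (leftmost0 (q i) - leftmost0 (q j))" using w unfolding specially_intersecting_def by blast+
    moreover have "leftmost0 (q i) - leftmost0 (q j) = of_int (A i 0 - A j 0)"
      unfolding A(5)[OF i] A(5)[OF j] leftmost0_path_of[of "A i" "G (\<sigma> i)", OF A(3)[OF i]]
        leftmost0_path_of[of "A j" "G (\<sigma> j)", OF A(3)[OF j]] by simp
    ultimately show ?thesis by (simp only: odd_real_of_int) simp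
  qed
  have m: "matching ?l (\<lambda>i. A i 0) (\<lambda>j. G j 0) \<sigma>"
    unfolding matching_def
  proof (intro conjI ballI impI)
    fix i j assume i: "i \<in> {1..?l}" and j: "j \<in> {1..?l}" and ij: "i \<noteq> j" and par: "even (A i 0) \<longleftrightarrow> even (A j 0)"
    show "G (\<sigma> i) 0 < A j 0 \<or> G (\<sigma> j) 0 < A i 0"
    proof (rule ccontr)
      assume not: "\<not> ?thesis"
      \<comment> \<open>Two intersecting intervals share the larger of their left ends.\<close>
      let ?t = "max (A i 0) (A j 0)"
      have "(?t, - ?t) \<in> set (q i)" "(?t, - ?t) \<in> set (q j)"
        unfolding A(5)[OF i] A(5)[OF j] set_path_of using not A(3)[OF i] A(3)[OF j] by auto
      then show False using meet[OF i j ij] par by blast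
    qed
  qed (use \<sigma> A in auto)
  have Adec: "decreasing_on ?l (\<lambda>i. A i s)" if s: "- int n \<le> s" "s \<le> 0" for s
    unfolding decreasing_on_def
  proof (intro ballI impI)
    fix i j assume i: "i \<in> {1..?l}" and j: "j \<in> {1..?l}" and ij: "i < j"
    show "A j s < A i s"
    proof (rule unit_steps_less_up[OF A(1)[OF i] A(1)[OF j] _ _ s])
      show "A j (- int n) < A i (- int n)"
        unfolding A0[OF i] A0[OF j] using conj_part_antimono[OF mu, of i j] i ij by auto
      fix t assume t: "- int n \<le> t" "t \<le> 0"
      show "A i t \<noteq> A j t"
      proof
        assume eq: "A i t = A j t"
        have "graph_point (A i) t \<in> set (q i)" "graph_point (A i) t \<in> set (q j)"
          unfolding A(5)[OF i] A(5)[OF j] set_path_of ht_graph_point using t eq A(3)[OF i] A(3)[OF j]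
          by (auto simp: graph_point_def)
        then have "t = 0" "even (A i 0) \<noteq> even (A j 0)" using meet[OF i j] ij by fastforce+
        then show False using eq by simp
      qed
    qed
  qed
  have Gdec: "decreasing_on ?l (\<lambda>j. G j r)" if r: "0 \<le> r" "r \<le> int n" for r
    unfolding decreasing_on_def
  proof (intro ballI impI)
    fix i j assume i: "i \<in> {1..?l}" and j: "j \<in> {1..?l}" and ij: "i < j"
    obtain i' where i': "i' \<in> {1..?l}" "i = \<sigma> i'" using onto[OF i] by blast
    obtain j' where j': "j' \<in> {1..?l}" "j = \<sigma> j'" using onto[OF j] by blast
    have ij': "i' \<noteq> j'" using ij i' j' by auto
    show "G j r < G i r"
      unfolding i'(2) j'(2)
    proof (rule unit_steps_less_down[OF A(2)[OF i'(1)] A(2)[OF j'(1)] _ _ r(2,1)])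
      show "G (\<sigma> j') (int n) < G (\<sigma> i') (int n)"
        unfolding Gn'[OF i'(1)] Gn'[OF j'(1)] using conj_part_antimono[OF lam, of i j] i ij i'(2) j'(2) by auto
      fix t assume t: "0 \<le> t" "t \<le> int n"
      show "G (\<sigma> i') t \<noteq> G (\<sigma> j') t"
      proof
        assume eq: "G (\<sigma> i') t = G (\<sigma> j') t"
        have "graph_point (G (\<sigma> i')) t \<in> set (q i')" "graph_point (G (\<sigma> i')) t \<in> set (q j')"
          unfolding A(5)[OF i'(1)] A(5)[OF j'(1)] set_path_of ht_graph_point using t eq A(3)[OF i'(1)] A(3)[OF j'(1)]
          by (auto simp: graph_point_def)
        then have "t = 0" "even (A i' 0) \<noteq> even (A j' 0)" using meet[OF i'(1) j'(1) ij'] by fastforce+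
        then show False using eq A(4)[OF i'(1)] A(4)[OF j'(1)] by simp
      qed
    qed
  qed
  have "config n lam mu A G"
    unfolding config_def
  proof (intro conjI ballI allI impI)
    fix j assume "j \<in> {1..?l}"
    then obtain i where i: "i \<in> {1..?l}" "j = \<sigma> i" using onto by blast
    show "unit_steps 0 (int n) (G j)" "G j (int n) = int (conj_part lam j) + 1 - int j"
      unfolding i(2) using A(2)[OF i(1)] Gn'[OF i(1)] by auto
  qed (use A A0 Adec Gdec matching_balanced[OF m] in auto)
  moreover have "p = tuple_of n ?l \<sigma> A G"
    unfolding p' tuple_of_def using A(5) q by (auto intro!: extensionalityI[of _ "{1..?l}"])
  ultimately show ?thesis using that m by blast
qed

lemma half_paths_of_eqD:
  assumes "half_paths_of n l A G = half_paths_of n l A' G'" "i \<in> {1..l}"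
  shows "- int n \<le> s \<Longrightarrow> s \<le> 0 \<Longrightarrow> A i s = A' i s" and "0 \<le> r \<Longrightarrow> r \<le> int n \<Longrightarrow> G i r = G' i r"
proof -
  have e: "(\<lambda>i\<in>{1..l}. lower_path n (A i)) = (\<lambda>i\<in>{1..l}. lower_path n (A' i))"
    "(\<lambda>j\<in>{1..l}. upper_path n (G j)) = (\<lambda>j\<in>{1..l}. upper_path n (G' j))"
    using assms(1) unfolding half_paths_of_def by auto
  have "lower_path n (A i) = lower_path n (A' i)" "upper_path n (G i) = upper_path n (G' i)"
    using fun_cong[OF e(1), of i] fun_cong[OF e(2), of i] assms(2) by simp_all
  then show "- int n \<le> s \<Longrightarrow> s \<le> 0 \<Longrightarrow> A i s = A' i s" and "0 \<le> r \<Longrightarrow> r \<le> int n \<Longrightarrow> G i r = G' i r"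
    using lower_path_eqD upper_path_eqD by blast+
qed

text \<open>The half paths determine the matching and with it the E-steps. This makes the
  description in \<open>eps_tuple\<close> definite.\<close>

lemma tuple_unique:
  assumes n: "1 \<le> n" and lam: "is_partition lam" and mu: "is_partition mu"
    and c: "config n lam mu A G" and m: "matching (lam 1) (\<lambda>i. A i 0) (\<lambda>j. G j 0) \<sigma>"
    and p: "p \<in> P1 n lam mu" and pi: "pi_map (lam 1) p = half_paths_of n (lam 1) A G"
  shows "p = tuple_of n (lam 1) \<sigma> A G"
proof -
  obtain \<tau> A' G' where p': "config n lam mu A' G'" "matching (lam 1) (\<lambda>i. A' i 0) (\<lambda>j. G' j 0) \<tau>" "p = tuple_of n (lam 1) \<tau> A' G'"
    using P1_obtain[OF n lam mu p] .
  have e: "half_paths_of n (lam 1) A' G' = half_paths_of n (lam 1) A G"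
    using pi pi_map_tuple_of[where A = A' and G = G' and \<sigma> = \<tau> and n = n, OF p'(2)] unfolding p'(3) by simp
  have "matching (lam 1) (\<lambda>i. A i 0) (\<lambda>j. G j 0) \<tau>"
    using p'(2) half_paths_of_eqD[OF e, of _ 0] by (rule_tac matching_cong) auto
  then have \<tau>: "\<tau> = \<sigma>" using matching_unique[OF _ m] configD(6)[OF c, of 0] by simp
  have "path_of n (A' i) (G' (\<sigma> i)) = path_of n (A i) (G (\<sigma> i))" if i: "i \<in> {1..lam 1}" for i
    using half_paths_of_eqD(1)[OF e i] half_paths_of_eqD(2)[OF e, of "\<sigma> i"] permutes_in_image[OF matchingD(1)[OF m]] i
    by (intro path_of_cong) auto
  then show ?thesis unfolding p'(3) \<tau> tuple_of_def by (auto intro!: restrict_ext)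
qed

section \<open>Exchange along a single row\<close>

lemma cells_disjoint:
  assumes "threshold_family n l P" "threshold_family n l Q"
  shows "cells n l P Q \<inter> cells n l Q P = {}"
proof -
  have "cell_adj U U" for U by (simp add: cell_adj_def)
  then show ?thesis using cells_not_adjacent[OF assms] by blast
qed

text \<open>For fixed index and height the cells form an interval, along which adjacency propagates
  membership.\<close>

lemma row_closed:
  assumes P: "threshold_family n l P" and Q: "threshold_family n l Q" and cl: "closed_in (cells n l P Q) K"
    and i: "i \<le> l" and s: "- int n \<le> s" "s \<le> 0"
    and x: "(x, s) \<in> K" "P i s x" "\<not> Q i s x" and y: "P i s y" "\<not> Q i s y"
  shows "(y, s) \<in> K"
proof -
  have cell: "(z, s) \<in> cells n l P Q" if "P i s z" "\<not> Q i s z" for z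
    using cellsI[of P i s z Q] that i s by blast
  have neighbour: "(z', s) \<in> K" if "(z, s) \<in> K" "P i s z" "\<not> Q i s z" "P i s z'" "\<not> Q i s z'" "\<bar>z' - z\<bar> \<le> 1" for z z'
    using cl cell[OF that(2,3)] cell[OF that(4,5)] that(1,6) unfolding closed_in_def cell_adj_def by auto
  have "(z, s) \<in> K" if "x \<le> z" "z \<le> y" for z
    using that
  proof (induction z rule: int_ge_induct)
    case (step z)
    then have K: "(z, s) \<in> K" by simp
    have "P i s z" "P i s (z + 1)" using threshold_mono[OF P i s x(2)] step by auto
    moreover have "\<not> Q i s z" "\<not> Q i s (z + 1)" using threshold_mono[OF Q i s] y(2) step by force+
    ultimately show ?case using neighbour[OF K] by auto
  qed (use x in simp)
  moreover have "(z, s) \<in> K" if "z \<le> x" "y \<le> z" for z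
    using that
  proof (induction z rule: int_le_induct)
    case (step z)
    then have K: "(z, s) \<in> K" by simp
    have "P i s z" "P i s (z - 1)" using threshold_mono[OF P i s y(1)] step by auto
    moreover have "\<not> Q i s z" "\<not> Q i s (z - 1)" using threshold_mono[OF Q i s] x(3) step by force+
    ultimately show ?case using neighbour[OF K] by auto
  qed (use x in simp)
  ultimately show ?thesis by (cases "x \<le> y") auto
qed

text \<open>The hypothesis shared by I- and II-regions, symmetric in \<open>P\<close> and
  \<open>Q\<close>.\<close>

definition one_type ::
  "nat \<Rightarrow> nat \<Rightarrow> (nat \<Rightarrow> int \<Rightarrow> int \<Rightarrow> bool) \<Rightarrow> (nat \<Rightarrow> int \<Rightarrow> int \<Rightarrow> bool) \<Rightarrow> (int \<times> int) set \<Rightarrow> bool" where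
  "one_type n l P Q K \<longleftrightarrow>
     closed_in (cells n l P Q) K \<and> closed_in (cells n l Q P) K \<and> (K \<subseteq> cells n l P Q \<or> K \<subseteq> cells n l Q P)"

lemma one_type_sym: "one_type n l P Q K \<Longrightarrow> one_type n l Q P K"
  unfolding one_type_def by blast

text \<open>The bridge from cells to \<open>eps\<close>, which only asks whether the path point
  \<open>v\<close> belongs to the region. Where the two curves differ, the cells between them lie
  all inside or all outside \<open>K\<close>, and the one next to \<open>v\<close> decides; where
  they coincide, both answers agree.\<close>

lemma swap_on_row:
  assumes P: "threshold_family n l P" and Q: "threshold_family n l Q" and K: "one_type n l P Q K"
    and i: "i \<le> l" and s: "- int n \<le> s" "s \<le> 0" and v: "P i s v" "\<not> P i s (v - 1)"
  shows "swap_on K P Q i s x \<longleftrightarrow> (if vertex_in K v s then Q i s x else P i s x)"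
proof -
  have mP: "P i s b" if "P i s a" "a \<le> b" for a b using threshold_mono[OF P i s] that by blast
  have mQ: "Q i s b" if "Q i s a" "a \<le> b" for a b using threshold_mono[OF Q i s] that by blast
  have pv: "P i s x \<longleftrightarrow> v \<le> x" for x using mP[of v x] mP[of x "v - 1"] v by force
  have clPQ: "closed_in (cells n l P Q) K" and clQP: "closed_in (cells n l Q P) K" using K unfolding one_type_def by auto
  note rowPQ = row_closed[OF P Q clPQ i s] and rowQP = row_closed[OF Q P clQP i s]
  have disj: "\<not> (P i s x \<and> \<not> Q i s x \<and> (x, s) \<in> cells n l Q P)" "\<not> (Q i s x \<and> \<not> P i s x \<and> (x, s) \<in> cells n l P Q)" for x
    using cells_disjoint[OF P Q] cellsI[of P i s x Q l n] cellsI[of Q i s x P l n] i s by blast+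
  consider (I) "K \<subseteq> cells n l P Q" | (II) "K \<subseteq> cells n l Q P" using K unfolding one_type_def by blast
  then show ?thesis
  proof cases
    case I
    note left = vertex_in_swap_left[OF P Q I clPQ i s v]
    show ?thesis
    proof (cases "P i s x \<longleftrightarrow> Q i s x")
      case False
      have noQP: "\<not> (Q i s x \<and> \<not> P i s x)" if "(x, s) \<in> K \<or> vertex_in K v s"
      proof
        assume q: "Q i s x \<and> \<not> P i s x"
        then have "vertex_in K v s" using that disj(2)[of x] I by blast
        then show False using left False mQ[of x v] q pv[of x] by auto
      qed
      show ?thesis
      proof (cases "P i s x")
        case True
        then have nq: "\<not> Q i s x" "v \<le> x" using False pv by auto
        then have nqv: "\<not> Q i s v" using mQ by blast
        have "(x, s) \<in> K \<longleftrightarrow> (v, s) \<in> K"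
          using rowPQ[of x v] rowPQ[of v x] True nq nqv v(1) by blast
        moreover have "vertex_in K v s \<longleftrightarrow> (v, s) \<in> K" using left True nq(1) unfolding vertex_in_def by blast
        ultimately show ?thesis unfolding swap_on_def by simp
      qed (use noQP False in \<open>auto simp: swap_on_def\<close>)
    qed (auto simp: swap_on_def)
  next
    case II
    note right = vertex_in_swap_right[OF Q P II clQP i s v]
    show ?thesis
    proof (cases "P i s x \<longleftrightarrow> Q i s x")
      case False
      have noPQ: "\<not> (P i s x \<and> \<not> Q i s x)" if "(x, s) \<in> K \<or> vertex_in K v s"
      proof
        assume q: "P i s x \<and> \<not> Q i s x"
        then have "vertex_in K v s" using that disj(1)[of x] II by blast
        then show False using right False mQ[of "v - 1" x] q pv[of x] by auto
      qed
      show ?thesis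
      proof (cases "P i s x")
        case False
        then have nq: "Q i s x" "x \<le> v - 1" using \<open>\<not> (P i s x \<longleftrightarrow> Q i s x)\<close> pv by auto
        then have nqv: "Q i s (v - 1)" using mQ by blast
        have "(x, s) \<in> K \<longleftrightarrow> (v - 1, s) \<in> K"
          using rowQP[of x "v - 1"] rowQP[of "v - 1" x] False nq nqv v(2) by blast
        moreover have "vertex_in K v s \<longleftrightarrow> (v - 1, s) \<in> K" using right False nq(1) unfolding vertex_in_def by blast
        ultimately show ?thesis unfolding swap_on_def by simp
      qed (use noPQ False in \<open>auto simp: swap_on_def\<close>)
    qed (auto simp: swap_on_def)
  qed
qed

text \<open>The pair of index \<open>i\<close> really changes at height \<open>s\<close>. This is
  stricter than the path point being a vertex of \<open>K\<close>, which can also happen where the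
  two curves coincide.\<close>

definition flagged ::
  "(int \<times> int) set \<Rightarrow> (nat \<Rightarrow> int \<Rightarrow> int \<Rightarrow> bool) \<Rightarrow> (nat \<Rightarrow> int \<Rightarrow> int \<Rightarrow> bool) \<Rightarrow> nat \<Rightarrow> int \<Rightarrow> bool" where
  "flagged K P Q i s \<longleftrightarrow> (\<exists>x. (x, s) \<in> K \<and> P i s x \<noteq> Q i s x)"

lemma flagged_sym: "flagged K P Q i s = flagged K Q P i s"
  unfolding flagged_def by auto

lemma not_flagged_swap_on: "\<not> flagged K P Q i s \<Longrightarrow> swap_on K P Q i s x = P i s x"
  unfolding flagged_def swap_on_def by auto

lemma flagged_swap_on:
  assumes "threshold_family n l P" "threshold_family n l Q" "one_type n l P Q K"
    and "i \<le> l" "- int n \<le> s" "s \<le> 0" "P i s v" "\<not> P i s (v - 1)" "flagged K P Q i s"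
  shows "vertex_in K v s" "swap_on K P Q i s x = Q i s x"
proof -
  note row = swap_on_row[OF assms(1-8)]
  show v: "vertex_in K v s" using row assms(9) unfolding flagged_def swap_on_def by metis
  show "swap_on K P Q i s x = Q i s x" unfolding row using v by simp
qed

lemma vertex_in_flagged_iff:
  assumes "threshold_family n l P" "threshold_family n l Q" "one_type n l P Q K"
    and "i \<le> l" "- int n \<le> s" "s \<le> 0" "P i s v" "\<not> P i s (v - 1)" "\<exists>x. P i s x \<noteq> Q i s x"
  shows "vertex_in K v s \<longleftrightarrow> flagged K P Q i s"
proof
  assume "vertex_in K v s"
  then have "swap_on K P Q i s x = Q i s x" for x using swap_on_row[OF assms(1-8)] by simp
  then show "flagged K P Q i s" using assms(9) not_flagged_swap_on[of K P Q i s] by metis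
qed (rule flagged_swap_on(1)[OF assms(1-8)])

text \<open>All upper data are transported to the lower strip: \<open>dual_upp G j\<close> is the abscissa of \<open>\<beta>\<^sub>j\<^sup>*\<close>.\<close>

definition dual_upp :: "(nat \<Rightarrow> int \<Rightarrow> int) \<Rightarrow> nat \<Rightarrow> int \<Rightarrow> int" where
  "dual_upp G j s = G j (- s) + s + 1"

definition low_thr :: "(nat \<Rightarrow> int \<Rightarrow> int) \<Rightarrow> nat \<Rightarrow> int \<Rightarrow> int \<Rightarrow> bool" where
  "low_thr A i s x \<longleftrightarrow> i \<noteq> 0 \<and> A i s \<le> x"

definition upp_thr :: "nat \<Rightarrow> (nat \<Rightarrow> int \<Rightarrow> int) \<Rightarrow> nat \<Rightarrow> int \<Rightarrow> int \<Rightarrow> bool" where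
  "upp_thr l G i s x \<longleftrightarrow> i = l \<or> dual_upp G (Suc i) s \<le> x"

lemma threshold_low_thr:
  assumes c: "config n lam mu A G"
  shows "threshold_family n (lam 1) (low_thr A)"
  unfolding threshold_family_def
proof (intro conjI allI impI)
  fix i s x assume "i < lam 1" "- int n \<le> s" "s \<le> 0" "low_thr A i s x"
  then show "low_thr A (Suc i) s (x - 1)"
    using decreasing_onD[OF configD(5)[OF c, of s], of i "Suc i"] by (auto simp: low_thr_def)
next
  fix i s x assume *: "i \<le> lam 1" "- int n \<le> s" "s < 0" "low_thr A i s x"
  then show "low_thr A i (s + 1) (x + 1)"
    using unit_stepsD[OF configD(1)[OF c, of i], of s] by (auto simp: low_thr_def)
next
  fix i s x assume *: "i \<le> lam 1" "- int n \<le> s" "s < 0" "low_thr A i (s + 1) x"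
  then show "low_thr A i s x"
    using unit_stepsD[OF configD(1)[OF c, of i], of s] by (auto simp: low_thr_def)
qed (auto simp: low_thr_def)

text \<open>Duality reverses heights: an NW-step of the upper path becomes an increase of the
  abscissa, an NE-step keeps it.\<close>

lemma dual_upp_step:
  assumes "unit_steps 0 (int n) (G j)" "- int n \<le> s" "s < 0"
  shows "dual_upp G j (s + 1) = dual_upp G j s \<or> dual_upp G j (s + 1) = dual_upp G j s + 1"
  using unit_stepsD[OF assms(1), of "- s - 1"] assms(2,3) unfolding dual_upp_def by auto

lemma threshold_upp_thr:
  assumes c: "config n lam mu A G"
  shows "threshold_family n (lam 1) (upp_thr (lam 1) G)"
  unfolding threshold_family_def
proof (intro conjI allI impI)
  fix i s x assume "i < lam 1" "- int n \<le> s" "s \<le> 0" "upp_thr (lam 1) G i s x"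
  then show "upp_thr (lam 1) G (Suc i) s (x - 1)"
    using decreasing_onD[OF configD(6)[OF c, of "- s"], of "Suc i" "Suc (Suc i)"]
    by (cases "Suc i = lam 1") (auto simp: upp_thr_def dual_upp_def)
next
  fix i s x assume *: "i \<le> lam 1" "- int n \<le> s" "s < 0" "upp_thr (lam 1) G i s x"
  then show "upp_thr (lam 1) G i (s + 1) (x + 1)"
    using dual_upp_step[of n G "Suc i" s, OF configD(3)[OF c, of "Suc i"]]
    by (cases "i = lam 1") (auto simp: upp_thr_def)
next
  fix i s x assume *: "i \<le> lam 1" "- int n \<le> s" "s < 0" "upp_thr (lam 1) G i (s + 1) x"
  then show "upp_thr (lam 1) G i s x"
    using dual_upp_step[of n G "Suc i" s, OF configD(3)[OF c, of "Suc i"]]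
    by (cases "i = lam 1") (auto simp: upp_thr_def)
qed (auto simp: upp_thr_def)

section \<open>Units\<close>

text \<open>An upper unit goes to its dual: height \<open>r\<close> becomes \<open>- r\<close> and
  the horizontal position grows by one, so a left vertex \<open>(x, y)\<close> gets the abscissa
  \<open>x - r + 1 = 1 - y\<close>.\<close>

definition cell_of :: "lunit \<Rightarrow> int \<times> int" where
  "cell_of U = (case fst U of Lower \<Rightarrow> (fst (snd U), ht (snd U)) | Upper \<Rightarrow> (1 - snd (snd U), - ht (snd U)))"

definition unit_at :: "side \<Rightarrow> int \<times> int \<Rightarrow> lunit" where
  "unit_at sd k = (sd, case sd of Lower \<Rightarrow> (fst k, snd k - fst k) | Upper \<Rightarrow> (fst k - snd k - 1, 1 - fst k))"

lemma cell_of_unit_at [simp]: "cell_of (unit_at sd k) = k"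
  by (cases sd; cases k) (auto simp: cell_of_def unit_at_def ht_def)

lemma unit_at_cell_of [simp]: "unit_at (fst U) (cell_of U) = U"
  by (cases U; cases "fst U") (auto simp: cell_of_def unit_at_def ht_def)

lemma fst_unit_at [simp]: "fst (unit_at sd k) = sd"
  by (simp add: unit_at_def)

lemma lunits_iff: "U \<in> lunits n \<longleftrightarrow> - int n \<le> snd (cell_of U) \<and> snd (cell_of U) \<le> 0"
  by (cases U; cases "fst U") (auto simp: lunits_def cell_of_def)

lemma lunit_height_cell_of: "lunit_height U = (case fst U of Lower \<Rightarrow> snd (cell_of U) | Upper \<Rightarrow> - snd (cell_of U))"
  by (cases "fst U") (auto simp: lunit_height_def left_vertex_def cell_of_def)

lemma adjacent_same_side_iff:
  assumes "U \<in> lunits n" "W \<in> lunits n"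
  shows "adjacent_same_side n U W \<longleftrightarrow> fst U = fst W \<and> cell_adj (cell_of U) (cell_of W)"
proof -
  obtain sd x y sd' x' y' where U: "U = (sd, x, y)" and W: "W = (sd', x', y')" by (metis surj_pair)
  show ?thesis
  proof (cases "sd = sd'")
    case True
    have st: "(x, y) \<in> strip n sd" "(x', y') \<in> strip n sd" "(x + 1, y - 1) \<in> strip n sd" "(x' + 1, y' - 1) \<in> strip n sd"
      using assms True unfolding lunits_def U W by (cases sd; auto simp: ht_def)+
    have "adjacent_same_side n U W \<longleftrightarrow>
        (x = x' \<or> x = x' + 1) \<and> (y = y' - 1 \<or> y = y') \<or>
        (x + 1 = x' \<or> x + 1 = x' + 1) \<and> (y - 1 = y' - 1 \<or> y - 1 = y') \<or>
        (x' = x \<or> x' = x + 1) \<and> (y' = y - 1 \<or> y' = y) \<or>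
        (x' + 1 = x \<or> x' + 1 = x + 1) \<and> (y' - 1 = y - 1 \<or> y' - 1 = y)"
      using st True unfolding adjacent_same_side_def U W
      by (simp only: lunit_vertices_def left_vertex_def right_vertex_def fst_conv snd_conv mem_Times_iff Int_iff
          insert_iff empty_iff simp_thms)
    also have "\<dots> \<longleftrightarrow> cell_adj (cell_of U) (cell_of W)" (is "?L \<longleftrightarrow> ?R")
    proof -
      \<comment> \<open>Either side confines both offsets to -1, 0, 1, which leaves nine cases to
        compute.\<close>
      have "(x' = x - 1 \<or> x' = x \<or> x' = x + 1) \<and> (y' = y - 1 \<or> y' = y \<or> y' = y + 1)" if "?L \<or> ?R"
        using that
      proof
        assume ?L
        then show ?thesis by (elim disjE conjE) simp_all
      next
        assume ?R
        then show ?thesis unfolding cell_adj_def U W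
          by (cases sd; simp add: True[symmetric] cell_of_def ht_def; elim disjE conjE; linarith)
      qed
      moreover have "?L \<longleftrightarrow> ?R"
        if "x' = x - 1 \<or> x' = x \<or> x' = x + 1" "y' = y - 1 \<or> y' = y \<or> y' = y + 1"
        using that by (elim disjE; cases sd; simp add: U W True[symmetric] cell_adj_def cell_of_def ht_def)
      ultimately show ?thesis by blast
    qed
    finally show ?thesis using True U W by simp
  qed (auto simp: adjacent_same_side_def U W)
qed

text \<open>In cell coordinates, dual units are the same cell seen on the two sides.\<close>

lemma adjacent_across_iff:
  "adjacent_across U W \<longleftrightarrow> fst U = Upper \<and> fst W = Lower \<and> cell_of U = cell_of W \<and> snd (cell_of U) = 0"
proof -
  obtain sd x y sd' x' y' where U: "U = (sd, x, y)" and W: "W = (sd', x', y')" by (metis surj_pair)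
  show ?thesis
    unfolding adjacent_across_def U W
    by (cases sd; cases sd') (auto simp: cell_of_def lunit_height_def left_vertex_def right_vertex_def ht_def)
qed

lemma adjacent_cell_adj:
  assumes "U \<in> lunits n" "W \<in> lunits n" "adjacent n U W"
  shows "cell_adj (cell_of U) (cell_of W)"
  using assms adjacent_same_side_iff[OF assms(1,2)] unfolding adjacent_def adjacent_across_iff by (auto simp: cell_adj_def)

lemma adjacent_sym:
  assumes "U \<in> lunits n" "W \<in> lunits n" "adjacent n U W"
  shows "adjacent n W U"
  using assms(3) cell_adj_sym[of "cell_of U" "cell_of W"]
  unfolding adjacent_def adjacent_same_side_iff[OF assms(1,2)] adjacent_same_side_iff[OF assms(2,1)] by argo

lemma hpos_lower_path: "- int n \<le> s \<Longrightarrow> s \<le> 0 \<Longrightarrow> hpos (lower_path n f) s = of_int (f s) - of_int s / 2"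
proof -
  assume "- int n \<le> s" "s \<le> 0"
  then have "(THE w. w \<in> set (lower_path n f) \<and> ht w = s) = graph_point f s"
    by (intro the_equality) (auto simp: lower_path_def)
  then show ?thesis unfolding hpos_def hp_lat by (simp add: graph_point_def ht_def)
qed

lemma hpos_upper_path: "0 \<le> r \<Longrightarrow> r \<le> int n \<Longrightarrow> hpos (upper_path n g) r = of_int (g r) - of_int r / 2"
proof -
  assume "0 \<le> r" "r \<le> int n"
  then have "(THE w. w \<in> set (upper_path n g) \<and> ht w = r) = graph_point g r"
    by (intro the_equality) (auto simp: upper_path_def)
  then show ?thesis unfolding hpos_def hp_lat by (simp add: graph_point_def ht_def)
qed

context
  fixes n l :: nat and A G :: "nat \<Rightarrow> int \<Rightarrow> int"
begin

abbreviation (input) "hh \<equiv> half_paths_of n l A G"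

lemma low_half_paths:
  "i \<le> l \<Longrightarrow> - int n \<le> s \<Longrightarrow> s \<le> 0 \<Longrightarrow> low hh i s = (if i = 0 then \<infinity> else ereal (of_int (A i s) - of_int s / 2))"
  by (auto simp: low_def half_paths_of_def hpos_lower_path)

lemma upp_half_paths:
  "1 \<le> i \<Longrightarrow> i \<le> l + 1 \<Longrightarrow> 0 \<le> r \<Longrightarrow> r \<le> int n \<Longrightarrow>
    upp l hh i r = (if i = l + 1 then - \<infinity> else ereal (of_int (G i r) - of_int r / 2))"
  by (auto simp: upp_def half_paths_of_def hpos_upper_path)

text \<open>At a fixed height, horizontal positions differ from abscissas by the constant
  \<open>t\<close>, so all comparisons become comparisons of integers. For an upper unit both
  inequalities are transported by duality.\<close>

lemma unit_at_thresholds: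
  assumes U: "U \<in> lunits n" and i: "i \<le> l"
  shows "I_at l hh i U \<longleftrightarrow> low_thr A i (snd (cell_of U)) (fst (cell_of U)) \<and> \<not> upp_thr l G i (snd (cell_of U)) (fst (cell_of U))"
    and "II_at l hh i U \<longleftrightarrow> upp_thr l G i (snd (cell_of U)) (fst (cell_of U)) \<and> \<not> low_thr A i (snd (cell_of U)) (fst (cell_of U))"
proof -
  obtain sd x y where U': "U = (sd, x, y)" by (metis surj_pair)
  let ?h = "x + y"
  define t where "t = real_of_int ?h / 2"
  have hx: "hp (lat (left_vertex U)) = real_of_int x - t"
    "hp (lat (right_vertex U)) = real_of_int (x + 1) - t"
    "lunit_height U = ?h"
    unfolding U' hp_lat t_def by (simp_all add: left_vertex_def right_vertex_def lunit_height_def ht_def)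
  have "(I_at l hh i U \<longleftrightarrow> low_thr A i (snd (cell_of U)) (fst (cell_of U)) \<and> \<not> upp_thr l G i (snd (cell_of U)) (fst (cell_of U))) \<and>
    (II_at l hh i U \<longleftrightarrow> upp_thr l G i (snd (cell_of U)) (fst (cell_of U)) \<and> \<not> low_thr A i (snd (cell_of U)) (fst (cell_of U)))"
  proof (cases sd)
    case Lower
    have s: "- int n \<le> ?h" "?h \<le> 0" and s': "0 \<le> - ?h" "- ?h \<le> int n"
      using U Lower by (auto simp: U' lunits_def ht_def)
    have c: "cell_of U = (x, ?h)" by (simp add: U' Lower cell_of_def ht_def)
    have ud: "upp_dual l hh (i + 1) ?h = (if i = l then - \<infinity> else ereal (real_of_int (dual_upp G (Suc i) ?h) - t))"
      unfolding upp_dual_def t_def dual_upp_def using upp_half_paths[OF _ _ s', of "i + 1"] i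
      by (auto simp: one_ereal_def field_simps)
    show ?thesis
      unfolding I_at_def II_at_def Let_def hx c ud low_half_paths[OF i s] t_def[symmetric]
      by (auto simp: U' Lower low_thr_def upp_thr_def)
  next
    case Upper
    have s: "0 \<le> ?h" "?h \<le> int n" and s': "- int n \<le> - ?h" "- ?h \<le> 0"
      using U Upper by (auto simp: U' lunits_def ht_def)
    have c: "cell_of U = (1 - y, - ?h)" by (simp add: U' Upper cell_of_def ht_def)
    define h where "h = ?h"
    have du: "dual_upp G (Suc i) (- ?h) = G (Suc i) ?h - ?h + 1"
      unfolding dual_upp_def minus_minus by simp
    have y: "y = h - x" by (simp add: h_def)
    have ud: "upp l hh (i + 1) ?h = (if i = l then - \<infinity> else ereal (real_of_int (G (Suc i) ?h) - t))"
      unfolding t_def using upp_half_paths[OF _ _ s, of "i + 1"] i by auto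
    have ld: "low_dual hh i ?h = (if i = 0 then \<infinity> else ereal (real_of_int (A i (- ?h) + ?h - 1) - t))"
      unfolding low_dual_def low_half_paths[OF i s'] t_def by (auto simp: one_ereal_def field_simps)
    show ?thesis
      unfolding I_at_def II_at_def Let_def hx c ud ld low_thr_def upp_thr_def fst_conv snd_conv du
      by (simp only: h_def[symmetric]) (auto simp: U' Upper y)
  qed
  then show "I_at l hh i U \<longleftrightarrow> low_thr A i (snd (cell_of U)) (fst (cell_of U)) \<and> \<not> upp_thr l G i (snd (cell_of U)) (fst (cell_of U))"
    and "II_at l hh i U \<longleftrightarrow> upp_thr l G i (snd (cell_of U)) (fst (cell_of U)) \<and> \<not> low_thr A i (snd (cell_of U)) (fst (cell_of U))" by blast+
qed

lemma units_cells:
  shows "I_units n l hh = {U \<in> lunits n. cell_of U \<in> cells n l (low_thr A) (upp_thr l G)}"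
    and "II_units n l hh = {U \<in> lunits n. cell_of U \<in> cells n l (upp_thr l G) (low_thr A)}"
proof -
  have "(\<exists>i\<in>{0..l}. I_at l hh i U) \<longleftrightarrow> cell_of U \<in> cells n l (low_thr A) (upp_thr l G)"
    "(\<exists>i\<in>{0..l}. II_at l hh i U) \<longleftrightarrow> cell_of U \<in> cells n l (upp_thr l G) (low_thr A)" if "U \<in> lunits n" for U
    using unit_at_thresholds[OF that] that[unfolded lunits_iff] unfolding cells_def
    by (cases "cell_of U"; auto)+
  then show "I_units n l hh = {U \<in> lunits n. cell_of U \<in> cells n l (low_thr A) (upp_thr l G)}"
    and "II_units n l hh = {U \<in> lunits n. cell_of U \<in> cells n l (upp_thr l G) (low_thr A)}"
    unfolding I_units_def II_units_def by blast+
qed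

end

section \<open>Components and regions\<close>

definition rel_on :: "('a \<Rightarrow> 'a \<Rightarrow> bool) \<Rightarrow> 'a set \<Rightarrow> ('a \<times> 'a) set" where
  "rel_on r S = {(x, y). x \<in> S \<and> y \<in> S \<and> r x y}"

text \<open>Connectedness is formulated inside \<open>C\<close> alone, so it survives when the
  ambient set \<open>S\<close> changes; only the closedness condition has to be checked
  again.\<close>

definition component :: "('a \<Rightarrow> 'a \<Rightarrow> bool) \<Rightarrow> 'a set \<Rightarrow> 'a set \<Rightarrow> bool" where
  "component r S C \<longleftrightarrow> C \<noteq> {} \<and> C \<subseteq> S \<and> (\<forall>x\<in>C. \<forall>y\<in>S. r x y \<longrightarrow> y \<in> C) \<and>
     (\<forall>x\<in>C. \<forall>y\<in>C. (x, y) \<in> (rel_on r C)\<^sup>*)"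

lemma quotient_rtrancl_iff_component:
  assumes sym: "\<And>x y. x \<in> S \<Longrightarrow> y \<in> S \<Longrightarrow> r x y \<Longrightarrow> r y x"
  shows "C \<in> S // (rel_on r S)\<^sup>* \<longleftrightarrow> component r S C"
proof
  assume "C \<in> S // (rel_on r S)\<^sup>*"
  then obtain x where x: "x \<in> S" "C = (rel_on r S)\<^sup>* `` {x}" by (rule quotientE)
  have CS: "C \<subseteq> S"
  proof
    fix y assume "y \<in> C"
    then have "(x, y) \<in> (rel_on r S)\<^sup>*" using x by blast
    then show "y \<in> S" by (induction rule: rtrancl_induct) (use x in \<open>auto simp: rel_on_def\<close>)
  qed
  have closed: "z \<in> C" if "y \<in> C" "z \<in> S" "r y z" for y z
  proof -
    have "(y, z) \<in> rel_on r S" using that CS unfolding rel_on_def by blast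
    then show ?thesis using that(1) unfolding x(2) by (auto intro: rtrancl_into_rtrancl)
  qed
  have from_x: "(x, y) \<in> (rel_on r C)\<^sup>*" if "y \<in> C" for y
  proof -
    have "(x, y) \<in> (rel_on r S)\<^sup>*" using that x by blast
    then have "y \<in> C \<and> (x, y) \<in> (rel_on r C)\<^sup>*"
    proof (induction rule: rtrancl_induct)
      case base
      then show ?case using x by auto
    next
      case (step y z)
      then have "z \<in> C" using closed unfolding rel_on_def by blast
      then have "(y, z) \<in> rel_on r C" using step unfolding rel_on_def by blast
      then show ?case using step \<open>z \<in> C\<close> by (auto intro: rtrancl_into_rtrancl)
    qed
    then show ?thesis by blast
  qed
  have "sym (rel_on r C)" using sym CS unfolding rel_on_def sym_def by blast
  then have "sym ((rel_on r C)\<^sup>*)" by (rule sym_rtrancl)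
  then have "(y, z) \<in> (rel_on r C)\<^sup>*" if "y \<in> C" "z \<in> C" for y z
    using from_x[OF that(1)] from_x[OF that(2)] by (meson rtrancl_trans symD)
  then show "component r S C" unfolding component_def using CS closed x by blast
next
  assume C: "component r S C"
  then obtain x where x: "x \<in> C" unfolding component_def by blast
  have "C = (rel_on r S)\<^sup>* `` {x}"
  proof (intro equalityI subsetI)
    fix y assume "y \<in> C"
    then have "(x, y) \<in> (rel_on r C)\<^sup>*" using x C unfolding component_def by blast
    moreover have "rel_on r C \<subseteq> rel_on r S" using C unfolding component_def rel_on_def by blast
    ultimately show "y \<in> (rel_on r S)\<^sup>* `` {x}" using rtrancl_mono by blast
  next
    fix y assume "y \<in> (rel_on r S)\<^sup>* `` {x}"
    then have "(x, y) \<in> (rel_on r S)\<^sup>*" by blast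
    then show "y \<in> C"
      by (induction rule: rtrancl_induct) (use x C in \<open>auto simp: component_def rel_on_def\<close>)
  qed
  then show "C \<in> S // (rel_on r S)\<^sup>*" using x C unfolding component_def by (metis quotientI subsetD)
qed

lemma component_subset:
  assumes "component r S C" "x \<in> C" "x \<in> D" "\<And>y z. y \<in> D \<Longrightarrow> y \<in> C \<Longrightarrow> z \<in> C \<Longrightarrow> r y z \<Longrightarrow> z \<in> D"
  shows "C \<subseteq> D"
proof
  fix y assume "y \<in> C"
  then have "(x, y) \<in> (rel_on r C)\<^sup>*" using assms unfolding component_def by blast
  then show "y \<in> D"
    by (induction rule: rtrancl_induct) (use assms(3,4) in \<open>auto simp: rel_on_def\<close>)
qed

lemma component_eqI:
  assumes C: "component r S C" and D: "component r S D" and x: "x \<in> C" "x \<in> D"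
  shows "C = D"
proof
  show "C \<subseteq> D" using component_subset[OF C x] C D unfolding component_def by blast
  show "D \<subseteq> C" using component_subset[OF D x(2,1)] C D unfolding component_def by blast
qed

text \<open>Together with \<open>component_Un\<close> this follows a component that changes its
  type: it leaves one set of cells and joins the other.\<close>

lemma component_Diff:
  assumes C: "component r S C" and sym: "\<And>x y. r x y \<Longrightarrow> r y x" and refl: "\<And>x. r x x"
  shows "component r (S - C) D \<longleftrightarrow> component r S D \<and> D \<noteq> C"
proof
  assume D: "component r (S - C) D"
  then have "D \<noteq> C" unfolding component_def by blast
  moreover have "y \<in> D" if "x \<in> D" "y \<in> S" "r x y" for x y
  proof (cases "y \<in> C")
    case True
    then have "x \<in> C" using C D that sym unfolding component_def by blast
    then show ?thesis using D that unfolding component_def by blast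
  qed (use D that in \<open>auto simp: component_def\<close>)
  ultimately show "component r S D \<and> D \<noteq> C" using D unfolding component_def by blast
next
  assume D: "component r S D \<and> D \<noteq> C"
  then have "D \<inter> C = {}" using component_eqI[OF C] by blast
  then show "component r (S - C) D" using D unfolding component_def by blast
qed

lemma component_Un:
  assumes C: "component r T C" and sym: "\<And>x y. r x y \<Longrightarrow> r y x"
    and sep: "\<And>x y. x \<in> S \<Longrightarrow> y \<in> C \<Longrightarrow> \<not> r x y" and disj: "S \<inter> C = {}"
  shows "component r (S \<union> C) D \<longleftrightarrow> component r S D \<or> D = C"
proof
  assume D: "component r (S \<union> C) D"
  show "component r S D \<or> D = C"
  proof (cases "D \<inter> C = {}")
    case True
    then show ?thesis using D unfolding component_def by blast
  next
    case False
    then obtain x where x: "x \<in> D" "x \<in> C" by blast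
    have "D \<subseteq> C" using component_subset[OF D x] D sep sym unfolding component_def by blast
    moreover have "C \<subseteq> D" using component_subset[OF C x(2,1)] D unfolding component_def by blast
    ultimately show ?thesis by blast
  qed
next
  assume "component r S D \<or> D = C"
  then show "component r (S \<union> C) D"
  proof
    assume D: "component r S D"
    then show ?thesis using sep unfolding component_def by blast
  next
    assume "D = C"
    then show ?thesis using C sep sym unfolding component_def by blast
  qed
qed

lemma unit_classes_iff:
  assumes "S \<subseteq> lunits n"
  shows "C \<in> unit_classes n S \<longleftrightarrow> component (adjacent n) S C"
proof -
  have "{(U, W). U \<in> S \<and> W \<in> S \<and> adjacent n U W} = rel_on (adjacent n) S" unfolding rel_on_def by blast
  moreover have "adjacent n W U" if "U \<in> S" "W \<in> S" "adjacent n U W" for U W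
    using adjacent_sym[of U n W] that assms by blast
  ultimately show ?thesis
    unfolding unit_classes_def using quotient_rtrancl_iff_component[of S "adjacent n" C] by simp
qed

section \<open>Regions of units and regions of cells\<close>

definition units_over :: "nat \<Rightarrow> (int \<times> int) set \<Rightarrow> lunit set" where
  "units_over n K = {U \<in> lunits n. cell_of U \<in> K}"

definition strip_cells :: "nat \<Rightarrow> (int \<times> int) set" where
  "strip_cells n = {k. - int n \<le> snd k \<and> snd k \<le> 0}"

lemma cells_subset_strip: "cells n l P Q \<subseteq> strip_cells n"
  unfolding cells_def strip_cells_def by auto

lemma unit_at_in_lunits: "unit_at sd k \<in> lunits n \<longleftrightarrow> k \<in> strip_cells n"
  by (simp add: lunits_iff strip_cells_def)

lemma adjacent_unit_at:
  assumes "k \<in> strip_cells n" "k' \<in> strip_cells n"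
  shows "adjacent n (unit_at sd k) (unit_at sd k') \<longleftrightarrow> cell_adj k k'"
proof -
  have "\<not> adjacent_across (unit_at sd k) (unit_at sd k')" "\<not> adjacent_across (unit_at sd k') (unit_at sd k)"
    unfolding adjacent_across_iff by (cases sd; simp)+
  then show ?thesis
    unfolding adjacent_def using adjacent_same_side_iff[of "unit_at sd k" n "unit_at sd k'"] assms
    by (simp add: unit_at_in_lunits)
qed

lemma adjacent_unit_at_across: "snd k = 0 \<Longrightarrow> adjacent n (unit_at sd k) (unit_at sd' k)"
  unfolding adjacent_def adjacent_across_iff adjacent_same_side_def
  by (cases sd; cases sd') (auto simp: lunit_vertices_def left_vertex_def unit_at_def cell_of_def ht_def)

definition region_of :: "(int \<times> int) set \<Rightarrow> (int \<times> int) set \<Rightarrow> bool" where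
  "region_of Z K \<longleftrightarrow> component cell_adj Z K \<and> (\<exists>x. (x, 0) \<in> K)"

text \<open>Because of the height-0 unit, a component containing both sides is stable under duality,
  and hence determined by its lower half.\<close>

lemma component_units_over_iff:
  assumes Z: "Z \<subseteq> strip_cells n"
  shows "component (adjacent n) (units_over n Z) C \<and> (\<exists>U\<in>C. lunit_height U = 0) \<longleftrightarrow>
    (\<exists>K. C = units_over n K \<and> region_of Z K)"
proof
  assume "component (adjacent n) (units_over n Z) C \<and> (\<exists>U\<in>C. lunit_height U = 0)"
  then have C: "component (adjacent n) (units_over n Z) C" and "\<exists>U\<in>C. lunit_height U = 0" by auto
  then obtain U0 where "U0 \<in> C" "lunit_height U0 = 0" by blast
  then have U0: "U0 \<in> C" "snd (cell_of U0) = 0"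
    by (cases "fst U0"; simp add: lunit_height_cell_of)+
  have CX: "C \<subseteq> units_over n Z" using C unfolding component_def by blast
  have XU: "unit_at sd (cell_of U) \<in> units_over n Z" if "U \<in> C" for U sd
    using that CX Z by (auto simp: units_over_def unit_at_in_lunits)
  have cl: "W \<in> C" if "U \<in> C" "W \<in> units_over n Z" "adjacent n U W" for U W
    using that C unfolding component_def by blast
  \<comment> \<open>\<open>?D\<close> collects the units whose counterparts on both sides lie in
    \<open>C\<close>. It contains the unit of height 0, and an adjacency is copied to either side,
    so it is all of \<open>C\<close>.\<close>
  let ?D = "{U \<in> C. \<forall>sd. unit_at sd (cell_of U) \<in> C}"
  have "C \<subseteq> ?D"
  proof (rule component_subset[OF C U0(1)])
    show "U0 \<in> ?D"
      using U0 cl[OF U0(1) XU[OF U0(1)]] adjacent_unit_at_across[OF U0(2), of n "fst U0"] by simp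
    fix U W assume U: "U \<in> ?D" and W: "W \<in> C" and adj: "adjacent n U W"
    have UW: "U \<in> lunits n" "W \<in> lunits n" using U W CX unfolding units_over_def by auto
    then have "cell_of U \<in> strip_cells n" "cell_of W \<in> strip_cells n" "cell_adj (cell_of U) (cell_of W)"
      using adjacent_cell_adj[OF UW adj] by (auto simp: lunits_iff strip_cells_def)
    then have "adjacent n (unit_at sd (cell_of U)) (unit_at sd (cell_of W))" for sd
      using adjacent_unit_at by blast
    then show "W \<in> ?D" using U W cl XU by blast
  qed
  then have dual: "unit_at sd (cell_of U) \<in> C" if "U \<in> C" for sd U using that by blast
  let ?K = "cell_of ` C"
  have CK: "C = units_over n ?K"
  proof (intro equalityI subsetI)
    fix U assume "U \<in> units_over n ?K"
    then obtain W where "W \<in> C" "cell_of U = cell_of W" unfolding units_over_def by auto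
    then show "U \<in> C" using dual[of W "fst U"] unit_at_cell_of[of U] by simp
  qed (use CX in \<open>auto simp: units_over_def\<close>)
  have KX: "?K \<subseteq> Z" using CX unfolding units_over_def by auto
  have closed: "k' \<in> ?K" if "k \<in> ?K" "k' \<in> Z" "cell_adj k k'" for k k'
  proof -
    have "unit_at Lower k \<in> C" using that dual by auto
    moreover have "unit_at Lower k' \<in> units_over n Z" using that Z by (auto simp: units_over_def unit_at_in_lunits)
    moreover have "adjacent n (unit_at Lower k) (unit_at Lower k')" using adjacent_unit_at that Z KX by blast
    ultimately have "unit_at Lower k' \<in> C" using cl by blast
    then show ?thesis by (metis cell_of_unit_at image_eqI)
  qed
  have "(cell_of U, cell_of W) \<in> (rel_on cell_adj ?K)\<^sup>*" if "U \<in> C" "W \<in> C" for U W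
  proof -
    have "(U, W) \<in> (rel_on (adjacent n) C)\<^sup>*" using that C unfolding component_def by blast
    then show ?thesis
    proof (induction rule: rtrancl_induct)
      case (step V W)
      then have "(cell_of V, cell_of W) \<in> rel_on cell_adj ?K"
        using adjacent_cell_adj[of V n W] CX unfolding rel_on_def units_over_def by auto
      then show ?case using step by (meson rtrancl_into_rtrancl)
    qed simp
  qed
  then have "component cell_adj Z ?K" unfolding component_def using U0(1) KX closed by blast
  moreover have "\<exists>x. (x, 0) \<in> ?K" using U0 by (metis image_eqI prod.collapse)
  ultimately show "\<exists>K. C = units_over n K \<and> region_of Z K" using CK unfolding region_of_def by blast
next
  assume "\<exists>K. C = units_over n K \<and> region_of Z K"
  then obtain K x where C: "C = units_over n K" and K: "component cell_adj Z K" and x: "(x, 0) \<in> K"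
    unfolding region_of_def by blast
  have KX: "K \<subseteq> Z" using K unfolding component_def by blast
  have unitC: "unit_at sd k \<in> C" if "k \<in> K" for sd k
    using that KX Z unfolding C units_over_def by (auto simp: unit_at_in_lunits)
  have closed: "W \<in> C" if "U \<in> C" "W \<in> units_over n Z" "adjacent n U W" for U W
    using that K adjacent_cell_adj[of U n W] unfolding C units_over_def component_def by blast
  have same: "(unit_at sd k, unit_at sd k') \<in> (rel_on (adjacent n) C)\<^sup>*" if "k \<in> K" "k' \<in> K" for sd k k'
  proof -
    have "(k, k') \<in> (rel_on cell_adj K)\<^sup>*" using that K unfolding component_def by blast
    then show ?thesis
    proof (induction rule: rtrancl_induct)
      case (step k' k'')
      then have "(unit_at sd k', unit_at sd k'') \<in> rel_on (adjacent n) C"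
        using unitC subsetD[OF subset_trans[OF KX Z]] adjacent_unit_at[of k' n k'' sd] unfolding rel_on_def by blast
      then show ?case using step by (meson rtrancl_into_rtrancl)
    qed simp
  qed
  \<comment> \<open>Two units are joined by walking to \<open>(x, 0)\<close> on the side of the
    first, crossing there if necessary, and walking on the side of the second.\<close>
  have "(U, W) \<in> (rel_on (adjacent n) C)\<^sup>*" if "U \<in> C" "W \<in> C" for U W
  proof -
    have k: "cell_of U \<in> K" "cell_of W \<in> K" using that unfolding C units_over_def by auto
    have "(unit_at (fst U) (cell_of U), unit_at (fst U) (x, 0)) \<in> (rel_on (adjacent n) C)\<^sup>*" using same k x by blast
    moreover have "(unit_at (fst U) (x, 0), unit_at (fst W) (x, 0)) \<in> rel_on (adjacent n) C"
      using unitC[OF x] adjacent_unit_at_across unfolding rel_on_def by auto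
    moreover have "(unit_at (fst W) (x, 0), unit_at (fst W) (cell_of W)) \<in> (rel_on (adjacent n) C)\<^sup>*" using same k x by blast
    ultimately show ?thesis by (simp only: unit_at_cell_of)
  qed
  then have "component (adjacent n) (units_over n Z) C"
    unfolding component_def using unitC[OF x] closed KX unfolding C units_over_def by blast
  moreover have "\<exists>U\<in>C. lunit_height U = 0"
    using unitC[OF x, of Lower] by (intro bexI[of _ "unit_at Lower (x, 0)"]) (auto simp: lunit_height_cell_of)
  ultimately show "component (adjacent n) (units_over n Z) C \<and> (\<exists>U\<in>C. lunit_height U = 0)" by blast
qed

section \<open>Lattice points of a region\<close>

definition region_points :: "nat \<Rightarrow> (int \<times> int) set \<Rightarrow> spoint set" where
  "region_points n K = \<Union> (lunit_points n ` units_over n K)"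

lemma region_points_iff:
  "(sd, w) \<in> region_points n K \<longleftrightarrow> w \<in> strip n sd \<and>
     (\<exists>x s. (x, s) \<in> K \<inter> strip_cells n \<and>
       (case sd of Lower \<Rightarrow> of_int x \<le> fst w \<and> fst w \<le> of_int x + 1 \<and> of_int (s - x) - 1 \<le> snd w \<and> snd w \<le> of_int (s - x)
        | Upper \<Rightarrow> of_int (x - s - 1) \<le> fst w \<and> fst w \<le> of_int (x - s - 1) + 1 \<and> of_int (1 - x) - 1 \<le> snd w \<and> snd w \<le> of_int (1 - x)))"
    (is "?L \<longleftrightarrow> ?R")
proof -
  have "?L \<longleftrightarrow> (\<exists>U\<in>units_over n K. (sd, w) \<in> lunit_points n U)" unfolding region_points_def by blast
  also have "\<dots> \<longleftrightarrow> (\<exists>k\<in>K \<inter> strip_cells n. (sd, w) \<in> lunit_points n (unit_at sd k))"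
  proof
    assume "\<exists>U\<in>units_over n K. (sd, w) \<in> lunit_points n U"
    then obtain U where U: "U \<in> units_over n K" "(sd, w) \<in> lunit_points n U" by blast
    then have "fst U = sd" unfolding lunit_points_def by auto
    then have "U = unit_at sd (cell_of U)" using unit_at_cell_of[of U] by simp
    then show "\<exists>k\<in>K \<inter> strip_cells n. (sd, w) \<in> lunit_points n (unit_at sd k)"
      using U unfolding units_over_def by (intro bexI[of _ "cell_of U"]) (auto simp: lunits_iff strip_cells_def)
  next
    assume "\<exists>k\<in>K \<inter> strip_cells n. (sd, w) \<in> lunit_points n (unit_at sd k)"
    then obtain k where k: "k \<in> K" "k \<in> strip_cells n" "(sd, w) \<in> lunit_points n (unit_at sd k)" by blast
    then show "\<exists>U\<in>units_over n K. (sd, w) \<in> lunit_points n U"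
      by (intro bexI[of _ "unit_at sd k"]) (auto simp: units_over_def unit_at_in_lunits)
  qed
  also have "\<dots> \<longleftrightarrow> ?R"
    by (cases sd; cases w) (auto simp: lunit_points_def unit_at_def image_iff Bex_def)
  finally show ?thesis .
qed

text \<open>A lattice point lies in a closed unit square only as a corner, which gives the four
  cells of \<open>vertex_in\<close>. For an upper point, \<open>1 - snd w\<close> is the abscissa of
  the dual point.\<close>

lemma lattice_point_region_iff:
  assumes K: "K \<subseteq> strip_cells n"
  shows "- int n \<le> ht w \<Longrightarrow> ht w \<le> 0 \<Longrightarrow> (Lower, lat w) \<in> region_points n K \<longleftrightarrow> vertex_in K (fst w) (ht w)"
    and "0 \<le> ht w \<Longrightarrow> ht w \<le> int n \<Longrightarrow> (Upper, lat w) \<in> region_points n K \<longleftrightarrow> vertex_in K (1 - snd w) (- ht w)"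
proof -
  obtain a b where w: "w = (a, b)" by (cases w)
  have unit: "real_of_int x \<le> real_of_int v \<and> real_of_int v \<le> real_of_int x + 1 \<longleftrightarrow> v = x \<or> v = x + 1" for x v by linarith
  have unit': "real_of_int y - 1 \<le> real_of_int v \<and> real_of_int v \<le> real_of_int y \<longleftrightarrow> v = y - 1 \<or> v = y" for y v by linarith
  have K': "(x, s) \<in> K \<inter> strip_cells n \<longleftrightarrow> (x, s) \<in> K" for x s using K by auto
  { assume h: "- int n \<le> ht w" "ht w \<le> 0"
    have "real_of_int (- int n) \<le> real_of_int (a + b)" "real_of_int (a + b) \<le> 0" using h by (auto simp: w ht_def)
    then have st: "lat w \<in> strip n Lower" by (simp add: w lat_def ht_def)
    have "(Lower, lat w) \<in> region_points n K \<longleftrightarrow>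
        (\<exists>x s. (x, s) \<in> K \<and> (a = x \<or> a = x + 1) \<and> (b = s - x - 1 \<or> b = s - x))"
      unfolding region_points_iff K' side.case using st unit unit' by (simp only: w lat_def fst_conv snd_conv) blast
    also have "\<dots> \<longleftrightarrow> vertex_in K a (a + b)"
      unfolding vertex_in_def
    proof
      assume "\<exists>x s. (x, s) \<in> K \<and> (a = x \<or> a = x + 1) \<and> (b = s - x - 1 \<or> b = s - x)"
      then obtain x s where "(x, s) \<in> K" "a = x \<or> a = x + 1" "b = s - x - 1 \<or> b = s - x" by blast
      then show "(a, a + b) \<in> K \<or> (a - 1, a + b) \<in> K \<or> (a - 1, a + b - 1) \<in> K \<or> (a, a + b + 1) \<in> K"
        by (elim disjE) auto
    next
      assume "(a, a + b) \<in> K \<or> (a - 1, a + b) \<in> K \<or> (a - 1, a + b - 1) \<in> K \<or> (a, a + b + 1) \<in> K"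
      then show "\<exists>x s. (x, s) \<in> K \<and> (a = x \<or> a = x + 1) \<and> (b = s - x - 1 \<or> b = s - x)" by force
    qed
    finally show "(Lower, lat w) \<in> region_points n K \<longleftrightarrow> vertex_in K (fst w) (ht w)" by (simp add: w ht_def) }
  { assume h: "0 \<le> ht w" "ht w \<le> int n"
    have "0 \<le> real_of_int (a + b)" "real_of_int (a + b) \<le> real_of_int (int n)" using h by (auto simp: w ht_def)
    then have st: "lat w \<in> strip n Upper" by (simp add: w lat_def ht_def)
    have "(Upper, lat w) \<in> region_points n K \<longleftrightarrow>
        (\<exists>x s. (x, s) \<in> K \<and> (a = x - s - 1 \<or> a = x - s - 1 + 1) \<and> (b = 1 - x - 1 \<or> b = 1 - x))"
      unfolding region_points_iff K' side.case using st unit unit' by (simp only: w lat_def fst_conv snd_conv) blast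
    also have "\<dots> \<longleftrightarrow> vertex_in K (1 - b) (- (a + b))"
      unfolding vertex_in_def
    proof
      assume "\<exists>x s. (x, s) \<in> K \<and> (a = x - s - 1 \<or> a = x - s - 1 + 1) \<and> (b = 1 - x - 1 \<or> b = 1 - x)"
      then obtain x s where "(x, s) \<in> K" "a = x - s - 1 \<or> a = x - s - 1 + 1" "b = 1 - x - 1 \<or> b = 1 - x" by blast
      moreover from this have "(x, s) = (1 - b, - (a + b)) \<or> (x, s) = (1 - b - 1, - (a + b)) \<or>
          (x, s) = (1 - b - 1, - (a + b) - 1) \<or> (x, s) = (1 - b, - (a + b) + 1)"
        unfolding prod.inject by linarith
      ultimately show "(1 - b, - (a + b)) \<in> K \<or> (1 - b - 1, - (a + b)) \<in> K \<or> (1 - b - 1, - (a + b) - 1) \<in> K \<or> (1 - b, - (a + b) + 1) \<in> K"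
        by metis
    next
      assume "(1 - b, - (a + b)) \<in> K \<or> (1 - b - 1, - (a + b)) \<in> K \<or> (1 - b - 1, - (a + b) - 1) \<in> K \<or> (1 - b, - (a + b) + 1) \<in> K"
      then show "\<exists>x s. (x, s) \<in> K \<and> (a = x - s - 1 \<or> a = x - s - 1 + 1) \<and> (b = 1 - x - 1 \<or> b = 1 - x)" by force
    qed
    finally show "(Upper, lat w) \<in> region_points n K \<longleftrightarrow> vertex_in K (1 - snd w) (- ht w)" by (simp add: w ht_def) }
qed

section \<open>Expansion and folding\<close>

text \<open>For II-cells this is the absence of boundary units (\<open>boundary_iff\<close>), for
  I-cells it is automatic (\<open>I_nonboundary\<close>). The equivalences make it symmetric in
  \<open>P\<close> and \<open>Q\<close>, so it survives a change of type.\<close>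

definition nonboundary ::
  "nat \<Rightarrow> nat \<Rightarrow> (nat \<Rightarrow> int \<Rightarrow> int \<Rightarrow> bool) \<Rightarrow> (nat \<Rightarrow> int \<Rightarrow> int \<Rightarrow> bool) \<Rightarrow> (int \<times> int) set \<Rightarrow> bool" where
  "nonboundary n l P Q K \<longleftrightarrow>
     (\<forall>x s. (x, s) \<in> K \<longrightarrow> (P 0 s x \<longleftrightarrow> Q 0 s x) \<and> (P l s x \<longleftrightarrow> Q l s x) \<and> s \<noteq> - int n)"

definition good_region ::
  "nat \<Rightarrow> nat \<Rightarrow> (nat \<Rightarrow> int \<Rightarrow> int \<Rightarrow> bool) \<Rightarrow> (nat \<Rightarrow> int \<Rightarrow> int \<Rightarrow> bool) \<Rightarrow> (int \<times> int) set \<Rightarrow> bool" where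
  "good_region n l P Q K \<longleftrightarrow> region_of (cells n l P Q) K \<and> nonboundary n l P Q K"

lemma nonboundary_sym: "nonboundary n l P Q K \<longleftrightarrow> nonboundary n l Q P K"
  unfolding nonboundary_def by auto

lemma region_of_subset: "region_of Z K \<Longrightarrow> K \<subseteq> Z"
  unfolding region_of_def component_def by blast

lemma good_region_one_type:
  assumes "threshold_family n l P" "threshold_family n l Q" "good_region n l P Q K"
  shows "one_type n l P Q K"
proof -
  have K: "component cell_adj (cells n l P Q) K" using assms(3) unfolding good_region_def region_of_def by blast
  then have "closed_in (cells n l P Q) K" "K \<subseteq> cells n l P Q" unfolding component_def closed_in_def by blast+
  moreover have "closed_in (cells n l Q P) K"
    unfolding closed_in_def using \<open>K \<subseteq> cells n l P Q\<close> cells_disjoint[OF assms(1,2)] by blast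
  ultimately show ?thesis unfolding one_type_def by blast
qed

lemma cells_cong:
  assumes "\<And>i s x. i \<le> l \<Longrightarrow> - int n \<le> s \<Longrightarrow> s \<le> 0 \<Longrightarrow> P i s x = P' i s x"
    and "\<And>i s x. i \<le> l \<Longrightarrow> - int n \<le> s \<Longrightarrow> s \<le> 0 \<Longrightarrow> Q i s x = Q' i s x"
  shows "cells n l P Q = cells n l P' Q'"
  unfolding cells_def using assms by auto

lemma threshold_family_cong:
  assumes "\<And>i s x. i \<le> l \<Longrightarrow> - int n \<le> s \<Longrightarrow> s \<le> 0 \<Longrightarrow> P i s x = P' i s x"
    and P: "threshold_family n l P"
  shows "threshold_family n l P'"
  unfolding threshold_family_def
proof (intro conjI allI impI)
  fix i s x assume "i \<le> l" "- int n \<le> s" "s \<le> 0" "P' i s x"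
  then show "P' i s (x + 1)" using assms(1) threshold_familyD(1)[OF P] by metis
next
  fix i s x assume *: "i < l" "- int n \<le> s" "s \<le> 0" "P' i s x"
  then have "P i s x" using assms(1)[of i s x] by simp
  then have "P (Suc i) s (x - 1)" using threshold_familyD(2)[OF P *(1-3)] by blast
  then show "P' (Suc i) s (x - 1)" using assms(1)[of "Suc i" s "x - 1"] * by simp
next
  fix i s x assume *: "i \<le> l" "- int n \<le> s" "s < 0" "P' i s x"
  then have "P i s x" using assms(1)[of i s x] by simp
  then have "P i (s + 1) (x + 1)" using threshold_familyD(3)[OF P *(1-3)] by blast
  then show "P' i (s + 1) (x + 1)" using assms(1)[of i "s + 1" "x + 1"] * by simp
next
  fix i s x assume *: "i \<le> l" "- int n \<le> s" "s < 0" "P' i (s + 1) x"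
  then have "P i (s + 1) x" using assms(1)[of i "s + 1" x] by simp
  then have "P i s x" using threshold_familyD(4)[OF P *(1-3)] by blast
  then show "P' i s x" using assms(1)[of i s x] * by simp
qed

lemma eq_of_thresholds:
  fixes a b :: int
  assumes "\<And>x. a \<le> x \<longleftrightarrow> b \<le> x"
  shows "a = b"
  using assms[of a] assms[of b] by simp

lemma half_shift:
  "real_of_int g - real_of_int (- s) / 2 + 1 = real_of_int (g + s + 1) - real_of_int s / 2"
  "real_of_int g - real_of_int (- s) / 2 - 1 = real_of_int (g + s - 1) - real_of_int s / 2"
  by linarith+

lemma point_at_half: "point_at r (ereal (real_of_int x - real_of_int r / 2)) = (x, r - x)"
  unfolding point_at_def
proof (rule the_equality)
  show "ht (x, r - x) = r \<and> ereal (hp (lat (x, r - x))) = ereal (real_of_int x - real_of_int r / 2)"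
    by (simp add: hp_lat) (simp add: ht_def)
  fix w assume "ht w = r \<and> ereal (hp (lat w)) = ereal (real_of_int x - real_of_int r / 2)"
  then have "ht w = r" "fst w = x" by (auto simp: hp_lat)
  then show "w = (x, r - x)" by (cases w) (auto simp: ht_def)
qed

definition swap_A :: "nat \<Rightarrow> (int \<times> int) set \<Rightarrow> (nat \<Rightarrow> int \<Rightarrow> int) \<Rightarrow> (nat \<Rightarrow> int \<Rightarrow> int) \<Rightarrow> nat \<Rightarrow> int \<Rightarrow> int" where
  "swap_A l K A G i s = (if flagged K (low_thr A) (upp_thr l G) i s then dual_upp G (Suc i) s else A i s)"

text \<open>The term \<open>A (j - 1) (- r) + r - 1\<close> is the abscissa of the dual lower path
  at height \<open>r\<close>.\<close>

definition swap_G :: "nat \<Rightarrow> (int \<times> int) set \<Rightarrow> (nat \<Rightarrow> int \<Rightarrow> int) \<Rightarrow> (nat \<Rightarrow> int \<Rightarrow> int) \<Rightarrow> nat \<Rightarrow> int \<Rightarrow> int" where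
  "swap_G l K A G j r =
     (if flagged K (low_thr A) (upp_thr l G) (j - 1) (- r) then A (j - 1) (- r) + r - 1 else G j r)"

text \<open>A count that refers to neither type; it equals \<open>n_I\<close> on I-regions and
  \<open>n_II\<close> on II-regions.\<close>

definition even_pairs :: "nat \<Rightarrow> (nat \<Rightarrow> int \<Rightarrow> int) \<Rightarrow> (nat \<Rightarrow> int \<Rightarrow> int) \<Rightarrow> (int \<times> int) set \<Rightarrow> nat" where
  "even_pairs l A G K =
     card {i \<in> {1..<l}. even (A i 0 - G (Suc i) 0) \<and> flagged K (low_thr A) (upp_thr l G) i 0}"

section \<open>Regions of a fixed configuration\<close>

locale path_config =
  fixes n l :: nat and lam mu :: "nat \<Rightarrow> nat" and A G :: "nat \<Rightarrow> int \<Rightarrow> int"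
  assumes n: "1 \<le> n" and l: "l = lam 1" and config: "config n lam mu A G"
    and pos: "\<forall>i\<in>{1..<l}. int (conj_part lam (i + 1)) - int (conj_part mu i) \<le> int n"
begin

abbreviation "P \<equiv> low_thr A"
abbreviation "Q \<equiv> upp_thr l G"
abbreviation "H \<equiv> half_paths_of n l A G"

lemmas P = threshold_low_thr[OF config, folded l] and Q = threshold_upp_thr[OF config, folded l]
lemmas c = configD[OF config, folded l]

lemma P_0 [simp]: "\<not> P 0 s x" and Q_l [simp]: "Q l s x"
  by (simp_all add: low_thr_def upp_thr_def)

text \<open>The index of an I-cell is neither 0 nor \<open>l\<close>, where one predicate is
  constant, and strict decrease then settles both outer indices. At height \<open>- n\<close> the
  positions are prescribed, and a cell of index \<open>i\<close> would make the conjugate part of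
  \<open>lam\<close> at \<open>i + 1\<close> exceed that of \<open>mu\<close> at \<open>i\<close> by
  more than \<open>n\<close>.\<close>

lemma I_nonboundary:
  assumes K: "K \<subseteq> cells n l P Q"
  shows "nonboundary n l P Q K"
  unfolding nonboundary_def
proof (intro allI impI)
  fix x s assume "(x, s) \<in> K"
  then obtain i where i: "i \<le> l" "- int n \<le> s" "s \<le> 0" "P i s x" "\<not> Q i s x" using K unfolding cells_def by blast
  have i0: "0 < i" "i < l" using i P_0[of s x] Q_l[of s x] by (metis gr0I) (metis i(1,5) Q_l order.not_eq_order_implies_strict)
  have "\<not> Q 0 s x"
    using threshold_index_mono[OF Q i0(1) i(1-3)] threshold_mono[OF Q i(1-3), of "x - 1" x] i(5) by auto
  moreover have "P l s x"
    using threshold_index_mono[OF P i0(2) _ i(2-4)] threshold_mono[OF P _ i(2,3), of l "x - 1" x] by auto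
  moreover have "s \<noteq> - int n"
  proof
    assume "s = - int n"
    then have "A i (- int n) < dual_upp G (Suc i) (- int n)" using i by (auto simp: low_thr_def upp_thr_def)
    moreover have "i \<in> {1..<l}" using i0 by simp
    ultimately show False
      using bspec[OF pos \<open>i \<in> {1..<l}\<close>] c(2)[of i] c(4)[of "Suc i"] i0 by (auto simp: dual_upp_def)
  qed
  ultimately show "(P 0 s x \<longleftrightarrow> Q 0 s x) \<and> (P l s x \<longleftrightarrow> Q l s x) \<and> s \<noteq> - int n" by simp
qed

lemma I_regions_eq: "I_regions n l H = {region_points n K | K. good_region n l P Q K}"
proof -
  have I: "I_units n l H = units_over n (cells n l P Q)" unfolding units_cells units_over_def ..
  have "units_over n (cells n l P Q) \<subseteq> lunits n" unfolding units_over_def by blast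
  then have *: "C \<in> unit_classes n (I_units n l H) \<and> (\<exists>U\<in>C. lunit_height U = 0) \<longleftrightarrow>
      (\<exists>K. C = units_over n K \<and> region_of (cells n l P Q) K)" for C
    unfolding I using unit_classes_iff component_units_over_iff[OF cells_subset_strip] by blast
  have g: "good_region n l P Q K \<longleftrightarrow> region_of (cells n l P Q) K" for K
    unfolding good_region_def using I_nonboundary[OF region_of_subset] by blast
  show ?thesis unfolding I_regions_def * g region_points_def by blast
qed

lemma boundary_iff:
  assumes K: "K \<subseteq> cells n l Q P"
  shows "units_over n K \<inter> boundary_II_units n l H = {} \<longleftrightarrow> nonboundary n l Q P K"
proof -
  have II: "U \<in> II_units n l H" if "U \<in> units_over n K" for U
    using that K unfolding units_cells units_over_def by blast
  have at: "U \<in> boundary_II_units n l H \<longleftrightarrow>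
      (Q 0 s x \<noteq> P 0 s x \<or> Q l s x \<noteq> P l s x \<or> s = - int n)"
    if U: "U \<in> units_over n K" and xs: "cell_of U = (x, s)" for U x s
  proof -
    have Ul: "U \<in> lunits n" using U unfolding units_over_def by blast
    have "\<bar>lunit_height U\<bar> = int n \<longleftrightarrow> s = - int n"
      using Ul xs unfolding lunits_iff lunit_height_cell_of by (cases "fst U") auto
    then show ?thesis
      unfolding boundary_II_units_def using II[OF U] unit_at_thresholds(2)[OF Ul, where A = A and G = G and l = l] xs by auto
  qed
  show ?thesis
  proof
    assume L: "units_over n K \<inter> boundary_II_units n l H = {}"
    show "nonboundary n l Q P K"
      unfolding nonboundary_def
    proof (intro allI impI)
      fix x s assume xs: "(x, s) \<in> K"
      then have U: "unit_at Lower (x, s) \<in> units_over n K"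
        using K cells_subset_strip[of n l Q P] by (auto simp: units_over_def unit_at_in_lunits)
      then show "(Q 0 s x \<longleftrightarrow> P 0 s x) \<and> (Q l s x \<longleftrightarrow> P l s x) \<and> s \<noteq> - int n"
        using at[OF U, of x s] L by auto
    qed
  next
    assume R: "nonboundary n l Q P K"
    have "U \<notin> boundary_II_units n l H" if U: "U \<in> units_over n K" for U
    proof -
      obtain x s where xs: "cell_of U = (x, s)" by (cases "cell_of U")
      then have "(x, s) \<in> K" using U unfolding units_over_def by auto
      then show ?thesis using at[OF U xs] R unfolding nonboundary_def by auto
    qed
    then show "units_over n K \<inter> boundary_II_units n l H = {}" by blast
  qed
qed

lemma II_regions_eq: "II_regions n l H = {region_points n K | K. good_region n l Q P K}"
proof -
  have I: "II_units n l H = units_over n (cells n l Q P)" unfolding units_cells units_over_def ..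
  have "units_over n (cells n l Q P) \<subseteq> lunits n" unfolding units_over_def by blast
  then have *: "C \<in> unit_classes n (II_units n l H) \<and> (\<exists>U\<in>C. lunit_height U = 0) \<longleftrightarrow>
      (\<exists>K. C = units_over n K \<and> region_of (cells n l Q P) K)" for C
    unfolding I using unit_classes_iff component_units_over_iff[OF cells_subset_strip] by blast
  have **: "(C \<in> unit_classes n (II_units n l H) \<and> (\<exists>U\<in>C. lunit_height U = 0) \<and> C \<inter> boundary_II_units n l H = {}) \<longleftrightarrow>
      (\<exists>K. C = units_over n K \<and> good_region n l Q P K)" for C
    unfolding good_region_def conj_assoc[symmetric] * using boundary_iff region_of_subset by blast
  show ?thesis unfolding II_regions_def ** region_points_def by blast
qed

lemma thr_P: "i \<in> {1..l} \<Longrightarrow> P i s (A i s)" "i \<in> {1..l} \<Longrightarrow> \<not> P i s (A i s - 1)"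
  and thr_Q: "i < l \<Longrightarrow> Q i s (dual_upp G (Suc i) s)" "i < l \<Longrightarrow> \<not> Q i s (dual_upp G (Suc i) s - 1)"
  by (auto simp: low_thr_def upp_thr_def)

text \<open>If \<open>\<alpha>\<^sub>i\<close> and the dual of
  \<open>\<beta>\<^sub>i\<^sub>+\<^sub>1\<close> differ at height 0, each endpoint alone detects
  whether the pair is exchanged, so the disjunction in \<open>meets0\<close> collapses.\<close>

lemma meets0_iff:
  assumes K: "one_type n l P Q K" and i: "i \<in> {1..<l}" and ne: "A i 0 \<noteq> G (Suc i) 0 + 1"
  shows "meets0 H i (region_points n K) \<longleftrightarrow> flagged K P Q i 0"
proof -
  have st: "K \<subseteq> strip_cells n" using K cells_subset_strip unfolding one_type_def by blast
  have i': "i \<in> {1..l}" "i \<le> l" "i < l" "Suc i \<in> {1..l}" using i by auto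
  have ne': "\<exists>x. P i 0 x \<noteq> Q i 0 x" "\<exists>x. Q i 0 x \<noteq> P i 0 x"
    using ne i eq_of_thresholds[of "A i 0" "dual_upp G (Suc i) 0"] by (auto simp: low_thr_def upp_thr_def dual_upp_def)
  have last: "last (fst H i) = graph_point (A i) 0" and hd: "hd (snd H (i + 1)) = graph_point (G (Suc i)) 0"
    using i' by (simp_all add: half_paths_of_def lower_path_def upper_path_def last_map hd_map last_upto hd_upto)
  have "(Lower, lat (last (fst H i))) \<in> region_points n K \<longleftrightarrow> vertex_in K (A i 0) 0"
    unfolding last using lattice_point_region_iff(1)[OF st, of "graph_point (A i) 0"] by (simp add: graph_point_def ht_def)
  also have "\<dots> \<longleftrightarrow> flagged K P Q i 0"
    using vertex_in_flagged_iff[OF P Q K i'(2) _ _ thr_P[OF i'(1)] ne'(1)] by simp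
  finally have 1: "(Lower, lat (last (fst H i))) \<in> region_points n K \<longleftrightarrow> flagged K P Q i 0" .
  have "(Upper, lat (hd (snd H (i + 1)))) \<in> region_points n K \<longleftrightarrow> vertex_in K (dual_upp G (Suc i) 0) 0"
    unfolding hd using lattice_point_region_iff(2)[OF st, of "graph_point (G (Suc i)) 0"] by (simp add: graph_point_def ht_def dual_upp_def add.commute)
  also have "\<dots> \<longleftrightarrow> flagged K Q P i 0"
    using vertex_in_flagged_iff[OF Q P one_type_sym[OF K] i'(2) _ _ thr_Q[OF i'(3)] ne'(2)] by simp
  finally have 2: "(Upper, lat (hd (snd H (i + 1)))) \<in> region_points n K \<longleftrightarrow> flagged K P Q i 0"
    unfolding flagged_sym[of K P] .
  show ?thesis unfolding meets0_def 1 2 by simp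
qed

lemma gap_eq: "i \<in> {1..<l} \<Longrightarrow> gap H i = of_int (A i 0 - G (Suc i) 0)"
  by (auto simp: gap_def half_paths_of_def hpos_lower_path hpos_upper_path)

text \<open>The type of the cell between the two curves decides their order. Through the shift of
  duality a II-cell needs a gap of at least 2.\<close>

lemma flagged_type:
  assumes "i \<in> {1..<l}" "flagged K P Q i 0"
  shows "K \<subseteq> cells n l P Q \<Longrightarrow> A i 0 \<le> G (Suc i) 0" and "K \<subseteq> cells n l Q P \<Longrightarrow> G (Suc i) 0 + 1 < A i 0"
proof -
  obtain x where x: "(x, 0) \<in> K" "P i 0 x \<noteq> Q i 0 x" using assms(2) unfolding flagged_def by blast
  have "(x, 0) \<in> cells n l P Q" if "P i 0 x" using that x(2) cellsI[of P i 0 x Q l n] assms(1) by auto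
  moreover have "(x, 0) \<in> cells n l Q P" if "Q i 0 x" using that x(2) cellsI[of Q i 0 x P l n] assms(1) by auto
  ultimately show "K \<subseteq> cells n l P Q \<Longrightarrow> A i 0 \<le> G (Suc i) 0" and "K \<subseteq> cells n l Q P \<Longrightarrow> G (Suc i) 0 + 1 < A i 0"
    using x cells_disjoint[OF P Q] assms(1) by (auto simp: low_thr_def upp_thr_def dual_upp_def)
qed

text \<open>An even gap is never 1, so the coincidence excluded in \<open>meets0_iff\<close> does
  not occur; and being flagged already implies the sign of the gap.\<close>

lemma n_I_eq:
  assumes K: "good_region n l P Q K"
  shows "n_I l H (region_points n K) = even_pairs l A G K"
proof -
  note K1 = good_region_one_type[OF P Q K]
  have sub: "K \<subseteq> cells n l P Q" using K unfolding good_region_def by (blast dest: region_of_subset)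
  have "gap H i \<le> 0 \<and> even_real (gap H i) \<and> meets0 H i (region_points n K) \<longleftrightarrow>
      even (A i 0 - G (Suc i) 0) \<and> flagged K P Q i 0" if i: "i \<in> {1..<l}" for i
  proof -
    have g: "gap H i \<le> 0 \<longleftrightarrow> A i 0 \<le> G (Suc i) 0" unfolding gap_eq[OF i] by simp
    have e: "even_real (gap H i) \<longleftrightarrow> even (A i 0 - G (Suc i) 0)" unfolding gap_eq[OF i] by (rule even_real_of_int)
    show ?thesis unfolding g e using meets0_iff[OF K1 i] flagged_type(1)[OF i _ sub] by fastforce
  qed
  then have "{i \<in> {1..<l}. gap H i \<le> 0 \<and> even_real (gap H i) \<and> meets0 H i (region_points n K)} =
      {i \<in> {1..<l}. even (A i 0 - G (Suc i) 0) \<and> flagged K P Q i 0}" by blast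
  then show ?thesis unfolding n_I_def even_pairs_def by simp
qed

lemma n_II_eq:
  assumes K: "good_region n l Q P K"
  shows "n_II l H (region_points n K) = even_pairs l A G K"
proof -
  note K1 = one_type_sym[OF good_region_one_type[OF Q P K]]
  have sub: "K \<subseteq> cells n l Q P" using K unfolding good_region_def by (blast dest: region_of_subset)
  have "gap H i > 0 \<and> even_real (gap H i) \<and> meets0 H i (region_points n K) \<longleftrightarrow>
      even (A i 0 - G (Suc i) 0) \<and> flagged K P Q i 0" if i: "i \<in> {1..<l}" for i
  proof -
    have g: "gap H i > 0 \<longleftrightarrow> A i 0 > G (Suc i) 0" unfolding gap_eq[OF i] by simp
    have e: "even_real (gap H i) \<longleftrightarrow> even (A i 0 - G (Suc i) 0)" unfolding gap_eq[OF i] by (rule even_real_of_int)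
    show ?thesis unfolding g e using meets0_iff[OF K1 i] flagged_type(2)[OF i _ sub] by fastforce
  qed
  then have "{i \<in> {1..<l}. gap H i > 0 \<and> even_real (gap H i) \<and> meets0 H i (region_points n K)} =
      {i \<in> {1..<l}. even (A i 0 - G (Suc i) 0) \<and> flagged K P Q i 0}" by blast
  then show ?thesis unfolding n_II_def even_pairs_def by simp
qed

definition is_region :: "(int \<times> int) set \<Rightarrow> bool" where
  "is_region K \<longleftrightarrow> good_region n l P Q K \<or> good_region n l Q P K"

lemma odd_regions_eq: "odd_regions n l H = {region_points n K | K. is_region K \<and> odd (even_pairs l A G K)}"
  unfolding odd_regions_def I_regions_eq II_regions_eq is_region_def using n_I_eq n_II_eq by auto

lemma is_region_one_type: "is_region K \<Longrightarrow> one_type n l P Q K"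
  unfolding is_region_def using good_region_one_type[OF P Q] one_type_sym[OF good_region_one_type[OF Q P]] by blast

lemma is_region_nonboundary:
  assumes "is_region K" "(x, s) \<in> K"
  shows "P 0 s x \<longleftrightarrow> Q 0 s x" "P l s x \<longleftrightarrow> Q l s x" "s \<noteq> - int n"
  using assms unfolding is_region_def good_region_def nonboundary_def by blast+

lemma is_region_subset_strip: "is_region K \<Longrightarrow> K \<subseteq> strip_cells n"
  using is_region_one_type cells_subset_strip unfolding one_type_def by blast

lemma not_flagged_boundary:
  assumes "is_region K"
  shows "\<not> flagged K P Q 0 s" "\<not> flagged K P Q l s" "\<not> flagged K P Q i (- int n)"
  using is_region_nonboundary[OF assms] unfolding flagged_def by blast+

section \<open>The configuration after an exchange along a region\<close>

context
  fixes K
  assumes K: "is_region K"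
begin

abbreviation "A' \<equiv> swap_A l K A G"
abbreviation "G' \<equiv> swap_G l K A G"

text \<open>Turns the exchange of positions into \<open>swap_on\<close>, where
  \<open>threshold_family_swap_on\<close> applies. A flagged index is neither 0 nor
  \<open>l\<close>, so both exchanged curves are finite.\<close>

lemma low_thr_swap_A:
  assumes "i \<le> l" "- int n \<le> s" "s \<le> 0"
  shows "low_thr A' i s x \<longleftrightarrow> swap_on K P Q i s x"
proof (cases "flagged K P Q i s")
  case True
  then have i: "i \<in> {1..l}" "i < l"
    using not_flagged_boundary(1,2)[OF K, of s] assms(1) by (metis One_nat_def Suc_leI atLeastAtMost_iff gr0I, metis order.not_eq_order_implies_strict)
  have "swap_on K P Q i s x = Q i s x"
    using flagged_swap_on(2)[OF P Q is_region_one_type[OF K] assms thr_P[OF i(1)] True] .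
  then show ?thesis using True i by (auto simp: low_thr_def upp_thr_def swap_A_def)
next
  case False
  then show ?thesis using not_flagged_swap_on[OF False] by (auto simp: low_thr_def swap_A_def)
qed

lemma upp_thr_swap_G:
  assumes "i \<le> l" "- int n \<le> s" "s \<le> 0"
  shows "upp_thr l G' i s x \<longleftrightarrow> swap_on K Q P i s x"
proof (cases "flagged K P Q i s")
  case True
  then have i: "i \<in> {1..l}" "i < l"
    using not_flagged_boundary(1,2)[OF K, of s] assms(1) by (metis One_nat_def Suc_leI atLeastAtMost_iff gr0I, metis order.not_eq_order_implies_strict)
  have "swap_on K Q P i s x = P i s x"
    using flagged_swap_on(2)[OF Q P one_type_sym[OF is_region_one_type[OF K]] assms thr_Q[OF i(2)]] True flagged_sym[of K P Q] by simp
  then show ?thesis using True i by (auto simp: low_thr_def upp_thr_def swap_G_def dual_upp_def)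
next
  case False
  then have "\<not> flagged K Q P i s" using flagged_sym[of K P Q] by simp
  then show ?thesis using not_flagged_swap_on[of K Q P i s x] False by (auto simp: upp_thr_def swap_G_def dual_upp_def)
qed

lemma thresholds_swapped:
  shows "threshold_family n l (low_thr A')" "threshold_family n l (upp_thr l G')"
proof -
  have K1: "closed_in (cells n l P Q) K" "closed_in (cells n l Q P) K" using is_region_one_type[OF K] unfolding one_type_def by auto
  show "threshold_family n l (low_thr A')"
    by (rule threshold_family_cong[OF _ threshold_family_swap_on[OF P Q K1]]) (simp add: low_thr_swap_A)
  show "threshold_family n l (upp_thr l G')"
    by (rule threshold_family_cong[OF _ threshold_family_swap_on[OF Q P K1(2,1)]]) (simp add: upp_thr_swap_G)
qed

definition "J = {i \<in> {1..<l}. flagged K P Q i 0}"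

lemma J_subset: "J \<subseteq> {1..<l}"
  unfolding J_def by blast

lemma A'_0: "i \<in> {1..l} \<Longrightarrow> A' i 0 = swap_low J (\<lambda>i. A i 0) (\<lambda>j. G j 0) i"
  using not_flagged_boundary(2)[OF K, of 0] unfolding J_def swap_low_def swap_A_def dual_upp_def
  by (cases "i = l") auto

lemma G'_0: "j \<in> {1..l} \<Longrightarrow> G' j 0 = swap_upp J (\<lambda>i. A i 0) (\<lambda>j. G j 0) j"
proof -
  assume j: "j \<in> {1..l}"
  have "j \<in> Suc ` J \<longleftrightarrow> flagged K P Q (j - 1) 0"
  proof
    assume f: "flagged K P Q (j - 1) 0"
    then have "j - 1 \<noteq> 0" using not_flagged_boundary(1)[OF K, of 0] by metis
    then have "j - 1 \<in> J" "j = Suc (j - 1)" using f j unfolding J_def by auto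
    then show "j \<in> Suc ` J" by blast
  qed (auto simp: J_def)
  then show ?thesis unfolding swap_upp_def swap_G_def by simp
qed

text \<open>Unit steps and strict decrease are read off from the threshold rules at the new
  positions. The prescribed endpoints stay because regions avoid the extreme heights, and
  \<open>balanced_swap\<close> applies because all cells of a region have one type.\<close>

lemma config_swapped: "config n lam mu A' G'"
  unfolding config_def l[symmetric]
proof (intro conjI ballI allI impI)
  note tA = thresholds_swapped(1) and tG = thresholds_swapped(2)
  fix i assume i: "i \<in> {1..l}"
  show "unit_steps (- int n) 0 (A' i)"
    unfolding unit_steps_def
  proof (intro allI impI)
    fix s assume s: "- int n \<le> s" "s < 0"
    have "low_thr A' i (s + 1) (A' i s + 1)" "low_thr A' i s (A' i (s + 1))"
      using threshold_familyD(3)[OF tA _ s, of i "A' i s"] threshold_familyD(4)[OF tA _ s, of i "A' i (s + 1)"] i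
      by (auto simp: low_thr_def)
    then show "A' i (s + 1) = A' i s \<or> A' i (s + 1) = A' i s + 1" by (auto simp: low_thr_def)
  qed
  show "A' i (- int n) = int (conj_part mu i) + 1 - int i"
    using c(2)[OF i] not_flagged_boundary(3)[OF K] by (simp add: swap_A_def)
  have j: "i - 1 < l" "Suc (i - 1) = i" using i by auto
  show "unit_steps 0 (int n) (G' i)"
    unfolding unit_steps_def
  proof (intro allI impI)
    fix r assume r: "0 \<le> r" "r < int n"
    let ?s = "- r - 1"
    have s: "- int n \<le> ?s" "?s < 0" using r by auto
    have "upp_thr l G' (i - 1) (?s + 1) (dual_upp G' i ?s + 1)" "upp_thr l G' (i - 1) ?s (dual_upp G' i (?s + 1))"
      using threshold_familyD(3)[OF tG _ s, of "i - 1" "dual_upp G' i ?s"]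
        threshold_familyD(4)[OF tG _ s, of "i - 1" "dual_upp G' i (?s + 1)"] j
      by (auto simp: upp_thr_def)
    then show "G' i (r + 1) = G' i r \<or> G' i (r + 1) = G' i r + 1"
      using j by (auto simp: upp_thr_def dual_upp_def add.commute)
  qed
  show "G' i (int n) = int (conj_part lam i) + 1 - int i"
    using c(4)[OF i] not_flagged_boundary(3)[OF K] by (simp add: swap_G_def)
next
  fix s assume s: "- int n \<le> s" "s \<le> 0"
  show "decreasing_on l (\<lambda>i. A' i s)"
    unfolding decreasing_on_def
  proof (intro ballI impI)
    fix i j assume ij: "i \<in> {1..l}" "j \<in> {1..l}" "i < j"
    then have "low_thr A' j s (A' i s - 1)"
      using threshold_index_mono[OF thresholds_swapped(1) ij(3) _ s, of "A' i s"] by (auto simp: low_thr_def)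
    then show "A' j s < A' i s" by (auto simp: low_thr_def)
  qed
next
  fix r assume r: "0 \<le> r" "r \<le> int n"
  show "decreasing_on l (\<lambda>j. G' j r)"
    unfolding decreasing_on_def
  proof (intro ballI impI)
    fix i j assume ij: "i \<in> {1..l}" "j \<in> {1..l}" "i < j"
    have s: "- int n \<le> - r" "- r \<le> 0" using r by auto
    have ij': "i - 1 < j - 1" "j - 1 \<le> l" "Suc (i - 1) = i" "Suc (j - 1) = j" "j - 1 \<noteq> l" using ij by auto
    then have "upp_thr l G' (j - 1) (- r) (dual_upp G' i (- r) - 1)"
      using threshold_index_mono[OF thresholds_swapped(2) ij'(1,2) s, of "dual_upp G' i (- r)"] by (auto simp: upp_thr_def)
    then show "G' j r < G' i r" using ij' by (auto simp: upp_thr_def dual_upp_def)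
  qed
next
  let ?a = "\<lambda>i. A i 0" and ?b = "\<lambda>j. G j 0"
  have "balanced l (swap_low J ?a ?b) (swap_upp J ?a ?b)"
  proof (rule balanced_swap[OF c(7) _ _ J_subset])
    show "decreasing_on l ?a" "decreasing_on l ?b" using c(5)[of 0] c(6)[of 0] by auto
    have "K \<subseteq> cells n l P Q \<or> K \<subseteq> cells n l Q P" using is_region_one_type[OF K] unfolding one_type_def by blast
    then show "(\<forall>i\<in>J. ?a i \<le> ?b (Suc i)) \<or> (\<forall>i\<in>J. ?b (Suc i) < ?a i)"
      using flagged_type[of _ K] unfolding J_def by force
  qed
  moreover have "coverage l (\<lambda>i. A' i 0) (\<lambda>j. G' j 0) e t = coverage l (swap_low J ?a ?b) (swap_upp J ?a ?b) e t" for e t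
    unfolding coverage_def using A'_0 G'_0 by (auto intro!: arg_cong2[where f = "(-)"] sum.cong)
  ultimately show "balanced l (\<lambda>i. A' i 0) (\<lambda>j. G' j 0)" unfolding balanced_def by simp
qed

lemma swapped_path_config: "path_config n l lam mu A' G'"
  by (rule path_config.intro[OF n l config_swapped pos])

lemma eps_lower_point:
  assumes i: "i \<in> {1..l}" and s: "- int n \<le> s" "s \<le> 0"
  shows "(if (Lower, lat (graph_point (A i) s)) \<in> region_points n K
      then point_at s (upp_dual l H (i + 1) s) else graph_point (A i) s) = graph_point (A' i) s"
proof -
  have il: "i \<le> l" using i by simp
  have row: "low_thr A' i s x \<longleftrightarrow> (if vertex_in K (A i s) s then Q i s x else P i s x)" for x
    using swap_on_row[OF P Q is_region_one_type[OF K] il s thr_P[OF i]] low_thr_swap_A[OF il s] by simp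
  have V: "(Lower, lat (graph_point (A i) s)) \<in> region_points n K \<longleftrightarrow> vertex_in K (A i s) s"
    using lattice_point_region_iff(1)[OF is_region_subset_strip[OF K], of "graph_point (A i) s"] s by (simp add: graph_point_def)
      (simp add: ht_def)
  show ?thesis
  proof (cases "vertex_in K (A i s) s")
    case True
    \<comment> \<open>For \<open>i = l\<close> the exchanged row would contain every position, but
      the one before the new threshold is excluded.\<close>
    have "i \<noteq> l" using row[of "A' i s - 1"] True i by (auto simp: low_thr_def)
    then have "A' i s = dual_upp G (Suc i) s"
      using row True i by (intro eq_of_thresholds) (auto simp: low_thr_def upp_thr_def)
    moreover have "upp_dual l H (i + 1) s = ereal (real_of_int (dual_upp G (Suc i) s) - real_of_int s / 2)"
    proof -
      have "upp l H (i + 1) (- s) = ereal (real_of_int (G (Suc i) (- s)) - real_of_int (- s) / 2)"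
        by (subst upp_half_paths) (use \<open>i \<noteq> l\<close> i s in auto)
      then show ?thesis
        unfolding upp_dual_def dual_upp_def one_ereal_def by (simp only: plus_ereal.simps half_shift)
    qed
    ultimately show ?thesis using True V by (simp add: point_at_half graph_point_def)
  next
    case False
    then have "A' i s = A i s" using row i by (intro eq_of_thresholds) (auto simp: low_thr_def)
    then show ?thesis using False V by (simp add: graph_point_def)
  qed
qed

lemma eps_upper_point:
  assumes j: "j \<in> {1..l}" and r: "0 \<le> r" "r \<le> int n"
  shows "(if (Upper, lat (graph_point (G j) r)) \<in> region_points n K
      then point_at r (low_dual H (j - 1) r) else graph_point (G j) r) = graph_point (G' j) r"
proof -
  have il: "j - 1 \<le> l" "j - 1 < l" "Suc (j - 1) = j" "j - 1 \<noteq> l" and s: "- int n \<le> - r" "- r \<le> 0" using j r by auto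
  have row: "upp_thr l G' (j - 1) (- r) x \<longleftrightarrow> (if vertex_in K (dual_upp G j (- r)) (- r) then P (j - 1) (- r) x else Q (j - 1) (- r) x)" for x
    using swap_on_row[OF Q P one_type_sym[OF is_region_one_type[OF K]] il(1) s thr_Q[OF il(2)]] upp_thr_swap_G[OF il(1) s] il(3) by simp
  have V: "(Upper, lat (graph_point (G j) r)) \<in> region_points n K \<longleftrightarrow> vertex_in K (dual_upp G j (- r)) (- r)"
    using lattice_point_region_iff(2)[OF is_region_subset_strip[OF K], of "graph_point (G j) r"] r
    by (simp add: graph_point_def dual_upp_def) (simp add: ht_def algebra_simps)
  have G'r: "G' j r = dual_upp G' j (- r) + r - 1" and Gr: "G j r = dual_upp G j (- r) + r - 1" by (simp_all add: dual_upp_def)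
  show ?thesis
  proof (cases "vertex_in K (dual_upp G j (- r)) (- r)")
    case True
    \<comment> \<open>Index 0 would leave the exchanged row empty, but it contains its own
      threshold.\<close>
    have j0: "j - 1 \<noteq> 0" using row[of "dual_upp G' j (- r)"] True il by (auto simp: upp_thr_def low_thr_def)
    then have "dual_upp G' j (- r) = A (j - 1) (- r)"
      using row True il by (intro eq_of_thresholds) (auto simp: low_thr_def upp_thr_def)
    then have "G' j r = A (j - 1) (- r) + r - 1" unfolding G'r by simp
    moreover have "low_dual H (j - 1) r = ereal (real_of_int (A (j - 1) (- r) + r - 1) - real_of_int r / 2)"
    proof -
      have "low H (j - 1) (- r) = ereal (real_of_int (A (j - 1) (- r)) - real_of_int (- r) / 2)"
        by (subst low_half_paths) (use il s j0 in auto)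
      then show ?thesis
        unfolding low_dual_def one_ereal_def by (simp only: ereal_minus half_shift)
    qed
    ultimately show ?thesis using True V by (simp only: point_at_half graph_point_def if_True)
  next
    case False
    then have "dual_upp G' j (- r) = dual_upp G j (- r)" using row il by (intro eq_of_thresholds) (auto simp: upp_thr_def)
    then have "G' j r = G j r" unfolding G'r Gr by simp
    then show ?thesis using False V by (simp add: graph_point_def)
  qed
qed

lemma eps_region: "eps l (region_points n K) H = half_paths_of n l A' G'"
proof -
  have "map (\<lambda>w. if (Lower, lat w) \<in> region_points n K
      then point_at (ht w) (upp_dual l H (i + 1) (ht w)) else w) (fst H i) = lower_path n (A' i)" if "i \<in> {1..l}" for i
  proof -
    have Hi: "fst H i = lower_path n (A i)" using that by (simp add: half_paths_of_def)
    show ?thesis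
      unfolding Hi lower_path_def map_map comp_def ht_graph_point
      by (rule map_cong[OF refl], rule eps_lower_point[OF that]) auto
  qed
  moreover have "map (\<lambda>w. if (Upper, lat w) \<in> region_points n K
      then point_at (ht w) (low_dual H (i - 1) (ht w)) else w) (snd H i) = upper_path n (G' i)" if "i \<in> {1..l}" for i
  proof -
    have Hi: "snd H i = upper_path n (G i)" using that by (simp add: half_paths_of_def)
    show ?thesis
      unfolding Hi upper_path_def map_map comp_def ht_graph_point
      by (rule map_cong[OF refl], rule eps_upper_point[OF that]) auto
  qed
  ultimately show ?thesis
    unfolding eps_def half_paths_of_def[of n l A' G'] by (intro arg_cong2[where f = Pair] restrict_ext)
qed

lemma cells_swapped:
  "cells n l (low_thr A') (upp_thr l G') = cells n l P Q - K \<union> cells n l Q P \<inter> K"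
  "cells n l (upp_thr l G') (low_thr A') = cells n l Q P - K \<union> cells n l P Q \<inter> K"
  unfolding cells_swap_on[symmetric] by (rule cells_cong; simp add: low_thr_swap_A upp_thr_swap_G)+

lemma nonboundary_swapped:
  assumes "K1 \<subseteq> strip_cells n"
  shows "nonboundary n l (low_thr A') (upp_thr l G') K1 \<longleftrightarrow> nonboundary n l P Q K1"
proof -
  have "(low_thr A' i s x \<longleftrightarrow> upp_thr l G' i s x) \<longleftrightarrow> (P i s x \<longleftrightarrow> Q i s x)" if "(x, s) \<in> K1" "i \<le> l" for i s x
  proof -
    have s: "- int n \<le> s" "s \<le> 0" using that(1) assms unfolding strip_cells_def by auto
    show ?thesis unfolding low_thr_swap_A[OF that(2) s] upp_thr_swap_G[OF that(2) s] swap_on_def by auto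
  qed
  then show ?thesis unfolding nonboundary_def by simp
qed

text \<open>The new difference is \<open>(b + 1) - (a - 1)\<close>, of the same parity as
  \<open>a - b\<close>, and trading the two predicates does not change where they differ.\<close>

lemma even_pairs_swapped: "even_pairs l A' G' K1 = even_pairs l A G K1"
proof -
  have "flagged K1 (low_thr A') (upp_thr l G') i 0 \<longleftrightarrow> flagged K1 P Q i 0" if "i \<in> {1..<l}" for i
    using low_thr_swap_A[of i 0] upp_thr_swap_G[of i 0] that unfolding flagged_def swap_on_def by auto
  moreover have "even (A' i 0 - G' (Suc i) 0) \<longleftrightarrow> even (A i 0 - G (Suc i) 0)" if "i \<in> {1..<l}" for i
    unfolding swap_A_def swap_G_def dual_upp_def by auto
  ultimately show ?thesis unfolding even_pairs_def by (intro arg_cong[where f = card]) blast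
qed

text \<open>\<open>K\<close> leaves one type of cells and joins the other. As cells of different
  types are never adjacent, \<open>K\<close> stays a component and no other component
  changes.\<close>

lemma is_region_swapped: "path_config.is_region n l A' G' K1 \<longleftrightarrow> is_region K1"
proof -
  interpret S: path_config n l lam mu A' G' by (rule swapped_path_config)
  have refl: "cell_adj x x" for x by (simp add: cell_adj_def)
  have main: "(region_of (Z - K) K1 \<or> region_of (Y \<union> K) K1) \<longleftrightarrow> (region_of Z K1 \<or> region_of Y K1)"
    if K: "region_of Z K" and sep: "\<And>x y. x \<in> Z \<Longrightarrow> y \<in> Y \<Longrightarrow> \<not> cell_adj x y" for Z Y
  proof -
    have K1: "component cell_adj Z K" "\<exists>x. (x, 0) \<in> K" "K \<subseteq> Z" using K unfolding region_of_def component_def by blast+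
    have "Y \<inter> K = {}" using sep refl K1(3) by blast
    then show ?thesis
      unfolding region_of_def
      using component_Diff[OF K1(1) cell_adj_sym refl, of K1] component_Un[OF K1(1) cell_adj_sym, of Y K1] sep K1(2,3) cell_adj_sym K1(1)
      by blast
  qed
  have nb: "region_of Z K1 \<Longrightarrow> Z \<subseteq> strip_cells n \<Longrightarrow>
      nonboundary n l (low_thr A') (upp_thr l G') K1 \<longleftrightarrow> nonboundary n l P Q K1" for Z
    using nonboundary_swapped region_of_subset by blast
  have iff: "path_config.is_region n l A' G' K1 \<longleftrightarrow>
      (region_of (cells n l (low_thr A') (upp_thr l G')) K1 \<or> region_of (cells n l (upp_thr l G') (low_thr A')) K1) \<and> nonboundary n l P Q K1"
    unfolding S.is_region_def good_region_def nonboundary_sym[of n l "upp_thr l G'"]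
    using nb cells_subset_strip by blast
  have iff': "is_region K1 \<longleftrightarrow> (region_of (cells n l P Q) K1 \<or> region_of (cells n l Q P) K1) \<and> nonboundary n l P Q K1"
    unfolding is_region_def good_region_def nonboundary_sym[of n l Q] by blast
  have disj: "cells n l P Q \<inter> cells n l Q P = {}" using cells_disjoint[OF P Q] .
  show ?thesis
  proof (cases "good_region n l P Q K")
    case True
    then have K: "region_of (cells n l P Q) K" unfolding good_region_def by blast
    then have sub: "K \<subseteq> cells n l P Q" by (rule region_of_subset)
    have e: "cells n l (low_thr A') (upp_thr l G') = cells n l P Q - K" "cells n l (upp_thr l G') (low_thr A') = cells n l Q P \<union> K"
      unfolding cells_swapped using sub disj by blast+
    show ?thesis unfolding iff iff' e using main[OF K cells_not_adjacent[OF P Q]] by blast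
  next
    case False
    then have K: "region_of (cells n l Q P) K" using K unfolding is_region_def good_region_def by blast
    then have sub: "K \<subseteq> cells n l Q P" by (rule region_of_subset)
    have e: "cells n l (low_thr A') (upp_thr l G') = cells n l P Q \<union> K" "cells n l (upp_thr l G') (low_thr A') = cells n l Q P - K"
      unfolding cells_swapped using sub disj by blast+
    show ?thesis unfolding iff iff' e using main[OF K cells_not_adjacent[OF Q P]] by blast
  qed
qed

lemma odd_regions_swapped: "odd_regions n l (half_paths_of n l A' G') = odd_regions n l H"
proof -
  interpret S: path_config n l lam mu A' G' by (rule swapped_path_config)
  show ?thesis unfolding S.odd_regions_eq odd_regions_eq is_region_swapped even_pairs_swapped ..
qed

lemma swap_twice: "half_paths_of n l (swap_A l K A' G') (swap_G l K A' G') = H"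
proof -
  interpret S: path_config n l lam mu A' G' by (rule swapped_path_config)
  have K': "S.is_region K" using K is_region_swapped by blast
  have sw: "swap_on K (low_thr A') (upp_thr l G') i s x = P i s x" "swap_on K (upp_thr l G') (low_thr A') i s x = Q i s x"
    if "i \<le> l" "- int n \<le> s" "s \<le> 0" for i s x
    using low_thr_swap_A[OF that] upp_thr_swap_G[OF that] unfolding swap_on_def by auto
  have "swap_A l K A' G' i s = A i s" if "i \<in> {1..l}" "- int n \<le> s" "s \<le> 0" for i s
    using S.low_thr_swap_A[OF K', of i s] sw(1)[of i s] that by (intro eq_of_thresholds) (auto simp: low_thr_def)
  moreover have "swap_G l K A' G' j r = G j r" if "j \<in> {1..l}" "0 \<le> r" "r \<le> int n" for j r
  proof -
    have j: "j - 1 \<le> l" "Suc (j - 1) = j" "j - 1 \<noteq> l" using that by auto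
    have "dual_upp (swap_G l K A' G') j (- r) = dual_upp G j (- r)"
      using S.upp_thr_swap_G[OF K', of "j - 1" "- r"] sw(2)[of "j - 1" "- r"] that j
      by (intro eq_of_thresholds) (auto simp: upp_thr_def)
    then show ?thesis unfolding dual_upp_def by simp
  qed
  ultimately show ?thesis
    unfolding half_paths_of_def by (auto intro!: restrict_ext lower_path_cong upper_path_cong)
qed

end

end

section \<open>The rightmost odd region\<close>

definition top_vertex :: "(int \<times> int) set \<Rightarrow> int" where
  "top_vertex K = Max {v. vertex_in K v 0}"

lemma top_vertex:
  assumes "finite K" "K \<subseteq> strip_cells n" "(x, 0) \<in> K"
  shows "vertex_in K (top_vertex K) 0" "vertex_in K v 0 \<Longrightarrow> v \<le> top_vertex K"
    "(top_vertex K - 1, 0) \<in> K \<or> (top_vertex K - 1, -1) \<in> K"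
proof -
  have no1: "(v, 1) \<notin> K" for v using assms(2) unfolding strip_cells_def by auto
  have "{v. vertex_in K v 0} \<subseteq> fst ` K \<union> (\<lambda>k. fst k + 1) ` K"
    unfolding vertex_in_def by (auto simp: image_iff) force+
  then have fin: "finite {v. vertex_in K v 0}" using assms(1) finite_subset by blast
  have ne: "{v. vertex_in K v 0} \<noteq> {}" using assms(3) unfolding vertex_in_def by blast
  show top: "vertex_in K (top_vertex K) 0" using Max_in[OF fin ne] unfolding top_vertex_def by simp
  show le: "v \<le> top_vertex K" if "vertex_in K v 0" for v
    using Max_ge[OF fin] that unfolding top_vertex_def by simp
  \<comment> \<open>Otherwise the right vertex of this cell would lie further right.\<close>
  have "(top_vertex K, 0) \<notin> K"
    using le[of "top_vertex K + 1"] unfolding vertex_in_def by auto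
  then show "(top_vertex K - 1, 0) \<in> K \<or> (top_vertex K - 1, -1) \<in> K"
    using top no1 unfolding vertex_in_def by auto
qed

text \<open>Along height 0 the upper copy of a cell lies one position to the left of the lower copy,
  so the maximum is attained at a lattice point of the lower side.\<close>

lemma rightmost0_region_points:
  assumes K: "finite K" "K \<subseteq> strip_cells n" "(x, 0) \<in> K"
  shows "rightmost0 (region_points n K) = of_int (top_vertex K)"
  unfolding rightmost0_def
proof (rule Greatest_equality)
  let ?v = "top_vertex K"
  have "(Lower, lat (?v, - ?v)) \<in> region_points n K"
    using lattice_point_region_iff(1)[OF K(2), of "(?v, - ?v)"] top_vertex(1)[OF K] by simp
  moreover have "ht (lat (?v, - ?v)) = 0" "hp (lat (?v, - ?v)) = of_int ?v" by (simp_all add: lat_def ht_def hp_def)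
  ultimately show "\<exists>s w. (s, w) \<in> region_points n K \<and> ht w = 0 \<and> of_int ?v = hp w" by metis
  fix t assume "\<exists>s w. (s, w) \<in> region_points n K \<and> ht w = 0 \<and> t = hp w"
  then obtain sd w where w: "(sd, w) \<in> region_points n K" "ht w = 0" "t = hp w" by blast
  then have t: "t = fst w" "snd w = - fst w" by (auto simp: ht_def hp_def)
  obtain y s where k: "(y, s) \<in> K" "s \<le> 0" and pt: "(case sd of
        Lower \<Rightarrow> of_int y \<le> fst w \<and> fst w \<le> of_int y + 1 \<and> of_int (s - y) - 1 \<le> snd w \<and> snd w \<le> of_int (s - y)
      | Upper \<Rightarrow> of_int (y - s - 1) \<le> fst w \<and> fst w \<le> of_int (y - s - 1) + 1 \<and> of_int (1 - y) - 1 \<le> snd w \<and> snd w \<le> of_int (1 - y))"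
    using w(1) unfolding region_points_iff strip_cells_def by auto
  have "t \<le> of_int (y + 1) \<and> real_of_int s \<ge> -1"
  proof (cases sd)
    case Lower
    then have "fst w \<le> of_int y + 1" "snd w \<le> of_int (s - y)" using pt by simp_all
    then show ?thesis using t by simp
  next
    case Upper
    then have "of_int (y - s - 1) \<le> fst w" "of_int (1 - y) - 1 \<le> snd w" using pt by simp_all
    then show ?thesis using t by simp
  qed
  then have "t \<le> of_int (y + 1)" "s = 0 \<or> s = -1" using k(2) by auto
  moreover have "vertex_in K (y + 1) 0" if "s = 0 \<or> s = -1" using that k(1) unfolding vertex_in_def by auto
  ultimately show "t \<le> of_int ?v"
    using top_vertex(2)[OF K, of "y + 1"] by (meson of_int_le_iff order_trans)
qed

context path_config
begin

text \<open>A finite set containing every region: nonboundary cells have an index strictly between 0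
  and \<open>l\<close>, where both curves are finite. The maxima below need this.\<close>

definition frame :: "(int \<times> int) set" where
  "frame = (\<Union>i\<in>{1..<l}. \<Union>s\<in>{- int n..0}. {min (A i s) (dual_upp G (Suc i) s)..max (A i s) (dual_upp G (Suc i) s)} \<times> {s})"

lemma finite_frame: "finite frame"
  unfolding frame_def by auto

lemma is_region_frame:
  assumes K: "is_region K"
  shows "K \<subseteq> frame"
proof
  fix k assume k: "k \<in> K"
  obtain x s where xs: "k = (x, s)" by (cases k)
  have "(x, s) \<in> cells n l P Q \<or> (x, s) \<in> cells n l Q P"
    using is_region_one_type[OF K] k xs unfolding one_type_def by blast
  then obtain i where i: "i \<le> l" "- int n \<le> s" "s \<le> 0" "P i s x \<noteq> Q i s x" unfolding cells_def by blast
  have "i \<noteq> 0" "i \<noteq> l" using is_region_nonboundary[OF K] k i(4) unfolding xs by metis+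
  then have "i \<in> {1..<l}" using i(1) by auto
  moreover have "min (A i s) (dual_upp G (Suc i) s) \<le> x" "x \<le> max (A i s) (dual_upp G (Suc i) s)"
    using i(4) \<open>i \<noteq> 0\<close> \<open>i \<noteq> l\<close> by (auto simp: low_thr_def upp_thr_def)
  ultimately show "k \<in> frame" unfolding frame_def xs using i by auto
qed

lemma is_region_finite: "is_region K \<Longrightarrow> finite K"
  using is_region_frame finite_frame finite_subset by blast

lemma is_region_0: "is_region K \<Longrightarrow> \<exists>x. (x, 0) \<in> K"
  unfolding is_region_def good_region_def region_of_def by blast

text \<open>Each region contains a cell of height 0 or -1 whose abscissa is one less than the top
  vertex. Any two such cells are equal or adjacent, so the regions have the same type and then
  coincide.\<close>

lemma region_top_unique:
  assumes K1: "is_region K1" and K2: "is_region K2" and eq: "top_vertex K1 = top_vertex K2"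
  shows "K1 = K2"
proof -
  obtain x1 x2 where x: "(x1, 0) \<in> K1" "(x2, 0) \<in> K2" using is_region_0 K1 K2 by blast
  note t1 = top_vertex(3)[OF is_region_finite[OF K1] is_region_subset_strip[OF K1] x(1)]
  note t2 = top_vertex(3)[OF is_region_finite[OF K2] is_region_subset_strip[OF K2] x(2)]
  obtain u1 u2 where u: "u1 \<in> K1" "u2 \<in> K2" "cell_adj u1 u2" "cell_adj u2 u1"
  proof -
    let ?v = "top_vertex K1 - 1"
    have "cell_adj (?v, a) (?v, b)" if "a \<in> {0, -1}" "b \<in> {0, -1}" for a b using that by (auto simp: cell_adj_def)
    moreover obtain a where "a \<in> {0, -1}" "(?v, a) \<in> K1" using t1 by blast
    moreover obtain b where "b \<in> {0, -1}" "(?v, b) \<in> K2" using t2 eq by auto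
    ultimately show ?thesis using that by blast
  qed
  have same: "K1 = K2" if "region_of Z K1" "region_of Z K2" for Z
  proof -
    have C: "component cell_adj Z K1" "component cell_adj Z K2" using that unfolding region_of_def by simp_all
    have "u2 \<in> Z" using region_of_subset[OF that(2)] u(2) by blast
    moreover have "\<forall>x\<in>K1. \<forall>y\<in>Z. cell_adj x y \<longrightarrow> y \<in> K1"
      using C(1) unfolding component_def by (elim conjE)
    ultimately have "u2 \<in> K1" using u(1,3) by blast
    then show ?thesis by (rule component_eqI[OF C _ u(2)])
  qed
  have not: False if "region_of (cells n l P Q) K" "region_of (cells n l Q P) K'" "u \<in> K" "u' \<in> K'" "cell_adj u u'" for K K' u u'
    using cells_not_adjacent[OF P Q, of u u'] region_of_subset that by blast
  have "region_of (cells n l P Q) K1 \<or> region_of (cells n l Q P) K1" "region_of (cells n l P Q) K2 \<or> region_of (cells n l Q P) K2"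
    using K1 K2 unfolding is_region_def good_region_def by blast+
  then show ?thesis
  proof (elim disjE)
    assume "region_of (cells n l P Q) K1" "region_of (cells n l P Q) K2"
    then show ?thesis by (rule same)
  next
    assume "region_of (cells n l Q P) K1" "region_of (cells n l Q P) K2"
    then show ?thesis by (rule same)
  next
    assume "region_of (cells n l P Q) K1" "region_of (cells n l Q P) K2"
    then show ?thesis using not[OF _ _ u(1,2,3)] by blast
  next
    assume "region_of (cells n l Q P) K1" "region_of (cells n l P Q) K2"
    then show ?thesis using not[OF _ _ u(2,1,4)] by blast
  qed
qed

lemma top_odd_region_exists:
  assumes p: "pi_map l p = H" and ne: "odd_regions n l H \<noteq> {}"
  shows "\<exists>K. is_region K \<and> odd (even_pairs l A G K) \<and> is_top_odd_region n l p (region_points n K)"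
    and "\<exists>!V. is_top_odd_region n l p V"
proof -
  let ?S = "{K. is_region K \<and> odd (even_pairs l A G K)}"
  have r: "rightmost0 (region_points n K) = of_int (top_vertex K)" if "is_region K" for K
    using rightmost0_region_points is_region_finite[OF that] is_region_subset_strip[OF that] is_region_0[OF that] by blast
  have "?S \<subseteq> Pow frame" using is_region_frame by blast
  then have fin: "finite ?S" using finite_frame finite_subset by blast
  obtain K0 where "K0 \<in> ?S" using ne unfolding odd_regions_eq by blast
  then have "Max (top_vertex ` ?S) \<in> top_vertex ` ?S" using fin by (intro Max_in) auto
  then obtain K where K: "is_region K" "odd (even_pairs l A G K)" "top_vertex K = Max (top_vertex ` ?S)" by auto
  have "is_top_odd_region n l p (region_points n K)"
    unfolding is_top_odd_region_def p odd_regions_eq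
  proof (intro conjI ballI)
    show "region_points n K \<in> {region_points n K | K. is_region K \<and> odd (even_pairs l A G K)}" using K by blast
    fix W assume "W \<in> {region_points n K | K. is_region K \<and> odd (even_pairs l A G K)}"
    then obtain K' where K': "W = region_points n K'" "K' \<in> ?S" by blast
    have "top_vertex K' \<le> top_vertex K" unfolding K(3) using fin K'(2) by (intro Max_ge) auto
    then show "rightmost0 W \<le> rightmost0 (region_points n K)" using r K(1) K' by simp
  qed
  then show ex: "\<exists>K. is_region K \<and> odd (even_pairs l A G K) \<and> is_top_odd_region n l p (region_points n K)" using K by blast
  have "V = W" if V: "is_top_odd_region n l p V" and W: "is_top_odd_region n l p W" for V W
  proof -
    obtain K1 K2 where K12: "V = region_points n K1" "W = region_points n K2" "is_region K1" "is_region K2"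
      using V W unfolding is_top_odd_region_def p odd_regions_eq by blast
    have "rightmost0 V = rightmost0 W"
      using V W unfolding is_top_odd_region_def by (meson order_antisym)
    then have "top_vertex K1 = top_vertex K2" using r K12 by simp
    then show ?thesis using region_top_unique K12 by blast
  qed
  then show "\<exists>!V. is_top_odd_region n l p V" using ex by blast
qed

end

section \<open>Weights of pairs of half paths\<close>

lemma prod_atLeastLessThan_int_last:
  fixes f :: "int \<Rightarrow> 'm::comm_monoid_mult"
  assumes "a \<le> b"
  shows "(\<Prod>x\<in>{a..<b + 1}. f x) = (\<Prod>x\<in>{a..<b}. f x) * f b"
proof -
  have "{a..<b + 1} = insert b {a..<b}" using assms by auto
  then show ?thesis by (simp add: mult.commute)
qed

lemma prod_atLeastLessThan_int_first:
  fixes f :: "int \<Rightarrow> 'm::comm_monoid_mult"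
  assumes "a < b"
  shows "(\<Prod>x\<in>{a..<b}. f x) = f a * (\<Prod>x\<in>{a + 1..<b}. f x)"
proof -
  have "{a..<b} = insert a {a + 1..<b}" using assms by auto
  then show ?thesis by simp
qed

lemma prod_atLeastLessThan_int_shift:
  fixes f :: "int \<Rightarrow> 'm::comm_monoid_mult"
  shows "(\<Prod>x\<in>{a..<b}. f (x + 1)) = (\<Prod>x\<in>{a + 1..<b + 1}. f x)"
  by (rule prod.reindex_bij_witness[of _ "\<lambda>x. x - 1" "\<lambda>x. x + 1"]) auto

text \<open>Both curves move up one height, from \<open>a, b\<close> to \<open>a1, b1\<close>;
  \<open>h\<close> and \<open>k\<close> are the step weights of a lower and of a dual path. The
  crossed steps with the old row contain the same factors as the uncrossed steps with the new row;
  the shift in \<open>k\<close> accounts for the end cells.\<close>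

lemma cross_unit_row:
  fixes h k :: "int \<Rightarrow> 'm::comm_monoid_mult"
  assumes "a \<le> b" "a1 = a \<or> a1 = a + 1" "b1 = b \<or> b1 = b + 1" "a1 \<le> b1"
  shows "(\<Prod>x\<in>{a..<b}. h x * k (x + 1)) * ((if b1 = b + 1 then h b else 1) * (if a1 = a then k a else 1))
    = (if a1 = a + 1 then h a else 1) * (if b1 = b then k b else 1) * (\<Prod>x\<in>{a1..<b1}. h x * k x)"
proof -
  let ?H = "\<lambda>a b. \<Prod>x\<in>{a..<b}. h x" and ?K = "\<lambda>a b. \<Prod>x\<in>{a..<b}. k x"
  have L: "(\<Prod>x\<in>{a..<b}. h x * k (x + 1)) = ?H a b * ?K (a + 1) (b + 1)"
    by (simp add: prod.distrib prod_atLeastLessThan_int_shift)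
  have R: "(\<Prod>x\<in>{a1..<b1}. h x * k x) = ?H a1 b1 * ?K a1 b1"
    by (simp add: prod.distrib)
  have H1: "?H a (b + 1) = ?H a b * h b" and K1: "?K a (b + 1) = ?K a b * k b"
    using prod_atLeastLessThan_int_last[OF assms(1)] by blast+
  have H2: "?H a (b + 1) = h a * ?H (a + 1) (b + 1)" and K2: "?K a (b + 1) = k a * ?K (a + 1) (b + 1)"
    using prod_atLeastLessThan_int_first[of a "b + 1"] assms(1) by auto
  consider "a1 = a" "b1 = b" | "a1 = a" "b1 = b + 1" | "a1 = a + 1" "b1 = b" "a < b" | "a1 = a + 1" "b1 = b + 1"
    using assms by fastforce
  then show ?thesis
  proof cases
    case 1
    have "?H a b * ?K (a + 1) (b + 1) * k a = ?H a b * (k a * ?K (a + 1) (b + 1))" by (simp only: ac_simps)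
    also have "\<dots> = k b * (?H a b * ?K a b)" unfolding K2[symmetric] K1 by (simp only: ac_simps)
    finally show ?thesis unfolding L R using 1 by simp
  next
    case 2
    have "?H a b * ?K (a + 1) (b + 1) * (h b * k a) = (?H a b * h b) * (k a * ?K (a + 1) (b + 1))" by (simp only: ac_simps)
    also have "\<dots> = ?H a (b + 1) * ?K a (b + 1)" unfolding K2[symmetric] H1[symmetric] ..
    finally show ?thesis unfolding L R using 2 by simp
  next
    case 3
    have "?H a b = h a * ?H (a + 1) b" using prod_atLeastLessThan_int_first 3 by blast
    moreover have "?K (a + 1) (b + 1) = ?K (a + 1) b * k b" by (rule prod_atLeastLessThan_int_last) (use 3 in simp)
    ultimately have "?H a b * ?K (a + 1) (b + 1) = h a * k b * (?H (a + 1) b * ?K (a + 1) b)" by (simp only: ac_simps)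
    then show ?thesis unfolding L R using 3 by simp
  next
    case 4
    have "?H a b * ?K (a + 1) (b + 1) * h b = (?H a b * h b) * ?K (a + 1) (b + 1)" by (simp only: ac_simps)
    also have "\<dots> = h a * (?H (a + 1) (b + 1) * ?K (a + 1) (b + 1))" unfolding H1[symmetric] H2 by (simp only: ac_simps)
    finally show ?thesis unfolding L R using 4 by simp
  qed
qed

text \<open>\<open>E\<close> will be equality of classes in the ring. Working modulo a congruence
  keeps all products ordinary products in a commutative monoid. \<open>zl\<close> and
  \<open>zu\<close> are the weights of NE-steps below and above height 0, by starting height and
  abscissa.\<close>

locale weight_system =
  fixes C :: "'m::comm_monoid_mult set" and E :: "'m \<Rightarrow> 'm \<Rightarrow> bool" and zl zu :: "int \<Rightarrow> int \<Rightarrow> 'm" and n :: nat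
  assumes one: "1 \<in> C" and mult: "u \<in> C \<Longrightarrow> v \<in> C \<Longrightarrow> u * v \<in> C"
    and E_refl: "u \<in> C \<Longrightarrow> E u u" and E_trans: "E u v \<Longrightarrow> E v w \<Longrightarrow> E u w"
    and E_mult: "E u v \<Longrightarrow> E u' v' \<Longrightarrow> E (u * u') (v * v')"
    and zl: "- int n \<le> s \<Longrightarrow> s < 0 \<Longrightarrow> zl s x \<in> C" and zu: "0 \<le> r \<Longrightarrow> r < int n \<Longrightarrow> zu r x \<in> C"
    and unit_rel: "- int n < s \<Longrightarrow> s < 0 \<Longrightarrow>
      E (zl (s - 1) x * zu (- s) (x - s - 1)) (zl s x * zu (- s - 1) (x - s - 1))"
begin

text \<open>A dual path keeps the abscissa \<open>y\<close> from height \<open>s\<close> to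
  \<open>s + 1\<close> exactly when the upper path makes an NE-step at height \<open>- s - 1\<close>
  from abscissa \<open>y - s - 2\<close>.\<close>

definition zd :: "int \<Rightarrow> int \<Rightarrow> 'm" where
  "zd s y = zu (- s - 1) (y - s - 2)"

definition low_step :: "(int \<Rightarrow> int) \<Rightarrow> int \<Rightarrow> 'm" where
  "low_step f s = (if f (s + 1) = f s + 1 then zl s (f s) else 1)"

definition dual_step :: "(int \<Rightarrow> int) \<Rightarrow> int \<Rightarrow> 'm" where
  "dual_step f s = (if f (s + 1) = f s then zd s (f s) else 1)"

definition upp_step :: "(int \<Rightarrow> int) \<Rightarrow> int \<Rightarrow> 'm" where
  "upp_step g r = (if g (r + 1) = g r + 1 then zu r (g r) else 1)"

definition low_weight :: "(int \<Rightarrow> int) \<Rightarrow> 'm" where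
  "low_weight f = (\<Prod>s\<in>{- int n..<0}. low_step f s)"

definition upp_weight :: "(int \<Rightarrow> int) \<Rightarrow> 'm" where
  "upp_weight g = (\<Prod>r\<in>{0..<int n}. upp_step g r)"

text \<open>The 1st, 3rd, ... E-steps start at even distance from \<open>a\<close> and carry the
  letter of an NE-step at height 0; the 2nd, 4th, ... carry the letter of one at height -1.\<close>

definition mid_weight :: "int \<Rightarrow> int \<Rightarrow> 'm" where
  "mid_weight a b = (\<Prod>x\<in>{a..<b}. if even (x - a) then zu 0 x else zl (-1) x)"

lemma zd: "- int n \<le> s \<Longrightarrow> s < 0 \<Longrightarrow> zd s y \<in> C"
  unfolding zd_def by (rule zu) auto

lemma prod_in_C: "(\<And>i. i \<in> S \<Longrightarrow> f i \<in> C) \<Longrightarrow> prod f S \<in> C"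
  by (induction S rule: infinite_finite_induct) (auto simp: one mult)

lemma prod_E: "(\<And>i. i \<in> S \<Longrightarrow> E (f i) (g i)) \<Longrightarrow> E (prod f S) (prod g S)"
  by (induction S rule: infinite_finite_induct) (auto simp: one E_refl E_mult)

lemma low_step_C: "- int n \<le> s \<Longrightarrow> s < 0 \<Longrightarrow> low_step f s \<in> C"
  and dual_step_C: "- int n \<le> s \<Longrightarrow> s < 0 \<Longrightarrow> dual_step f s \<in> C"
  unfolding low_step_def dual_step_def by (auto simp: zl zd one)

lemma upp_step_C: "0 \<le> r \<Longrightarrow> r < int n \<Longrightarrow> upp_step g r \<in> C"
  unfolding upp_step_def by (auto simp: zu one)

lemma low_weight_C: "low_weight f \<in> C" and upp_weight_C: "upp_weight f \<in> C"
  unfolding low_weight_def upp_weight_def by (auto intro!: prod_in_C low_step_C upp_step_C)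

lemma mid_weight_C: "1 \<le> n \<Longrightarrow> mid_weight a b \<in> C"
  unfolding mid_weight_def by (rule prod_in_C) (auto intro!: zl zu)

text \<open>In terms of dual weights the ring relation also shifts the argument of \<open>zd\<close>
  by one, which is the shift absorbed by \<open>cross_unit_row\<close>.\<close>

lemma row_rel:
  assumes "- int n < s" "s < 0"
  shows "E (\<Prod>x\<in>{a..<b}. zl (s - 1) x * zd (s - 1) x) (\<Prod>x\<in>{a..<b}. zl s x * zd s (x + 1))"
proof (rule prod_E)
  fix x
  show "E (zl (s - 1) x * zd (s - 1) x) (zl s x * zd s (x + 1))"
    using unit_rel[OF assms, of x] unfolding zd_def by (simp add: algebra_simps)
qed

text \<open>In the induction step, a whole row of units is pushed down by one height.\<close>

lemma pair_weight_swap: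
  assumes A: "unit_steps (- int n) 0 A" and B: "unit_steps (- int n) 0 B"
    and A': "unit_steps (- int n) 0 A'" and B': "unit_steps (- int n) 0 B'"
    and swA: "\<And>s. - int n \<le> s \<Longrightarrow> s \<le> 0 \<Longrightarrow> A' s = (if sw s then B s else A s)"
    and swB: "\<And>s. - int n \<le> s \<Longrightarrow> s \<le> 0 \<Longrightarrow> B' s = (if sw s then A s else B s)"
    and less: "\<And>s. - int n \<le> s \<Longrightarrow> s \<le> 0 \<Longrightarrow> sw s \<Longrightarrow> A s < B s"
    and bottom: "\<not> sw (- int n)"
  shows "E (low_weight A' * (\<Prod>s\<in>{- int n..<0}. dual_step B' s))
    (low_weight A * (\<Prod>s\<in>{- int n..<0}. dual_step B s) * (if sw 0 then \<Prod>x\<in>{A 0..<B 0}. zl (-1) x * zd (-1) x else 1))"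
proof -
  let ?W = "\<lambda>f g t. (\<Prod>s\<in>{- int n..<t}. low_step f s * dual_step g s)"
  let ?F = "\<lambda>t. if sw t then \<Prod>x\<in>{A t..<B t}. zl (t - 1) x * zd (t - 1) x else 1"
  have WC: "?W f g t \<in> C" if "t \<le> 0" for f g t
    by (rule prod_in_C, rule mult) (use that in \<open>auto intro!: low_step_C dual_step_C\<close>)
  \<comment> \<open>Invariant: up to height \<open>t\<close>, the two pairs differ by the factors of
    the units between the curves at height \<open>t\<close>.\<close>
  have "t \<le> 0 \<longrightarrow> E (?W A' B' t) (?W A B t * ?F t)" if "- int n \<le> t" for t
    using that
  proof (induction t rule: int_ge_induct)
    case base
    then show ?case using bottom by (simp add: E_refl one)
  next
    case (step t)
    show ?case
    proof
      assume t1: "t + 1 \<le> 0"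
      then have IH: "E (?W A' B' t) (?W A B t * ?F t)" using step by simp
      have t: "- int n \<le> t" "t < 0" "t \<le> 0" "- int n \<le> t + 1" using step t1 by auto
      note st = unit_stepsD[OF A t(1,2)] unit_stepsD[OF B t(1,2)] unit_stepsD[OF A' t(1,2)] unit_stepsD[OF B' t(1,2)]
      note s0 = swA[OF t(1,3)] swB[OF t(1,3)] and s1 = swA[OF t(4) t1] swB[OF t(4) t1]
      have W: "?W f g (t + 1) = ?W f g t * (low_step f t * dual_step g t)" for f g
        by (rule prod_atLeastLessThan_int_last[OF step(1)])
      have stepC: "low_step f t * dual_step g t \<in> C" for f g
        using t by (intro mult low_step_C dual_step_C) auto
      show "E (?W A' B' (t + 1)) (?W A B (t + 1) * ?F (t + 1))"
      proof (cases "sw t \<or> sw (t + 1)")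
        case False
        have "low_step A' t = low_step A t" "dual_step B' t = dual_step B t"
          using False s0 s1 unfolding low_step_def dual_step_def by simp_all
        then have "E (?W A' B' (t + 1)) (?W A B t * ?F t * (low_step A t * dual_step B t))"
          unfolding W using E_mult[OF IH E_refl[OF stepC[of A B]]] by simp
        then show ?thesis unfolding W using False by simp
      next
        case True
        \<comment> \<open>An exchange begins or ends only where the curves touch: if only one of two
          consecutive heights is exchanged, the unit steps of both pairs force equal positions at
          the other.\<close>
        have eq0: "A t = B t" if "\<not> sw t"
          using that True s0 s1 st less[OF t(4) t1] by auto
        have eq1: "A (t + 1) = B (t + 1)" if "\<not> sw (t + 1)"
          using that True s0 s1 st less[OF t(1,3)] by auto
        have le0: "A t \<le> B t" using eq0 less[OF t(1,3)] by (cases "sw t") auto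
        have le1: "A (t + 1) \<le> B (t + 1)" using eq1 less[OF t(4) t1] by (cases "sw (t + 1)") auto
        have sA: "A' t = B t" "A' (t + 1) = B (t + 1)" "B' t = A t" "B' (t + 1) = A (t + 1)"
          using s0 s1 eq0 eq1 by (cases "sw t"; cases "sw (t + 1)"; simp)+
        have F0: "?F t = (\<Prod>x\<in>{A t..<B t}. zl (t - 1) x * zd (t - 1) x)" using eq0 by simp
        have F1: "?F (t + 1) = (\<Prod>x\<in>{A (t + 1)..<B (t + 1)}. zl t x * zd t x)" using eq1 by simp
        let ?T = "\<Prod>x\<in>{A t..<B t}. zl t x * zd t (x + 1)"
        have TC: "?T \<in> C" by (rule prod_in_C, rule mult) (use t in \<open>auto intro!: zl zd\<close>)
        \<comment> \<open>At the bottom the weight \<open>zl (t - 1)\<close> would be out of range,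
          but there the row is empty.\<close>
        have rel: "E (?F t) ?T"
        proof (cases "t = - int n")
          case True
          then have "A t = B t" using eq0 bottom by blast
          then show ?thesis unfolding F0 by (simp add: E_refl one)
        qed (use row_rel[of t] t F0 in auto)
        have "E (?W A' B' t) (?W A B t * ?T)"
          by (rule E_trans[OF IH]) (rule E_mult[OF E_refl[OF WC] rel], rule t)
        then have "E (?W A' B' (t + 1)) (?W A B t * ?T * (low_step A' t * dual_step B' t))"
          unfolding W by (rule E_mult) (rule E_refl[OF stepC])
        moreover have "?T * (low_step A' t * dual_step B' t) = low_step A t * dual_step B t * ?F (t + 1)"
          unfolding F1 low_step_def dual_step_def sA
          using cross_unit_row[OF le0 st(1,2) le1, of "zl t" "zd t"] .
        ultimately show ?thesis unfolding W by (simp only: mult.assoc)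
      qed
    qed
  qed
  from this[of 0] show ?thesis unfolding low_weight_def prod.distrib[symmetric] by (cases "sw 0") simp_all
qed

lemma upp_weight_dual:
  assumes "unit_steps 0 (int n) g"
  shows "upp_weight g = (\<Prod>s\<in>{- int n..<0}. dual_step (\<lambda>s. g (- s) + s + 1) s)"
  unfolding upp_weight_def
proof (rule prod.reindex_bij_witness[of _ "\<lambda>s. - s - 1" "\<lambda>r. - r - 1"])
  fix r assume "r \<in> {0..<int n}"
  then have "0 \<le> r" "r < int n" by auto
  then show "dual_step (\<lambda>s. g (- s) + s + 1) (- r - 1) = upp_step g r"
    using unit_stepsD[OF assms, of r] unfolding upp_step_def dual_step_def zd_def by (auto simp: algebra_simps)
qed auto

section \<open>Weights of the E-steps\<close>

definition mid_cover :: "nat \<Rightarrow> (nat \<Rightarrow> int) \<Rightarrow> (nat \<Rightarrow> int) \<Rightarrow> bool \<Rightarrow> int \<Rightarrow> nat" where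
  "mid_cover l a b e x = card {i \<in> {1..l}. a i \<le> x \<and> x < b i \<and> even (a i) = e}"

lemma prod_power_card: "finite S \<Longrightarrow> (\<Prod>i\<in>S. if R i then z else 1) = z ^ card {i \<in> S. R i}"
  by (subst prod.inter_filter[symmetric]) simp_all

text \<open>An E-step starting at \<open>x\<close> carries the barred letter exactly if its path has
  the parity of \<open>x\<close>. So the total depends only on how often each class covers
  \<open>x\<close>.\<close>

lemma prod_mid_weight:
  assumes Y: "finite Y" "\<And>i. i \<in> {1..l} \<Longrightarrow> {a i..<b i} \<subseteq> Y"
  shows "(\<Prod>i\<in>{1..l}. mid_weight (a i) (b i))
    = (\<Prod>x\<in>Y. zu 0 x ^ mid_cover l a b (even x) x * zl (-1) x ^ mid_cover l a b (odd x) x)"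
proof -
  have "mid_weight (a i) (b i) = (\<Prod>x\<in>Y. (if a i \<le> x \<and> x < b i \<and> even (a i) = even x then zu 0 x else 1) *
      (if a i \<le> x \<and> x < b i \<and> even (a i) = odd x then zl (-1) x else 1))" if "i \<in> {1..l}" for i
    unfolding mid_weight_def using Y(1) Y(2)[OF that] by (intro prod.mono_neutral_cong_left) auto
  then have "(\<Prod>i\<in>{1..l}. mid_weight (a i) (b i))
      = (\<Prod>i\<in>{1..l}. \<Prod>x\<in>Y. (if a i \<le> x \<and> x < b i \<and> even (a i) = even x then zu 0 x else 1) *
      (if a i \<le> x \<and> x < b i \<and> even (a i) = odd x then zl (-1) x else 1))" by (rule prod.cong[OF refl])
  also have "\<dots> = (\<Prod>x\<in>Y. \<Prod>i\<in>{1..l}. (if a i \<le> x \<and> x < b i \<and> even (a i) = even x then zu 0 x else 1) *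
      (if a i \<le> x \<and> x < b i \<and> even (a i) = odd x then zl (-1) x else 1))" by (rule prod.swap)
  also have "\<dots> = (\<Prod>x\<in>Y. zu 0 x ^ mid_cover l a b (even x) x * zl (-1) x ^ mid_cover l a b (odd x) x)"
    unfolding mid_cover_def prod.distrib by (subst (1 2) prod_power_card) simp_all
  finally show ?thesis .
qed

text \<open>The permutation drops out as in \<open>matching_coverage\<close>; the right end is
  strict because E-steps are counted by their starting points.\<close>

lemma mid_cover_matching:
  assumes m: "matching l a b \<sigma>"
  shows "int (mid_cover l a (b \<circ> \<sigma>) e x) =
    (\<Sum>j\<in>{1..l}. of_bool (x < b j \<and> even (b j) = e)) - (\<Sum>i\<in>{1..l}. of_bool (x < a i \<and> even (a i) = e))"
proof -
  have "(\<Sum>j\<in>{1..l}. of_bool (x < b j \<and> even (b j) = e) :: int)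
      = (\<Sum>i\<in>{1..l}. of_bool (x < b (\<sigma> i) \<and> even (b (\<sigma> i)) = e))"
    using sum.permute[OF matchingD(1)[OF m], of "\<lambda>j. of_bool (x < b j \<and> even (b j) = e) :: int"] by (simp add: comp_def)
  moreover have "(of_bool (a i \<le> x \<and> x < b (\<sigma> i) \<and> even (a i) = e) :: int) =
      of_bool (x < b (\<sigma> i) \<and> even (b (\<sigma> i)) = e) - of_bool (x < a i \<and> even (a i) = e)" if "i \<in> {1..l}" for i
    using matchingD(2,3)[OF m that] by (auto simp: of_bool_def)
  then have "(\<Sum>i\<in>{1..l}. of_bool (a i \<le> x \<and> x < b (\<sigma> i) \<and> even (a i) = e) :: int) =
      (\<Sum>i\<in>{1..l}. of_bool (x < b (\<sigma> i) \<and> even (b (\<sigma> i)) = e) - of_bool (x < a i \<and> even (a i) = e))"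
    by (rule sum.cong[OF refl])
  ultimately show ?thesis
    unfolding mid_cover_def by (simp add: sum_of_bool_eq Int_def sum_subtractf)
qed

text \<open>An exchanged overlap removes barred letters at the starting points from
  \<open>a i - 1\<close> and unbarred ones at those from \<open>a i\<close>. The shift by one in
  \<open>zd\<close> aligns them to one factor per unit of height 0, the same factor that
  \<open>pair_weight_swap\<close> produces.\<close>

lemma mid_weight_swap:
  assumes m: "matching l a b \<sigma>" and m': "matching l a' b' \<sigma>'"
    and J: "J \<subseteq> {1..<l}" and le: "\<And>i. i \<in> J \<Longrightarrow> a i \<le> b (Suc i)"
    and a': "\<And>i. i \<in> {1..l} \<Longrightarrow> a' i = swap_low J a b i" and b': "\<And>j. j \<in> {1..l} \<Longrightarrow> b' j = swap_upp J a b j"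
  shows "(\<Prod>i\<in>{1..l}. mid_weight (a i) (b (\<sigma> i)))
    = (\<Prod>i\<in>{1..l}. mid_weight (a' i) (b' (\<sigma>' i))) * (\<Prod>i\<in>J. \<Prod>x\<in>{a i..<b (Suc i) + 1}. zl (-1) x * zd (-1) x)"
proof -
  have fJ: "finite J" using J finite_subset by blast
  define Y where "Y = (\<Union>i\<in>{1..l}. {a i..<b (\<sigma> i)}) \<union> (\<Union>i\<in>{1..l}. {a' i..<b' (\<sigma>' i)}) \<union> (\<Union>i\<in>J. {a i - 1..<b (Suc i) + 1})"
  have Y: "finite Y" unfolding Y_def using fJ by auto
  have Ya: "{a i..<(b \<circ> \<sigma>) i} \<subseteq> Y" "{a' i..<(b' \<circ> \<sigma>') i} \<subseteq> Y" if "i \<in> {1..l}" for i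
    unfolding Y_def comp_def using that by blast+
  have mid: "(\<Prod>i\<in>{1..l}. mid_weight (a i) (b (\<sigma> i)))
      = (\<Prod>x\<in>Y. zu 0 x ^ mid_cover l a (b \<circ> \<sigma>) (even x) x * zl (-1) x ^ mid_cover l a (b \<circ> \<sigma>) (odd x) x)"
    "(\<Prod>i\<in>{1..l}. mid_weight (a' i) (b' (\<sigma>' i)))
      = (\<Prod>x\<in>Y. zu 0 x ^ mid_cover l a' (b' \<circ> \<sigma>') (even x) x * zl (-1) x ^ mid_cover l a' (b' \<circ> \<sigma>') (odd x) x)"
    using prod_mid_weight[OF Y, of l a "b \<circ> \<sigma>", OF Ya(1)] prod_mid_weight[OF Y, of l a' "b' \<circ> \<sigma>'", OF Ya(2)]
    by (simp_all add: comp_def)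
  let ?c = "mid_cover l a (b \<circ> \<sigma>)" and ?c' = "mid_cover l a' (b' \<circ> \<sigma>')"
  let ?lo = "\<lambda>x. card {i \<in> J. a i - 1 \<le> x \<and> x < b (Suc i)}" and ?hi = "\<lambda>x. card {i \<in> J. a i \<le> x \<and> x < b (Suc i) + 1}"
  have cc: "?c e x = ?c' e x + (if e = even x then ?lo x else ?hi x)" for e x
  proof -
    let ?f = "\<lambda>y::int. of_bool (x < y \<and> even y = e) :: int"
    have 1: "int (?c' e x) = (\<Sum>j\<in>{1..l}. ?f (swap_upp J a b j)) - (\<Sum>i\<in>{1..l}. ?f (swap_low J a b i))"
      unfolding mid_cover_matching[OF m'] using a' b' by (intro arg_cong2[where f = "(-)"] sum.cong) auto
    have 2: "?f (a i - 1) - ?f (b (Suc i)) - ?f (b (Suc i) + 1) + ?f (a i) =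
        - (if e = even x then of_bool (a i - 1 \<le> x \<and> x < b (Suc i)) else of_bool (a i \<le> x \<and> x < b (Suc i) + 1))"
      if "i \<in> J" for i
    proof -
      \<comment> \<open>Exactly one of \<open>p - 1\<close> and \<open>p\<close> is in class
        \<open>e\<close>; which one it is matters only at \<open>x = p - 1\<close>.\<close>
      have *: "?f (p - 1) + ?f p = (if e = even x then of_bool (x < p - 1) else of_bool (x < p))" for p
      proof -
        consider "x < p - 1" | "x = p - 1" | "p \<le> x" by linarith
        then show ?thesis by cases auto
      qed
      have "p = q - r" if "p + r = q" for p q r :: int using that by simp
      have "?f (a i - 1) - ?f (b (Suc i)) - ?f (b (Suc i) + 1) + ?f (a i) =
          (?f (a i - 1) + ?f (a i)) - (?f (b (Suc i) + 1 - 1) + ?f (b (Suc i) + 1))" by simp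
      also have "\<dots> = - (if e = even x then of_bool (a i - 1 \<le> x \<and> x < b (Suc i)) else of_bool (a i \<le> x \<and> x < b (Suc i) + 1))"
        unfolding * using le[OF that] by (auto simp: of_bool_def)
      finally show ?thesis .
    qed
    have "int (?c' e x) = int (?c e x) - (\<Sum>i\<in>J. if e = even x then of_bool (a i - 1 \<le> x \<and> x < b (Suc i)) else of_bool (a i \<le> x \<and> x < b (Suc i) + 1))"
      unfolding 1 sum_swap[OF J, of ?f a b ?f] mid_cover_matching[OF m] using 2 by (simp add: sum_negf)
    also have "(\<Sum>i\<in>J. if e = even x then of_bool (a i - 1 \<le> x \<and> x < b (Suc i)) else of_bool (a i \<le> x \<and> x < b (Suc i) + 1))
        = int (if e = even x then ?lo x else ?hi x)"
      using fJ by (simp add: sum_of_bool_eq Int_def)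
    finally show ?thesis by linarith
  qed
  have "(\<Prod>i\<in>{1..l}. mid_weight (a i) (b (\<sigma> i)))
      = (\<Prod>x\<in>Y. zu 0 x ^ ?c (even x) x * zl (-1) x ^ ?c (odd x) x)"
    by (rule mid(1))
  also have "\<dots> = (\<Prod>x\<in>Y. (zu 0 x ^ ?c' (even x) x * zl (-1) x ^ ?c' (odd x) x) * (zu 0 x ^ ?lo x * zl (-1) x ^ ?hi x))"
    unfolding cc by (intro prod.cong refl) (auto simp: power_add ac_simps)
  also have "\<dots> = (\<Prod>i\<in>{1..l}. mid_weight (a' i) (b' (\<sigma>' i))) * (\<Prod>x\<in>Y. zu 0 x ^ ?lo x * zl (-1) x ^ ?hi x)"
    unfolding mid(2) by (rule prod.distrib)
  also have "(\<Prod>x\<in>Y. zu 0 x ^ ?lo x * zl (-1) x ^ ?hi x) = (\<Prod>i\<in>J. \<Prod>x\<in>{a i..<b (Suc i) + 1}. zl (-1) x * zd (-1) x)"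
  proof -
    have "(\<Prod>x\<in>Y. zu 0 x ^ ?lo x * zl (-1) x ^ ?hi x) =
        (\<Prod>x\<in>Y. \<Prod>i\<in>J. (if a i - 1 \<le> x \<and> x < b (Suc i) then zu 0 x else 1) * (if a i \<le> x \<and> x < b (Suc i) + 1 then zl (-1) x else 1))"
      unfolding prod.distrib[of _ _ J] using fJ by (subst (1 2) prod_power_card) simp_all
    also have "\<dots> = (\<Prod>i\<in>J. \<Prod>x\<in>Y. (if a i - 1 \<le> x \<and> x < b (Suc i) then zu 0 x else 1) * (if a i \<le> x \<and> x < b (Suc i) + 1 then zl (-1) x else 1))"
      by (rule prod.swap)
    also have "\<dots> = (\<Prod>i\<in>J. \<Prod>x\<in>{a i..<b (Suc i) + 1}. zl (-1) x * zd (-1) x)"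
    proof (rule prod.cong[OF refl])
      fix i assume i: "i \<in> J"
      then have sub: "{a i - 1..<b (Suc i)} \<subseteq> Y" "{a i..<b (Suc i) + 1} \<subseteq> Y" unfolding Y_def by force+
      have "(\<Prod>x\<in>Y. if a i - 1 \<le> x \<and> x < b (Suc i) then zu 0 x else 1) = (\<Prod>x\<in>{a i - 1..<b (Suc i)}. zu 0 x)"
        using Y sub(1) by (intro prod.mono_neutral_cong_right) auto
      also have "\<dots> = (\<Prod>x\<in>{a i..<b (Suc i) + 1}. zd (-1) x)"
        by (rule prod.reindex_bij_witness[of _ "\<lambda>x. x - 1" "\<lambda>x. x + 1"]) (auto simp: zd_def)
      finally show "(\<Prod>x\<in>Y. (if a i - 1 \<le> x \<and> x < b (Suc i) then zu 0 x else 1) * (if a i \<le> x \<and> x < b (Suc i) + 1 then zl (-1) x else 1))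
          = (\<Prod>x\<in>{a i..<b (Suc i) + 1}. zl (-1) x * zd (-1) x)"
        unfolding prod.distrib using Y sub(2)
        by (subst (2) prod.mono_neutral_cong_right[of Y "{a i..<b (Suc i) + 1}" _ "zl (-1)"]) (auto simp: mult.commute)
    qed
    finally show ?thesis .
  qed
  finally show ?thesis .
qed

end

section \<open>The weight in the ring\<close>

lemma ring_of_type_algebra_simps:
  "carrier (ring_of_type_algebra :: 'a::comm_ring_1 ring) = UNIV"
  "monoid.mult (ring_of_type_algebra :: 'a ring) = (*)" "monoid.one (ring_of_type_algebra :: 'a ring) = 1"
  "ring.add (ring_of_type_algebra :: 'a ring) = (+)" "ring.zero (ring_of_type_algebra :: 'a ring) = 0"
  by (simp_all add: ring_of_type_algebra_def)

lemma zpoly_ring_simps: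
  "monoid.mult (zpoly_ring n) = (*)" "monoid.one (zpoly_ring n) = 1"
  "ring.add (zpoly_ring n) = (+)" "ring.zero (zpoly_ring n) = 0"
  by (simp_all add: zpoly_ring_def ring_of_type_algebra_def)

lemma cring_zpoly_ring: "cring (zpoly_ring n)"
proof -
  interpret R: cring "ring_of_type_algebra :: zpoly ring" by (rule cring_from_type_algebra)
  have "subring (generate_ring ring_of_type_algebra {zvar i b | i b. i \<in> letters n}) (ring_of_type_algebra :: zpoly ring)"
    by (rule R.generate_ring_is_subring) (simp add: ring_of_type_algebra_simps)
  then have "subcring (generate_ring ring_of_type_algebra {zvar i b | i b. i \<in> letters n}) (ring_of_type_algebra :: zpoly ring)"
    by (rule R.subcringI')
  then show ?thesis unfolding zpoly_ring_def by (rule R.subcring_iff[THEN iffD1, rotated]) (simp add: ring_of_type_algebra_simps)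
qed

lemma letters_iff [simp]:
  "Unbarred i \<in> letters n \<longleftrightarrow> 1 \<le> i \<and> i \<le> n" "Barred i \<in> letters n \<longleftrightarrow> 1 \<le> i \<and> i \<le> n"
  by (auto simp: letters_def)

lemma zvar_carrier: "i \<in> letters n \<Longrightarrow> zvar i b \<in> carrier (zpoly_ring n)"
  unfolding zpoly_ring_def by (auto intro!: generate_ring.incl)


lemma uminus_carrier: "u \<in> carrier (zpoly_ring n) \<Longrightarrow> - u \<in> carrier (zpoly_ring n)"
proof -
  assume u: "u \<in> carrier (zpoly_ring n)"
  interpret R: cring "zpoly_ring n" by (rule cring_zpoly_ring)
  have "u + a_inv (zpoly_ring n) u = 0" using R.r_neg[OF u] by (simp add: zpoly_ring_simps)
  then have "a_inv (zpoly_ring n) u = - u" by (simp add: add_eq_0_iff)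
  then show ?thesis using R.a_inv_closed[OF u] by simp
qed

lemma zpoly_carrier:
  shows "1 \<in> carrier (zpoly_ring n)"
    and "u \<in> carrier (zpoly_ring n) \<Longrightarrow> v \<in> carrier (zpoly_ring n) \<Longrightarrow> u * v \<in> carrier (zpoly_ring n)"
    and "u \<in> carrier (zpoly_ring n) \<Longrightarrow> v \<in> carrier (zpoly_ring n) \<Longrightarrow> u - v \<in> carrier (zpoly_ring n)"
proof -
  interpret R: cring "zpoly_ring n" by (rule cring_zpoly_ring)
  show "1 \<in> carrier (zpoly_ring n)" using R.one_closed by (simp add: zpoly_ring_simps)
  show "u \<in> carrier (zpoly_ring n) \<Longrightarrow> v \<in> carrier (zpoly_ring n) \<Longrightarrow> u * v \<in> carrier (zpoly_ring n)"
    using R.m_closed[of u v] by (simp add: zpoly_ring_simps)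
  show "u \<in> carrier (zpoly_ring n) \<Longrightarrow> v \<in> carrier (zpoly_ring n) \<Longrightarrow> u - v \<in> carrier (zpoly_ring n)"
    using R.a_closed[OF _ uminus_carrier, of u v] by (simp add: zpoly_ring_simps)
qed

lemma zvar0_carrier:
  "i \<le> n \<Longrightarrow> zvar0 (Unbarred i) b \<in> carrier (zpoly_ring n)" "i \<le> n \<Longrightarrow> zvar0 (Barred i) b \<in> carrier (zpoly_ring n)"
  unfolding zvar0_def by (auto simp: zpoly_carrier intro!: zvar_carrier)

lemma ideal_zideal: "ideal (zideal n) (zpoly_ring n)"
proof -
  interpret R: cring "zpoly_ring n" by (rule cring_zpoly_ring)
  have "zrelations n \<subseteq> carrier (zpoly_ring n)"
    unfolding zrelations_def by (auto intro!: zpoly_carrier(2,3) zvar0_carrier)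
  then show ?thesis unfolding zideal_def by (rule R.genideal_ideal)
qed

lemma zrelations_zideal: "zrelations n \<subseteq> zideal n"
proof -
  interpret R: cring "zpoly_ring n" by (rule cring_zpoly_ring)
  have "zrelations n \<subseteq> carrier (zpoly_ring n)"
    unfolding zrelations_def by (auto intro!: zpoly_carrier(2,3) zvar0_carrier)
  then show ?thesis unfolding zideal_def by (rule R.genideal_self)
qed

definition zclass :: "nat \<Rightarrow> zpoly \<Rightarrow> zpoly set" where
  "zclass n u = a_r_coset (zpoly_ring n) (zideal n) u"

lemma cring_Zring: "cring (Zring n)"
  unfolding Zring_def by (rule ideal.quotient_is_cring[OF ideal_zideal cring_zpoly_ring])

lemma zclass_hom:
  "u \<in> carrier (zpoly_ring n) \<Longrightarrow> zclass n u \<in> carrier (Zring n)"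
  "u \<in> carrier (zpoly_ring n) \<Longrightarrow> v \<in> carrier (zpoly_ring n) \<Longrightarrow> zclass n (u * v) = monoid.mult (Zring n) (zclass n u) (zclass n v)"
  "zclass n 1 = monoid.one (Zring n)"
proof -
  have h: "zclass n \<in> ring_hom (zpoly_ring n) (Zring n)"
    unfolding Zring_def zclass_def[abs_def] by (rule ideal.rcos_ring_hom[OF ideal_zideal])
  show "u \<in> carrier (zpoly_ring n) \<Longrightarrow> zclass n u \<in> carrier (Zring n)" using ring_hom_closed[OF h] .
  show "u \<in> carrier (zpoly_ring n) \<Longrightarrow> v \<in> carrier (zpoly_ring n) \<Longrightarrow> zclass n (u * v) = monoid.mult (Zring n) (zclass n u) (zclass n v)"
    using ring_hom_mult[OF h, of u v] by (simp add: zpoly_ring_simps)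
  show "zclass n 1 = monoid.one (Zring n)" using ring_hom_one[OF h] by (simp add: zpoly_ring_simps)
qed

lemma zclass_eqI:
  assumes "u - v \<in> zideal n" "v \<in> carrier (zpoly_ring n)"
  shows "zclass n u = zclass n v"
proof -
  interpret I: ideal "zideal n" "zpoly_ring n" by (rule ideal_zideal)
  have "ring.add (zpoly_ring n) (u - v) v \<in> a_r_coset (zpoly_ring n) (zideal n) v"
    using I.a_rcosI[OF assms(1) _ assms(2)] I.a_subset by blast
  then have "u \<in> a_r_coset (zpoly_ring n) (zideal n) v" by (simp add: zpoly_ring_simps)
  then show ?thesis unfolding zclass_def using I.a_repr_independence'[OF _ assms(2)] by metis
qed

lemma finprod_zclass:
  assumes "finite S" "\<And>k. k \<in> S \<Longrightarrow> h k \<in> carrier (zpoly_ring n)"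
  shows "finprod (Zring n) (\<lambda>k. zclass n (h k)) S = zclass n (\<Prod>k\<in>S. h k) \<and> (\<Prod>k\<in>S. h k) \<in> carrier (zpoly_ring n)"
  using assms
proof (induction S rule: finite_induct)
  case empty
  interpret Z: cring "Zring n" by (rule cring_Zring)
  show ?case by (simp add: zclass_hom zpoly_carrier)
next
  case (insert k S)
  interpret Z: cring "Zring n" by (rule cring_Zring)
  have "finprod (Zring n) (\<lambda>k. zclass n (h k)) (insert k S)
      = monoid.mult (Zring n) (zclass n (h k)) (finprod (Zring n) (\<lambda>k. zclass n (h k)) S)"
    using insert by (intro Z.finprod_insert) (auto intro!: zclass_hom(1))
  then show ?case using insert by (simp add: zclass_hom(2) zpoly_carrier(2))
qed

section \<open>Step weights and the ring relation\<close>

definition zlow :: "nat \<Rightarrow> complex \<Rightarrow> int \<Rightarrow> int \<Rightarrow> zpoly" where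
  "zlow n a s x = zvar (Unbarred (nat (int n + 1 + s))) (a - 2 * of_int x)"

definition zupp :: "nat \<Rightarrow> complex \<Rightarrow> int \<Rightarrow> int \<Rightarrow> zpoly" where
  "zupp n a r x = zvar (Barred (nat (int n - r))) (a - 2 * of_int x)"

text \<open>Carrier membership is built in so that this is a congruence without side
  conditions.\<close>

definition zeq :: "nat \<Rightarrow> zpoly \<Rightarrow> zpoly \<Rightarrow> bool" where
  "zeq n u v \<longleftrightarrow> u \<in> carrier (zpoly_ring n) \<and> v \<in> carrier (zpoly_ring n) \<and> zclass n u = zclass n v"

text \<open>This is the defining relation with \<open>i = n + 1 + s\<close>, which is at least 2, so
  that the factors of index \<open>i - 1\<close> are genuine variables.\<close>

lemma zeq_unit:
  assumes s: "- int n < s" "s < 0"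
  shows "zeq n (zlow n a (s - 1) x * zupp n a (- s) (x - s - 1)) (zlow n a s x * zupp n a (- s - 1) (x - s - 1))"
proof -
  define i where "i = nat (int n + 1 + s)"
  have i: "i \<in> {1..n}" "i - 1 \<in> {1..n}" and ii: "int i = int n + 1 + s" using s by (auto simp: i_def)
  have e: "nat (int n + 1 + (s - 1)) = i - 1" "nat (int n - (- s)) = i - 1" "nat (int n - (- s - 1)) = i"
    using s by (auto simp: i_def)
  have "complex_of_int (int i) = of_nat n + 1 + of_int s" unfolding ii by simp
  \<comment> \<open>The shift by \<open>- 2n + 2i\<close> in the relation is the passage from
    abscissa \<open>x\<close> to \<open>x - s - 1\<close>.\<close>
  then have b: "a - 2 * of_int (x - s - 1) = (a - 2 * of_int x) - 2 * of_nat n + 2 * of_nat i" by simp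
  let ?b = "a - 2 * of_int x :: complex"
  have v0: "zvar0 (Unbarred j) c = zvar (Unbarred j) c" "zvar0 (Barred j) c = zvar (Barred j) c" if "j \<in> {1..n}" for j c
    using that by (auto simp: zvar0_def)
  have "zlow n a s x * zupp n a (- s - 1) (x - s - 1) - zlow n a (s - 1) x * zupp n a (- s) (x - s - 1) =
      zvar0 (Unbarred i) ?b * zvar0 (Barred i) (?b - 2 * of_nat n + 2 * of_nat i)
      - zvar0 (Unbarred (i - 1)) ?b * zvar0 (Barred (i - 1)) (?b - 2 * of_nat n + 2 * of_nat i)"
    unfolding zlow_def zupp_def e i_def[symmetric] b v0[OF i(1)] v0[OF i(2)] ..
  then have rel: "zlow n a s x * zupp n a (- s - 1) (x - s - 1) - zlow n a (s - 1) x * zupp n a (- s) (x - s - 1) \<in> zideal n"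
    using zrelations_zideal[of n] i(1) unfolding zrelations_def by blast
  have C: "zlow n a s x * zupp n a (- s - 1) (x - s - 1) \<in> carrier (zpoly_ring n)"
    "zlow n a (s - 1) x * zupp n a (- s) (x - s - 1) \<in> carrier (zpoly_ring n)"
    unfolding zlow_def zupp_def e i_def[symmetric] using i by (auto intro!: zpoly_carrier(2) zvar_carrier)
  show ?thesis unfolding zeq_def using C zclass_eqI[OF rel C(2)] by simp
qed

lemma weight_system_zpoly: "weight_system (carrier (zpoly_ring n)) (zeq n) (zlow n a) (zupp n a) n"
proof
  show "1 \<in> carrier (zpoly_ring n)" by (rule zpoly_carrier)
  show "u \<in> carrier (zpoly_ring n) \<Longrightarrow> v \<in> carrier (zpoly_ring n) \<Longrightarrow> u * v \<in> carrier (zpoly_ring n)" for u v by (rule zpoly_carrier)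
  show "u \<in> carrier (zpoly_ring n) \<Longrightarrow> zeq n u u" for u by (simp add: zeq_def)
  show "zeq n u v \<Longrightarrow> zeq n v w \<Longrightarrow> zeq n u w" for u v w by (simp add: zeq_def)
  show "zeq n u v \<Longrightarrow> zeq n u' v' \<Longrightarrow> zeq n (u * u') (v * v')" for u v u' v' by (simp add: zeq_def zclass_hom(2) zpoly_carrier(2))
  show "- int n \<le> s \<Longrightarrow> s < 0 \<Longrightarrow> zlow n a s x \<in> carrier (zpoly_ring n)" for s x
    unfolding zlow_def by (rule zvar_carrier) auto
  show "0 \<le> r \<Longrightarrow> r < int n \<Longrightarrow> zupp n a r x \<in> carrier (zpoly_ring n)" for r x
    unfolding zupp_def by (rule zvar_carrier) auto
  show "- int n < s \<Longrightarrow> s < 0 \<Longrightarrow>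
      zeq n (zlow n a (s - 1) x * zupp n a (- s) (x - s - 1)) (zlow n a s x * zupp n a (- s - 1) (x - s - 1))" for s x
    by (rule zeq_unit)
qed

interpretation W: weight_system "carrier (zpoly_ring n)" "zeq n" "zlow n a" "zupp n a" n for n a
  by (rule weight_system_zpoly)

lemma fst_graph_point: "fst (graph_point f s) = f s"
  by (simp add: graph_point_def)

lemma path_weight_path_of:
  assumes n: "1 \<le> n" and fg: "f 0 \<le> g 0" and f: "unit_steps (- int n) 0 f" and g: "unit_steps 0 (int n) g"
  shows "path_weight n a (path_of n f g) = zclass n (W.low_weight n a f * W.mid_weight n a (f 0) (g 0) * W.upp_weight n a g)"
proof -
  let ?q = "path_of n f g"
  let ?L = "map (\<lambda>s. (graph_point f s, graph_point f (s + 1))) [- int n..-1]"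
  let ?M = "map (\<lambda>x. ((x, - x), (x + 1, - x - 1))) [f 0..g 0 - 1]"
  let ?U = "map (\<lambda>r. (graph_point g r, graph_point g (r + 1))) [0..int n - 1]"
  define e where "e = nat (g 0 - f 0)"
  have st: "steps ?q = ?L @ ?M @ ?U" by (rule steps_path_of[of n f g, OF n fg])
  have len: "length ?L = n" "length ?M = e" "length ?U = n" using n by (simp_all add: e_def)
  let ?c = "\<lambda>k. NE_step (steps ?q ! k) \<or> E_step (steps ?q ! k)"
  let ?v = "\<lambda>k. zvar (L1 n ?q k) (a - 2 * of_int (fst (fst (steps ?q ! k))))"
  let ?t = "\<lambda>k. if ?c k then ?v k else 1"
  have low: "?t k = W.low_step n a f (int k - int n)" if k: "k < n" for k
  proof -
    let ?s = "int k - int n"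
    have s: "- int n \<le> ?s" "?s < 0" using k by auto
    have nth: "steps ?q ! k = (graph_point f ?s, graph_point f (?s + 1))"
      unfolding st using k len(1) by (simp add: nth_append nth_upto)
    show ?thesis
      unfolding W.low_step_def L1_def nth using path_step_kinds(2,3)[OF f s] s
      by (simp add: Let_def zlow_def fst_graph_point)
  qed
  have mid: "?t (n + k) = (if even k then zupp n a 0 (f 0 + int k) else zlow n a (-1) (f 0 + int k))" if k: "k < e" for k
  proof -
    let ?x = "f 0 + int k"
    have nth: "steps ?q ! (n + k) = ((?x, - ?x), (?x + 1, - ?x - 1))"
    proof -
      have "steps ?q ! (n + k) = ?M ! k" unfolding st using k len by (simp only: nth_append) simp
      also have "\<dots> = ((?x, - ?x), (?x + 1, - ?x - 1))" using k by (simp add: nth_upto e_def)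
      finally show ?thesis .
    qed
    have "filter E_step ?L = []" using path_step_kinds(3)[OF f] by (auto simp: filter_empty_conv)
    moreover have "filter E_step (take (Suc k) ?M) = take (Suc k) ?M"
      by (auto simp: filter_id_conv E_step_antidiagonal dest!: in_set_takeD)
    moreover have "take (Suc (n + k)) (steps ?q) = ?L @ take (Suc k) ?M"
      unfolding st using k len by simp
    ultimately have "length (filter E_step (take (Suc (n + k)) (steps ?q))) = Suc k"
      using k len(2) by simp
    \<comment> \<open>Counting from 0, the E-step with number \<open>k\<close> is the
      \<open>Suc k\<close>-th one, so odd \<open>k\<close> gives the letter
      \<open>n\<close>.\<close>
    then have odd: "even (length (filter E_step (take (Suc (n + k)) (steps ?q)))) \<longleftrightarrow> odd k" by simp
    define y where "y = ?x"
    show ?thesis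
      unfolding L1_def nth odd y_def[symmetric] by (simp add: Let_def zlow_def zupp_def E_step_antidiagonal)
  qed
  have upp: "?t (n + e + k) = W.upp_step n a g (int k)" if k: "k < n" for k
  proof -
    have r: "0 \<le> int k" "int k < int n" using k by auto
    have nth: "steps ?q ! (n + e + k) = (graph_point g (int k), graph_point g (int k + 1))"
    proof -
      have "steps ?q ! (n + e + k) = ?U ! k" unfolding st using k len by (simp only: nth_append) simp
      also have "\<dots> = (graph_point g (int k), graph_point g (int k + 1))" using k by (simp add: nth_upto)
      finally show ?thesis .
    qed
    show ?thesis
      unfolding W.upp_step_def L1_def nth using path_step_kinds(2,3)[OF g r]
      by (auto simp: Let_def zupp_def fst_graph_point)
  qed
  have total: "length (steps ?q) = n + e + n" unfolding st using len by simp
  have split: "(\<Prod>k<n + e + n. h k) = (\<Prod>k<n. h k) * (\<Prod>k<e. h (n + k)) * (\<Prod>k<n. h (n + e + k))" for h :: "nat \<Rightarrow> zpoly"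
  proof -
    have "(\<Prod>k<m + p. h k) = (\<Prod>k<m. h k) * (\<Prod>k<p. h (m + k))" for m p
      by (induction p) (simp_all add: ac_simps)
    then show ?thesis by simp
  qed
  let ?S = "{k. k < length (steps ?q) \<and> ?c k}"
  have tC: "?t k \<in> carrier (zpoly_ring n)" if k: "k < n + e + n" for k
  proof -
    consider "k < n" | j where "k = n + j" "j < e" | j where "k = n + e + j" "j < n"
      using k by (metis add.assoc add_less_cancel_left le_Suc_ex not_le)
    then show ?thesis
    proof cases
      case 1
      show ?thesis unfolding low[OF 1] by (rule W.low_step_C) (use 1 in auto)
    next
      case (2 j)
      show ?thesis unfolding 2(1) mid[OF 2(2)] using n by (auto intro!: W.zl W.zu)
    next
      case (3 j)
      show ?thesis unfolding 3(1) upp[OF 3(2)] by (rule W.upp_step_C) (use 3 in auto)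
    qed
  qed
  have "path_weight n a ?q = finprod (Zring n) (\<lambda>k. zclass n (?v k)) ?S"
    unfolding path_weight_def zgen_def zclass_def ..
  also have "\<dots> = zclass n (\<Prod>k\<in>?S. ?v k)"
  proof (rule finprod_zclass[THEN conjunct1])
    fix k assume "k \<in> ?S"
    then show "?v k \<in> carrier (zpoly_ring n)" using tC[of k] total by auto
  qed simp
  also have "(\<Prod>k\<in>?S. ?v k) = (\<Prod>k<n + e + n. ?t k)"
    unfolding total by (subst prod.inter_filter[symmetric]) (auto intro!: prod.cong)
  also have "\<dots> = (\<Prod>k<n. ?t k) * (\<Prod>k<e. ?t (n + k)) * (\<Prod>k<n. ?t (n + e + k))" by (rule split)
  also have "(\<Prod>k<n. ?t k) = W.low_weight n a f"
    unfolding W.low_weight_def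
    by (rule prod.reindex_bij_witness[of _ "\<lambda>s. nat (s + int n)" "\<lambda>k. int k - int n"]) (auto simp: low)
  also have "(\<Prod>k<e. ?t (n + k)) = W.mid_weight n a (f 0) (g 0)"
    unfolding W.mid_weight_def
    by (rule prod.reindex_bij_witness[of _ "\<lambda>x. nat (x - f 0)" "\<lambda>k. f 0 + int k"]) (auto simp: mid e_def)
  also have "(\<Prod>k<n. ?t (n + e + k)) = W.upp_weight n a g"
    unfolding W.upp_weight_def
    by (rule prod.reindex_bij_witness[of _ "\<lambda>r. nat r" "\<lambda>k. int k"]) (auto simp: upp)
  finally show ?thesis .
qed

section \<open>The involution\<close>

definition config_weight ::
  "nat \<Rightarrow> complex \<Rightarrow> nat \<Rightarrow> (nat \<Rightarrow> nat) \<Rightarrow> (nat \<Rightarrow> int \<Rightarrow> int) \<Rightarrow> (nat \<Rightarrow> int \<Rightarrow> int) \<Rightarrow> zpoly" where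
  "config_weight n a l \<sigma> A G = (\<Prod>i\<in>{1..l}. W.low_weight n a (A i)) * (\<Prod>j\<in>{1..l}. W.upp_weight n a (G j)) *
     (\<Prod>i\<in>{1..l}. W.mid_weight n a (A i 0) (G (\<sigma> i) 0))"

lemma tuple_weight_tuple_of:
  assumes n: "1 \<le> n" and c: "config n lam mu A G" and m: "matching (lam 1) (\<lambda>i. A i 0) (\<lambda>j. G j 0) \<sigma>"
  shows "tuple_weight n a (lam 1) (tuple_of n (lam 1) \<sigma> A G) = zclass n (config_weight n a (lam 1) \<sigma> A G)"
proof -
  interpret Z: cring "Zring n" by (rule cring_Zring)
  let ?w = "\<lambda>i. W.low_weight n a (A i) * W.mid_weight n a (A i 0) (G (\<sigma> i) 0) * W.upp_weight n a (G (\<sigma> i))"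
  have wC: "?w i \<in> carrier (zpoly_ring n)" for i
    by (intro zpoly_carrier(2) W.low_weight_C W.mid_weight_C W.upp_weight_C n)
  have "tuple_weight n a (lam 1) (tuple_of n (lam 1) \<sigma> A G) = finprod (Zring n) (\<lambda>i. zclass n (?w i)) {1..lam 1}"
    unfolding tuple_weight_def tuple_of_def
  proof (rule Z.finprod_cong'[OF refl])
    show "(\<lambda>i. zclass n (?w i)) \<in> {1..lam 1} \<rightarrow> carrier (Zring n)" using zclass_hom(1)[OF wC] by blast
    fix i assume i: "i \<in> {1..lam 1}"
    then have "\<sigma> i \<in> {1..lam 1}" using permutes_in_image[OF matchingD(1)[OF m]] by blast
    then show "path_weight n a (snd (\<sigma>, \<lambda>i\<in>{1..lam 1}. path_of n (A i) (G (\<sigma> i))) i) = zclass n (?w i)"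
      using i path_weight_path_of[of n "A i" "G (\<sigma> i)" a] n matchingD(2)[OF m i] configD(1)[OF c i] configD(3)[OF c] by simp
  qed
  also have "\<dots> = zclass n (\<Prod>i\<in>{1..lam 1}. ?w i)"
    using finprod_zclass[of "{1..lam 1}" ?w n] wC by blast
  also have "(\<Prod>i\<in>{1..lam 1}. ?w i) = config_weight n a (lam 1) \<sigma> A G"
    using prod.permute[OF matchingD(1)[OF m], of "\<lambda>j. W.upp_weight n a (G j)"]
    unfolding config_weight_def prod.distrib by (simp add: comp_def ac_simps)
  finally show ?thesis .
qed

text \<open>Each lower path is grouped with the upper path it can be exchanged with; the last lower
  and the first upper path remain alone.\<close>

lemma prod_pairing:
  fixes f g :: "nat \<Rightarrow> 'm::comm_monoid_mult"
  assumes "1 \<le> l"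
  shows "(\<Prod>i\<in>{1..l}. f i) * (\<Prod>j\<in>{1..l}. g j) = f l * g 1 * (\<Prod>i\<in>{1..<l}. f i * g (Suc i))"
proof -
  have 1: "{1..l} = insert l {1..<l}" using assms by auto
  have 2: "{1..l} = insert 1 (Suc ` {1..<l})"
  proof (intro equalityI subsetI)
    fix x assume "x \<in> {1..l}"
    then show "x \<in> insert 1 (Suc ` {1..<l})" by (cases "x = 1") (auto intro!: image_eqI[of _ _ "x - 1"])
  qed (use assms in auto)
  have "(\<Prod>i\<in>{1..l}. f i) = f l * (\<Prod>i\<in>{1..<l}. f i)" unfolding 1 by simp
  moreover have "(\<Prod>j\<in>{1..l}. g j) = g 1 * (\<Prod>i\<in>{1..<l}. g (Suc i))"
  proof -
    have "prod g {1..l} = prod g (insert 1 (Suc ` {1..<l}))" by (rule arg_cong[OF 2])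
    also have "\<dots> = g 1 * prod g (Suc ` {1..<l})" by (rule prod.insert) auto
    also have "prod g (Suc ` {1..<l}) = (\<Prod>i\<in>{1..<l}. g (Suc i))" by (subst prod.reindex) auto
    finally show ?thesis .
  qed
  ultimately show ?thesis by (simp add: prod.distrib ac_simps)
qed

section \<open>Invariance of the weight\<close>

context path_config
begin

lemma flagged_less:
  assumes K: "K \<subseteq> cells n l P Q" and i: "i \<in> {1..<l}" and s: "- int n \<le> s" "s \<le> 0" and f: "flagged K P Q i s"
  shows "A i s < dual_upp G (Suc i) s"
proof -
  obtain x where x: "(x, s) \<in> K" "P i s x \<noteq> Q i s x" using f unfolding flagged_def by blast
  have "(x, s) \<in> cells n l Q P" if "Q i s x" using that x(2) cellsI[of Q i s x P l n] i s by auto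
  then have "\<not> Q i s x" using x(1) K cells_disjoint[OF P Q] by blast
  then show ?thesis using x(2) i by (auto simp: low_thr_def upp_thr_def)
qed

text \<open>The exchanged pairs of half paths gain one factor for each unit of height 0 between
  them, and the E-steps lose exactly these factors.\<close>

lemma config_weight_swap:
  assumes K: "is_region K" and sub: "K \<subseteq> cells n l P Q"
    and m: "matching l (\<lambda>i. A i 0) (\<lambda>j. G j 0) \<sigma>"
    and m': "matching l (\<lambda>i. swap_A l K A G i 0) (\<lambda>j. swap_G l K A G j 0) \<sigma>'"
  shows "zeq n (config_weight n a l \<sigma>' (swap_A l K A G) (swap_G l K A G)) (config_weight n a l \<sigma> A G)"
proof (cases "l = 0")
  case True
  then show ?thesis unfolding config_weight_def by (simp add: W.E_refl zpoly_carrier)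
next
  case False
  then have l1: "1 \<le> l" by simp
  let ?A' = "swap_A l K A G" and ?G' = "swap_G l K A G"
  let ?lw = "W.low_weight n a" and ?uw = "W.upp_weight n a"
  let ?k = "\<lambda>i. \<Prod>x\<in>{A i 0..<G (Suc i) 0 + 1}. zlow n a (-1) x * W.zd n a (-1) x"
  let ?M = "\<Prod>i\<in>{1..l}. W.mid_weight n a (A i 0) (G (\<sigma> i) 0)" and ?M' = "\<Prod>i\<in>{1..l}. W.mid_weight n a (?A' i 0) (?G' (\<sigma>' i) 0)"
  have Jle: "A i 0 \<le> G (Suc i) 0" if "i \<in> J K" for i
    using that flagged_type(1)[of i K, OF _ _ sub] unfolding J_def[OF K] by blast
  have mid: "?M = ?M' * (\<Prod>i\<in>J K. ?k i)"
    by (rule W.mid_weight_swap[OF m m' J_subset[OF K] Jle A'_0[OF K] G'_0[OF K]])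
  have pair: "zeq n (?lw (?A' i) * ?uw (?G' (Suc i))) (?lw (A i) * ?uw (G (Suc i)) * (if i \<in> J K then ?k i else 1))"
    if i: "i \<in> {1..<l}" for i
  proof -
    have i': "i \<in> {1..l}" "Suc i \<in> {1..l}" using i by auto
    have dual: "(\<lambda>s. g j (- s) + s + 1) = dual_upp g j" for g :: "nat \<Rightarrow> int \<Rightarrow> int" and j by (simp add: dual_upp_def fun_eq_iff)
    note c' = configD[OF config_swapped[OF K], folded l]
    have st: "unit_steps (- int n) 0 (dual_upp g j)" if "unit_steps 0 (int n) (g j)" for g j
      unfolding unit_steps_def using dual_upp_step[of n g j, OF that] by blast
    have iJ: "i \<in> J K \<longleftrightarrow> flagged K P Q i 0" unfolding J_def[OF K] using i by blast
    have "zeq n (?lw (?A' i) * (\<Prod>s\<in>{- int n..<0}. W.dual_step n a (dual_upp ?G' (Suc i)) s))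
      (?lw (A i) * (\<Prod>s\<in>{- int n..<0}. W.dual_step n a (dual_upp G (Suc i)) s) *
        (if flagged K P Q i 0 then \<Prod>x\<in>{A i 0..<dual_upp G (Suc i) 0}. zlow n a (-1) x * W.zd n a (-1) x else 1))"
    proof (rule W.pair_weight_swap[where sw = "\<lambda>s. flagged K P Q i s"])
      show "unit_steps (- int n) 0 (A i)" "unit_steps (- int n) 0 (?A' i)" using c(1) c'(1) i' by blast+
      show "unit_steps (- int n) 0 (dual_upp G (Suc i))" "unit_steps (- int n) 0 (dual_upp ?G' (Suc i))"
        using st c(3) c'(3) i' by blast+
      show "\<not> flagged K P Q i (- int n)" using not_flagged_boundary(3)[OF K] .
      show "?A' i s = (if flagged K P Q i s then dual_upp G (Suc i) s else A i s)" for s by (simp add: swap_A_def)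
      show "dual_upp ?G' (Suc i) s = (if flagged K P Q i s then A i s else dual_upp G (Suc i) s)" for s
        by (simp add: swap_G_def dual_upp_def)
      show "- int n \<le> s \<Longrightarrow> s \<le> 0 \<Longrightarrow> flagged K P Q i s \<Longrightarrow> A i s < dual_upp G (Suc i) s" for s
        using flagged_less[OF sub i] by blast
    qed
    moreover have "?uw (?G' (Suc i)) = (\<Prod>s\<in>{- int n..<0}. W.dual_step n a (dual_upp ?G' (Suc i)) s)"
      "?uw (G (Suc i)) = (\<Prod>s\<in>{- int n..<0}. W.dual_step n a (dual_upp G (Suc i)) s)"
      using W.upp_weight_dual[OF c'(3)[OF i'(2)], of a] W.upp_weight_dual[OF c(3)[OF i'(2)], of a] unfolding dual by blast+
    moreover have "dual_upp G (Suc i) 0 = G (Suc i) 0 + 1" by (simp add: dual_upp_def)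
    ultimately show ?thesis unfolding iJ by (cases "flagged K P Q i 0") simp_all
  qed
  \<comment> \<open>The partners of these two paths are infinite, and regions are not flagged at
    their indices.\<close>
  have "?A' l = A l" using not_flagged_boundary(2)[OF K] by (simp add: swap_A_def fun_eq_iff)
  moreover have "?G' 1 = G 1" using not_flagged_boundary(1)[OF K] by (simp add: swap_G_def fun_eq_iff)
  ultimately have X': "(\<Prod>i\<in>{1..l}. ?lw (?A' i)) * (\<Prod>j\<in>{1..l}. ?uw (?G' j))
      = ?lw (A l) * ?uw (G 1) * (\<Prod>i\<in>{1..<l}. ?lw (?A' i) * ?uw (?G' (Suc i)))"
    unfolding prod_pairing[OF l1] by simp
  have X: "(\<Prod>i\<in>{1..l}. ?lw (A i)) * (\<Prod>j\<in>{1..l}. ?uw (G j))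
      = ?lw (A l) * ?uw (G 1) * (\<Prod>i\<in>{1..<l}. ?lw (A i) * ?uw (G (Suc i)))"
    unfolding prod_pairing[OF l1] ..
  have kJ: "(\<Prod>i\<in>{1..<l}. if i \<in> J K then ?k i else 1) = (\<Prod>i\<in>J K. ?k i)"
    using J_subset[OF K] by (intro prod.mono_neutral_cong_right) auto
  have "zeq n (\<Prod>i\<in>{1..<l}. ?lw (?A' i) * ?uw (?G' (Suc i)))
      ((\<Prod>i\<in>{1..<l}. ?lw (A i) * ?uw (G (Suc i))) * (\<Prod>i\<in>J K. ?k i))"
    unfolding kJ[symmetric] prod.distrib[symmetric] by (rule W.prod_E) (use pair in \<open>simp add: prod.distrib\<close>)
  then have "zeq n (?lw (A l) * ?uw (G 1) * (\<Prod>i\<in>{1..<l}. ?lw (?A' i) * ?uw (?G' (Suc i))) * ?M')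
      (?lw (A l) * ?uw (G 1) * ((\<Prod>i\<in>{1..<l}. ?lw (A i) * ?uw (G (Suc i))) * (\<Prod>i\<in>J K. ?k i)) * ?M')"
    by (intro W.E_mult W.E_refl zpoly_carrier(2) W.low_weight_C W.upp_weight_C W.prod_in_C W.mid_weight_C n)
  then show ?thesis
    unfolding config_weight_def X X' mid by (simp add: ac_simps)
qed

end

section \<open>The involution on a single tuple\<close>

lemma iota2_properties:
  assumes n: "1 \<le> n" and skew: "skew_diagram lam mu"
    and pos: "\<forall>i\<in>{1..<lam 1}. int (conj_part lam (i + 1)) - int (conj_part mu i) \<le> int n"
    and p: "p \<in> P_odd n lam mu"
  shows "(\<exists>!V. is_top_odd_region n (lam 1) p V) \<and>
    (\<exists>!p'. is_eps_tuple n lam mu (top_odd_region n (lam 1) p) p p') \<and>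
    iota2 n lam mu p \<in> P_odd n lam mu \<and>
    iota2 n lam mu (iota2 n lam mu p) = p \<and>
    tuple_weight n a (lam 1) (iota2 n lam mu p) = tuple_weight n a (lam 1) p \<and>
    tuple_sign (iota2 n lam mu p) = - tuple_sign p"
proof -
  let ?l = "lam 1"
  have lam: "is_partition lam" and mu: "is_partition mu" using skew unfolding skew_diagram_def by auto
  have p1: "p \<in> P1 n lam mu" and ne: "odd_regions n ?l (pi_map ?l p) \<noteq> {}" using p unfolding P_odd_def by auto
  obtain \<sigma> A G where c: "config n lam mu A G" and m: "matching ?l (\<lambda>i. A i 0) (\<lambda>j. G j 0) \<sigma>"
    and pt: "p = tuple_of n ?l \<sigma> A G" using P1_obtain[OF n lam mu p1] .
  let ?H = "half_paths_of n ?l A G"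
  have pH: "pi_map ?l p = ?H" unfolding pt by (rule pi_map_tuple_of[of ?l A G, OF m])
  interpret C: path_config n ?l lam mu A G by (rule path_config.intro[OF n refl c pos])
  obtain K where K: "C.is_region K" "odd (even_pairs ?l A G K)" "is_top_odd_region n ?l p (region_points n K)"
    using C.top_odd_region_exists(1)[OF pH] ne unfolding pH by blast
  let ?V = "region_points n K"
  have ex1: "\<exists>!V. is_top_odd_region n ?l p V" using C.top_odd_region_exists(2)[OF pH] ne unfolding pH by blast
  have top: "top_odd_region n ?l p = ?V" unfolding top_odd_region_def using the1_equality[OF ex1 K(3)] .
  let ?A = "swap_A ?l K A G" and ?G = "swap_G ?l K A G"
  let ?H' = "half_paths_of n ?l ?A ?G"
  have c': "config n lam mu ?A ?G" by (rule C.config_swapped[OF K(1)])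
  interpret S: path_config n ?l lam mu ?A ?G by (rule C.swapped_path_config[OF K(1)])
  have dec: "decreasing_on ?l (\<lambda>i. A i 0)" "decreasing_on ?l (\<lambda>j. G j 0)" "decreasing_on ?l (\<lambda>i. ?A i 0)" "decreasing_on ?l (\<lambda>j. ?G j 0)"
    using configD(5)[OF c, of 0] configD(6)[OF c, of 0] configD(5)[OF c', of 0] configD(6)[OF c', of 0] by auto
  obtain \<sigma>' where m': "matching ?l (\<lambda>i. ?A i 0) (\<lambda>j. ?G j 0) \<sigma>'"
    using matching_exists[OF configD(7)[OF c'] dec(3,4)] by blast
  define p' where "p' = tuple_of n ?l \<sigma>' ?A ?G"
  have p'1: "p' \<in> P1 n lam mu" unfolding p'_def by (rule tuple_of_in_P1[OF n c' m'])
  have p'H: "pi_map ?l p' = ?H'" unfolding p'_def by (rule pi_map_tuple_of[of ?l ?A ?G, OF m'])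
  have eps: "eps ?l ?V ?H = ?H'" by (rule C.eps_region[OF K(1)])
  have K': "S.is_region K" using K(1) C.is_region_swapped[OF K(1)] by blast
  have twice: "half_paths_of n ?l (swap_A ?l K ?A ?G) (swap_G ?l K ?A ?G) = ?H" by (rule C.swap_twice[OF K(1)])
  have eps': "eps ?l ?V ?H' = ?H" using S.eps_region[OF K'] twice by simp
  have is_eps: "is_eps_tuple n lam mu ?V p q \<longleftrightarrow> q = p'" for q
    unfolding is_eps_tuple_def pH eps using tuple_unique[OF n lam mu c' m'] p'1 p'H unfolding p'_def by blast
  have is_eps': "is_eps_tuple n lam mu ?V p' q \<longleftrightarrow> q = p" for q
    unfolding is_eps_tuple_def p'H eps' using tuple_unique[OF n lam mu c m] p1 pH unfolding pt by blast
  have odd_eq: "odd_regions n ?l ?H' = odd_regions n ?l ?H" by (rule C.odd_regions_swapped[OF K(1)])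
  \<comment> \<open>The odd regions are the same point sets before and after, so the second
    application selects the same region.\<close>
  have "is_top_odd_region n ?l p' = is_top_odd_region n ?l p"
    unfolding is_top_odd_region_def[abs_def] p'H pH odd_eq ..
  then have top': "top_odd_region n ?l p' = ?V" using top unfolding top_odd_region_def by simp
  have iota: "iota2 n lam mu p = p'" unfolding iota2_def top eps_tuple_def is_eps by simp
  have iota': "iota2 n lam mu p' = p" unfolding iota2_def top' eps_tuple_def is_eps' by simp
  have p'odd: "p' \<in> P_odd n lam mu" unfolding P_odd_def using p'1 ne p'H odd_eq pH by auto
  have weight: "tuple_weight n a ?l p' = tuple_weight n a ?l p"
  proof (cases "K \<subseteq> cells n ?l (low_thr A) (upp_thr ?l G)")
    case True
    show ?thesis
      unfolding pt p'_def tuple_weight_tuple_of[OF n c m] tuple_weight_tuple_of[OF n c' m']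
      using C.config_weight_swap[OF K(1) True m m', of a] unfolding zeq_def by blast
  next
    case False
    \<comment> \<open>Along II-cells the exchange is read backwards: they are I-cells of the new
      configuration, and exchanging again leads back to \<open>p\<close>.\<close>
    then have "K \<subseteq> cells n ?l (upp_thr ?l G) (low_thr A)" using C.is_region_one_type[OF K(1)] unfolding one_type_def by blast
    then have sub: "K \<subseteq> cells n ?l (low_thr ?A) (upp_thr ?l ?G)" unfolding C.cells_swapped[OF K(1)] by blast
    \<comment> \<open>These functions agree with \<open>A\<close> and \<open>G\<close> only at the
      heights of the strips, hence the detour through the tuple.\<close>
    let ?A2 = "swap_A ?l K ?A ?G" and ?G2 = "swap_G ?l K ?A ?G"
    have c2: "config n lam mu ?A2 ?G2" by (rule S.config_swapped[OF K'])
    have m2: "matching ?l (\<lambda>i. ?A2 i 0) (\<lambda>j. ?G2 j 0) \<sigma>"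
      by (rule matching_cong[OF _ _ m]) (use half_paths_of_eqD[OF twice, of _ 0] in auto)
    have "tuple_of n ?l \<sigma> ?A2 ?G2 = p"
      unfolding pt by (rule tuple_unique[OF n lam mu c m tuple_of_in_P1[OF n c2 m2]]) (simp only: pi_map_tuple_of[of ?l ?A2 ?G2, OF m2] twice)
    then have "tuple_weight n a ?l p = zclass n (config_weight n a ?l \<sigma> ?A2 ?G2)"
      using tuple_weight_tuple_of[OF n c2 m2, of a] by simp
    moreover have "tuple_weight n a ?l p' = zclass n (config_weight n a ?l \<sigma>' ?A ?G)"
      unfolding p'_def by (rule tuple_weight_tuple_of[OF n c' m'])
    ultimately show ?thesis using S.config_weight_swap[OF K' sub m' m2, of a] unfolding zeq_def by simp
  qed
  have "sign \<sigma>' = (- 1) ^ card {i \<in> C.J K. even (A i 0 - G (Suc i) 0)} * sign \<sigma>"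
    by (rule matching_swap_sign[OF m dec(2,1) m' dec(4,3) C.J_subset[OF K(1)] C.A'_0[OF K(1)] C.G'_0[OF K(1)]])
  moreover have "{i \<in> C.J K. even (A i 0 - G (Suc i) 0)} =
      {i \<in> {1..<?l}. even (A i 0 - G (Suc i) 0) \<and> flagged K (low_thr A) (upp_thr ?l G) i 0}"
    unfolding C.J_def[OF K(1)] by blast
  \<comment> \<open>The region is odd, so the number of sign changes is odd.\<close>
  ultimately have "sign \<sigma>' = - sign \<sigma>" using K(2) unfolding even_pairs_def by simp
  then have sign: "tuple_sign p' = - tuple_sign p" unfolding pt p'_def tuple_sign_def tuple_of_def by simp
  have "\<exists>!q. is_eps_tuple n lam mu (top_odd_region n ?l p) p q" unfolding top is_eps by blast
  then show ?thesis using ex1 iota iota' p'odd weight sign by simp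
qed

theorem proposition4p12:
  fixes n :: nat and a :: complex and lam mu :: "nat \<Rightarrow> nat"
  assumes "1 \<le> n"
    and "skew_diagram lam mu"
    and "\<forall>i\<in>{1..<lam 1}. int (conj_part lam (i + 1)) - int (conj_part mu i) \<le> int n"
  shows "(\<forall>p\<in>P_odd n lam mu. \<exists>!V. is_top_odd_region n (lam 1) p V) \<and>
    (\<forall>p\<in>P_odd n lam mu. \<exists>!p'. is_eps_tuple n lam mu (top_odd_region n (lam 1) p) p p') \<and>
    iota2 n lam mu \<in> P_odd n lam mu \<rightarrow> P_odd n lam mu \<and>
    (\<forall>p\<in>P_odd n lam mu. iota2 n lam mu (iota2 n lam mu p) = p) \<and>
    (\<forall>p\<in>P_odd n lam mu. tuple_weight n a (lam 1) (iota2 n lam mu p) = tuple_weight n a (lam 1) p) \<and>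
    (\<forall>p\<in>P_odd n lam mu. tuple_sign (iota2 n lam mu p) = - tuple_sign p)"
  using iota2_properties[OF assms] by (auto simp: Pi_iff)

end
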